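(* Let $\overrightarrow{G}$ be a directed graph of order $n$ with no weakly connected components of cardinality (number of vertices) less than $4$. Then $\overrightarrow{G}$ has a $\Gamma$-irregular labeling for every finite Abelian group $\Gamma$ such that $|\Gamma|\geq n+6$.
   Context: A directed graph (digraph) $\overrightarrow{G}$ has a vertex set $V(\overrightarrow{G})$ and arc set $E(\overrightarrow{G})$; its order is the number of vertices. An arc $xy$ is directed from its tail $x$ to its head $y$. For a vertex $x$, $N^+(x)$ denotes the set of vertices $y$ such that $xy$ is an arc, and $N^-(x)$ denotes the set of vertices $y$ such that $yx$ is an arc. Weakly connected components are the connected components of the underlying undirected graph. Digraphs are assumed to have no isolated vertices. Let $\Gamma$ be a finite Abelian group written additively. A $\Gamma$-irregular labeling of $\overrightarrow{G}$ is a mapping $\psi: E(\overrightarrow{G})\to\Gamma$ such that the mapping $\varphi_{\psi}: V(\overrightarrow{G})\to\Gamma$ defined by $$\varphi_{\psi}(x)=\sum_{y\in N^+(x)}\psi(xy)-\sum_{y\in N^-(x)}\psi(yx)\qquad (x\in V(\overrightarrow{G}))$$ is injective. *)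

theory Defs
  imports "Graph_Theory.Digraph_Component" "HOL-Library.Cardinality"
begin

definition out_neighbours :: "'v pair_pre_digraph \<Rightarrow> 'v \<Rightarrow> 'v set" where
  "out_neighbours G x = {y. (x, y) \<in> parcs G}"

definition in_neighbours :: "'v pair_pre_digraph \<Rightarrow> 'v \<Rightarrow> 'v set" where
  "in_neighbours G x = {y. (y, x) \<in> parcs G}"

(* mk_symmetric adds the reverse of every arc, so it encodes the underlying undirected graph;
   strong connectivity in it is connectivity of that graph. *)
definition weak_components :: "'v pair_pre_digraph \<Rightarrow> 'v set set" where
  "weak_components G =
     pre_digraph.sccs_verts (with_proj (mk_symmetric (with_proj G)))"

definition vertex_sum ::
    "'v pair_pre_digraph \<Rightarrow> ('v \<times> 'v \<Rightarrow> 'g::ab_group_add) \<Rightarrow> 'v \<Rightarrow> 'g" where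
  "vertex_sum G \<psi> x =
     (\<Sum>y\<in>out_neighbours G x. \<psi> (x, y)) - (\<Sum>y\<in>in_neighbours G x. \<psi> (y, x))"

(* Only the values of the labeling on the arcs of G matter. *)
definition irregular_labeling ::
    "'v pair_pre_digraph \<Rightarrow> ('v \<times> 'v \<Rightarrow> 'g::ab_group_add) \<Rightarrow> bool" where
  "irregular_labeling G \<psi> \<longleftrightarrow> inj_on (vertex_sum G \<psi>) (pverts G)"

end

theory Submission
  imports Defs "HOL-Library.Multiset"
begin

text \<open>
  The vertex sums of a labeling are what remains when group elements are moved along the arcs.
  On a weak component they can be prescribed freely, as long as they add up to zero. So the
  statement is about the group \<open>\<Gamma>\<close> alone: if \<open>|\<Gamma>| \<ge> n + 6\<close>, then for all sizes at least 4 with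
  total \<open>n\<close> there are pairwise disjoint zero-sum subsets of \<open>\<Gamma>\<close> of these sizes. Write \<open>m = |\<Gamma>|\<close>.
  Splitting off blocks of size 4 leaves only the sizes 4, 5, 6 and 7.

  If there are few involutions, pairs \<open>{x, -x}\<close> settle the even sizes, and an odd size is a zero-sum
  triple plus pairs. There are at most \<open>m / 5\<close> odd sizes, so disjoint zero-sum triples must cover up
  to three fifths of \<open>\<Gamma>\<close>, and what they leave must be closed under negation. They are taken in
  opposite couples \<open>{x, y, z}\<close>, \<open>{-x, -y, -z}\<close> and found one after the other. Suppose the process is
  stuck with more than \<open>2m / 5\<close> unused elements, and let \<open>A\<close> be the symmetric set of these. The Cayley
  graph of \<open>A\<close> is triangle-free with minimum degree above two fifths of its order, so by the argument
  of Andrasfai it is bipartite: \<open>A\<close> misses a subgroup \<open>H\<close> of index 2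
  (\<open>dense_triangle_free_index_two\<close>). Then some couple \<open>{x, y, z}\<close>, \<open>{-x, -y, -z}\<close> lies inside \<open>H\<close>. As \<open>A\<close>
  fills most of the other coset, both \<open>x\<close> and \<open>y\<close> can be completed to triples by elements of \<open>A\<close>,
  which gives one couple more (\<open>family_extend\<close>).

  An involution forms no pair. If \<open>\<Gamma>\<close> has a Klein four-subgroup \<open>K\<close>, its cosets replace the pairs.
  There are two cases.

  \<^item> All doubles \<open>x + x\<close> lie in some \<open>K\<close>. Then every coset of \<open>K\<close> is a zero-sum 4-set, it splits
    into two 2-sets of equal sum in \<open>K\<close>, and three cosets with sum \<open>K\<close> split into four transversals of
    equal sum. Everything is built from these; the disjoint triples of cosets come again
    from \<open>family_extend\<close> (\<open>square_klein_packable\<close>).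

  \<^item> Otherwise the subgroup \<open>\<Omega>\<close> of elements with \<open>x + x = 0\<close> has index at least 3. If \<open>\<Omega>\<close> has
    at most four elements, it can be left out, apart from 0. For larger \<open>\<Omega>\<close> and few odd sizes, the couples
    are found outside \<open>\<Omega>\<close>, and \<open>\<Omega>\<close> is cut into cosets of \<open>K\<close>. With many odd sizes, the
    nonzero elements of \<open>\<Omega>\<close>, up to at most four, are partitioned into lines \<open>{x, y, x + y}\<close>, each of
    which serves one odd size, and couples outside \<open>\<Omega>\<close> provide the remaining triples
    (\<open>packable_without_square_klein_subgroup\<close>).

  Parities are adjusted by the element 0, which turns a zero-sum set of even size into one of odd
  size.
\<close>

section \<open>Vertex sums on a weak component\<close>

lemma vertex_sum_add:
  "vertex_sum G (\<lambda>e. \<psi> e + \<chi> e) x = vertex_sum G \<psi> x + vertex_sum G \<chi> x"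
  by (simp add: vertex_sum_def sum.distrib algebra_simps)

lemma vertex_sum_sum:
  assumes "finite I"
  shows "vertex_sum G (\<lambda>e. \<Sum>i\<in>I. \<psi> i e) x = (\<Sum>i\<in>I. vertex_sum G (\<psi> i) x)"
  unfolding vertex_sum_def
  by (simp add: sum_subtractf sum.swap[of _ I])

lemma vertex_sum_single_arc:
  assumes "pair_fin_digraph G" "(u, v) \<in> parcs G"
  shows "vertex_sum G (\<lambda>e. if e = (u, v) then g else 0) x =
    (if x = u then g else 0) - (if x = v then g else 0)"
proof -
  interpret pair_fin_digraph G by fact
  have "finite (parcs G)" by simp
  then have fo: "finite (out_neighbours G x)" and fi: "finite (in_neighbours G x)"
  proof -
    have "out_neighbours G x \<subseteq> snd ` parcs G" "in_neighbours G x \<subseteq> fst ` parcs G"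
      by (force simp: out_neighbours_def in_neighbours_def)+
    with \<open>finite (parcs G)\<close> show "finite (out_neighbours G x)" "finite (in_neighbours G x)"
      by (meson finite_imageI finite_subset)+
  qed
  have "(\<Sum>y\<in>out_neighbours G x. if (x, y) = (u, v) then g else 0) = (if x = u then g else 0)"
    using fo assms(2) by (auto simp: out_neighbours_def)
  moreover have "(\<Sum>y\<in>in_neighbours G x. if (y, x) = (u, v) then g else 0) = (if x = v then g else 0)"
    using fi assms(2) by (auto simp: in_neighbours_def)
  ultimately show ?thesis by (simp only: vertex_sum_def)
qed

text \<open>
  A group element can be carried along any undirected walk: an arc traversed backwards gets the
  opposite label.
\<close>

lemma vertex_sum_transport:
  assumes "pair_fin_digraph G"
    and "u \<rightarrow>\<^sup>*\<^bsub>with_proj (mk_symmetric (with_proj G))\<^esub> v"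
  shows "\<exists>\<psi>. \<forall>x. vertex_sum G \<psi> x = (if x = u then g else 0) - (if x = v then g else 0)"
proof -
  have "(u, v) \<in> rtrancl_on (pverts G) (parcs (mk_symmetric (with_proj G)))"
    using assms(2) by (simp add: reachable_def)
  then have "(u, v) \<in> (parcs (mk_symmetric (with_proj G)))\<^sup>*"
    by (rule rtrancl_on_rtranclI)
  then show ?thesis
  proof induction
    case base
    have "\<forall>x. vertex_sum G (\<lambda>e. 0) x = (if x = u then g else 0) - (if x = u then g else 0)"
      by (simp add: vertex_sum_def)
    then show ?case by blast
  next
    case (step v w)
    then obtain \<psi> where \<psi>: "\<forall>x. vertex_sum G \<psi> x = (if x = u then g else 0) - (if x = v then g else 0)"
      by blast
    have "\<exists>\<chi>. \<forall>x. vertex_sum G \<chi> x = (if x = v then g else 0) - (if x = w then g else 0)"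
    proof (cases "(v, w) \<in> parcs G")
      case True
      then show ?thesis using vertex_sum_single_arc[OF assms(1)] by blast
    next
      case False
      then have "(w, v) \<in> parcs G" using step.hyps by (auto simp: parcs_mk_symmetric)
      then have "\<forall>x. vertex_sum G (\<lambda>e. if e = (w, v) then - g else 0) x
          = (if x = w then - g else 0) - (if x = v then - g else 0)"
        using vertex_sum_single_arc[OF assms(1)] by blast
      then have "\<forall>x. vertex_sum G (\<lambda>e. if e = (w, v) then - g else 0) x
          = (if x = v then g else 0) - (if x = w then g else 0)"
        by auto
      then show ?thesis by blast
    qed
    then obtain \<chi> where \<chi>: "\<forall>x. vertex_sum G \<chi> x = (if x = v then g else 0) - (if x = w then g else 0)"
      by blast
    have "\<forall>x. vertex_sum G (\<lambda>e. \<psi> e + \<chi> e) x = (if x = u then g else 0) - (if x = w then g else 0)"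
      using \<psi> \<chi> by (simp add: vertex_sum_add)
    then show ?case by blast
  qed
qed

text \<open>
  Every vertex sends its weight to a common root of its component. The root receives the total
  weight of the component, which is zero, so it keeps exactly its own weight.
\<close>

lemma prescribed_vertex_sums:
  fixes G :: "'v pair_pre_digraph" and w :: "'v \<Rightarrow> 'g::ab_group_add"
  assumes G: "pair_fin_digraph G"
    and zero: "\<And>C. C \<in> weak_components G \<Longrightarrow> sum w C = 0"
  shows "\<exists>\<psi>. \<forall>x\<in>pverts G. vertex_sum G \<psi> x = w x"
proof -
  interpret pair_fin_digraph G by fact
  let ?H = "with_proj (mk_symmetric (with_proj G))"
  interpret H: pair_fin_digraph "mk_symmetric (with_proj G)" ..
  define comp where "comp v = pre_digraph.scc_of ?H v" for v
  define root where "root v = (SOME r. r \<in> comp v)" for v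
  have comp: "comp v \<in> weak_components G" "v \<in> comp v" if "v \<in> pverts G" for v
    using that H.scc_of_in_sccs_verts[of v] H.in_scc_of_self[of v]
    by (auto simp: comp_def weak_components_def)
  have comp_eq: "comp x = C" if "C \<in> weak_components G" "x \<in> C" for x C
  proof -
    have "x \<in> pverts G" using that H.sccs_verts_subsets[of C] by (auto simp: weak_components_def)
    then show ?thesis using comp[of x] that H.sccs_verts_disjoint[of C "comp x"]
      by (auto simp: weak_components_def)
  qed
  have root: "root v \<in> comp v" if "v \<in> pverts G" for v
    using comp(2)[OF that] unfolding root_def by (rule someI)
  have "\<exists>\<psi>. \<forall>x. vertex_sum G \<psi> x = (if x = v then w v else 0) - (if x = root v then w v else 0)"
    if "v \<in> pverts G" for v
  proof (rule vertex_sum_transport[OF G])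
    show "v \<rightarrow>\<^sup>*\<^bsub>?H\<^esub> root v"
      using comp[OF that] root[OF that] by (auto simp: weak_components_def H.in_sccs_verts_conv_reachable)
  qed
  then obtain \<psi> where \<psi>: "\<And>v x. v \<in> pverts G \<Longrightarrow>
      vertex_sum G (\<psi> v) x = (if x = v then w v else 0) - (if x = root v then w v else 0)"
    by metis
  have fin: "finite (pverts G)" by simp
  have "vertex_sum G (\<lambda>e. \<Sum>v\<in>pverts G. \<psi> v e) x = w x" if x: "x \<in> pverts G" for x
  proof -
    have "vertex_sum G (\<lambda>e. \<Sum>v\<in>pverts G. \<psi> v e) x
        = (\<Sum>v\<in>pverts G. (if x = v then w v else 0) - (if x = root v then w v else 0))"
      using \<psi> by (simp add: vertex_sum_sum[OF fin])
    also have "\<dots> = w x - (\<Sum>v\<in>pverts G. if x = root v then w v else 0)"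
      using x fin by (simp add: sum_subtractf)
    also have "(\<Sum>v\<in>pverts G. if x = root v then w v else 0) = 0"
    proof (cases "x = root x")
      case True
      have "{v \<in> pverts G. x = root v} = comp x"
      proof (intro set_eqI iffI)
        fix v assume "v \<in> {v \<in> pverts G. x = root v}"
        then show "v \<in> comp x" using comp[of v] root[of v] comp_eq[of "comp v" x] by auto
      next
        fix v assume v: "v \<in> comp x"
        then have "v \<in> pverts G"
          using comp(1)[OF x] H.sccs_verts_subsets[of "comp x"] by (auto simp: weak_components_def)
        moreover have "comp v = comp x" using comp_eq[OF comp(1)[OF x] v] .
        ultimately show "v \<in> {v \<in> pverts G. x = root v}" using True by (simp add: root_def)
      qed
      then have "(\<Sum>v\<in>pverts G. if x = root v then w v else 0) = sum w (comp x)"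
        using sum.inter_filter[OF fin, of w "\<lambda>v. x = root v"] by simp
      then show ?thesis using zero[OF comp(1)[OF x]] by simp
    next
      case False
      have "root v \<noteq> x" if "v \<in> pverts G" for v
      proof
        assume "root v = x"
        then have "x \<in> comp v" using root[OF that] by simp
        then have "comp x = comp v" using comp_eq comp(1)[OF that] by blast
        then show False using False \<open>root v = x\<close> by (simp add: root_def)
      qed
      then show ?thesis by (intro sum.neutral) auto
    qed
    finally show ?thesis by simp
  qed
  then show ?thesis by blast
qed

section \<open>Disjoint zero-sum sets of prescribed sizes\<close>

text \<open>
  Disjointness is expressed by removing each chosen set from the available elements, so that sets
  can be merged, dropped and reordered without naming them.
\<close>

inductive packable :: "'g::ab_group_add set \<Rightarrow> nat multiset \<Rightarrow> bool" where
  packable_empty: "packable U {#}"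
| packable_add: "S \<subseteq> U \<Longrightarrow> finite S \<Longrightarrow> \<Sum>S = 0 \<Longrightarrow> packable (U - S) L \<Longrightarrow>
    packable U (add_mset (card S) L)"

lemma packable_mono: "packable U L \<Longrightarrow> U \<subseteq> U' \<Longrightarrow> packable U' L"
proof (induction arbitrary: U' rule: packable.induct)
  case (packable_add S U L)
  then have "packable (U' - S) L" by (meson Diff_mono order_refl)
  with packable_add show ?case by (intro packable.packable_add) auto
qed (rule packable_empty)

lemma packable_obtain:
  assumes "packable U (add_mset a L)"
  obtains S where "S \<subseteq> U" "finite S" "card S = a" "\<Sum>S = 0" "packable (U - S) L"
proof -
  have "packable U M \<Longrightarrow> M = add_mset a L \<Longrightarrow>
      \<exists>S\<subseteq>U. finite S \<and> card S = a \<and> \<Sum>S = 0 \<and> packable (U - S) L" for M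
  proof (induction U M arbitrary: L rule: packable.induct)
    case (packable_add S U L0)
    show ?case
    proof (cases "card S = a \<and> L0 = L")
      case True
      then show ?thesis using packable_add by blast
    next
      case False
      then obtain L1 where L1: "L0 = add_mset a L1" "L = add_mset (card S) L1"
        using packable_add.prems by (auto simp: add_eq_conv_ex)
      obtain S' where S': "S' \<subseteq> U - S" "finite S'" "card S' = a" "\<Sum>S' = 0" "packable (U - S - S') L1"
        using packable_add.IH[OF L1(1)] by blast
      have "packable (U - S') (add_mset (card S) L1)"
      proof (rule packable.packable_add)
        show "packable (U - S' - S) L1" using S'(5) by (simp add: Diff_Diff_Int Diff_eq inf_commute inf_left_commute)
      qed (use packable_add.hyps S' in auto)
      then show ?thesis using S' L1 by blast
    qed
  qed simp
  with assms that show thesis by blast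
qed

lemma packable_drop: "packable U (add_mset a L) \<Longrightarrow> packable U L"
  by (metis Diff_subset packable_mono packable_obtain)

lemma packable_merge:
  assumes "packable U (add_mset a (add_mset b L))"
  shows "packable U (add_mset (a + b) L)"
proof -
  obtain S where S: "S \<subseteq> U" "finite S" "card S = a" "\<Sum>S = 0" "packable (U - S) (add_mset b L)"
    using assms by (rule packable_obtain)
  obtain T where T: "T \<subseteq> U - S" "finite T" "card T = b" "\<Sum>T = 0" "packable (U - S - T) L"
    using S(5) by (rule packable_obtain)
  have disj: "S \<inter> T = {}" using T(1) by blast
  have "packable U (add_mset (card (S \<union> T)) L)"
  proof (rule packable_add)
    show "\<Sum>(S \<union> T) = 0" using S T disj by (simp add: sum.union_disjoint)
    show "packable (U - (S \<union> T)) L" using T(5) by (simp add: Diff_Un Diff_Int2 set_diff_eq Int_def conj_ac)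
  qed (use S T in auto)
  then show ?thesis using S T disj by (simp add: card_Un_disjoint)
qed

lemma packable_union:
  "packable U L \<Longrightarrow> packable U' L' \<Longrightarrow> U \<inter> U' = {} \<Longrightarrow> packable (U \<union> U') (L + L')"
proof (induction rule: packable.induct)
  case (packable_empty U)
  then show ?case using packable_mono[of U' L'] by simp
next
  case (packable_add S U L)
  then have "packable ((U - S) \<union> U') (L + L')" by blast
  moreover have "(U - S) \<union> U' = (U \<union> U') - S" using packable_add by blast
  ultimately show ?case using packable_add.hyps packable.packable_add[of S "U \<union> U'" "L + L'"]
    by auto
qed

lemma packable_single:
  "finite S \<Longrightarrow> \<Sum>S = 0 \<Longrightarrow> packable S {#card S#}"
  using packable_add[of S S "{#}"] packable_empty by auto

lemma packable_subset_mset: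
  assumes "packable U M" "L \<subseteq># M"
  shows "packable U L"
proof -
  have "packable U (L + N) \<Longrightarrow> packable U L" for N
    by (induction N) (auto dest: packable_drop)
  with assms show ?thesis by (metis mset_subset_eq_exists_conv)
qed

lemma packable_assignment:
  assumes "finite \<C>" "packable U (image_mset f (mset_set \<C>))"
  shows "\<exists>S. (\<forall>C\<in>\<C>. S C \<subseteq> U \<and> finite (S C) \<and> card (S C) = f C \<and> \<Sum>(S C) = 0) \<and>
    (\<forall>C\<in>\<C>. \<forall>D\<in>\<C>. C \<noteq> D \<longrightarrow> S C \<inter> S D = {})"
  using assms
proof (induction arbitrary: U rule: finite_induct)
  case (insert C \<C>)
  then have "packable U (add_mset (f C) (image_mset f (mset_set \<C>)))" by simp
  then obtain T where T: "T \<subseteq> U" "finite T" "card T = f C" "\<Sum>T = 0"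
      "packable (U - T) (image_mset f (mset_set \<C>))"
    by (rule packable_obtain)
  obtain S where S: "\<forall>C\<in>\<C>. S C \<subseteq> U - T \<and> finite (S C) \<and> card (S C) = f C \<and> \<Sum>(S C) = 0"
      "\<forall>C\<in>\<C>. \<forall>D\<in>\<C>. C \<noteq> D \<longrightarrow> S C \<inter> S D = {}"
    using insert.IH[OF T(5)] by blast
  show ?case
  proof (intro exI[of _ "S(C := T)"] conjI ballI impI)
    fix D assume "D \<in> insert C \<C>"
    then show "(S(C := T)) D \<subseteq> U" "finite ((S(C := T)) D)" "card ((S(C := T)) D) = f D"
      "\<Sum>((S(C := T)) D) = 0"
      using S T by auto
  next
    fix D E assume "D \<in> insert C \<C>" "E \<in> insert C \<C>" "D \<noteq> E"
    then show "(S(C := T)) D \<inter> (S(C := T)) E = {}"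
      using S by (auto simp: fun_upd_def; blast)
  qed
qed simp

section \<open>Dense symmetric sets without zero-sum triples\<close>

primrec iterated_sumset :: "'g::ab_group_add set \<Rightarrow> nat \<Rightarrow> 'g set" where
  "iterated_sumset A 0 = {0}"
| "iterated_sumset A (Suc n) = {a + s | a s. a \<in> A \<and> s \<in> iterated_sumset A n}"

lemma iterated_sumset_SucI:
  "a \<in> A \<Longrightarrow> s \<in> iterated_sumset A n \<Longrightarrow> a + s \<in> iterated_sumset A (Suc n)"
  by auto

lemma iterated_sumset_add:
  "x \<in> iterated_sumset A m \<Longrightarrow> y \<in> iterated_sumset A n \<Longrightarrow> x + y \<in> iterated_sumset A (m + n)"
proof (induction m arbitrary: x)
  case (Suc m)
  then obtain a s where "x = a + s" "a \<in> A" "s \<in> iterated_sumset A m" by auto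
  then show ?case using Suc.IH[of s] Suc.prems(2) by (auto simp: add.assoc)
qed simp

lemma iterated_sumset_uminus:
  "(\<And>a. a \<in> A \<Longrightarrow> - a \<in> A) \<Longrightarrow> x \<in> iterated_sumset A n \<Longrightarrow> - x \<in> iterated_sumset A n"
proof (induction n arbitrary: x)
  case (Suc n)
  then obtain a s where as: "x = a + s" "a \<in> A" "s \<in> iterated_sumset A n" by auto
  then have "- s \<in> iterated_sumset A n" "- a \<in> A" using Suc.IH[of s] Suc.prems(1) by blast+
  moreover have "- x = - a + - s" using as by simp
  ultimately show ?case using iterated_sumset_SucI by metis
qed simp

text \<open>
  Translates of \<open>A\<close> by the five points of a closed walk cover no element three times if translates
  by cyclically adjacent points are disjoint: a 5-cycle has no three pairwise non-adjacent vertices.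
\<close>

lemma card_le_double_of_pentagon:
  fixes A :: "'g::{finite, ab_group_add} set" and c :: "nat \<Rightarrow> 'g"
  assumes adj: "\<And>v. v - c 0 \<in> A \<Longrightarrow> v - c 1 \<notin> A" "\<And>v. v - c 1 \<in> A \<Longrightarrow> v - c 2 \<notin> A"
    "\<And>v. v - c 2 \<in> A \<Longrightarrow> v - c 3 \<notin> A" "\<And>v. v - c 3 \<in> A \<Longrightarrow> v - c 4 \<notin> A"
    "\<And>v. v - c 0 \<in> A \<Longrightarrow> v - c 4 \<notin> A"
  shows "5 * card A \<le> 2 * CARD('g)"
proof -
  have card: "(\<Sum>v\<in>UNIV. of_bool (v - c i \<in> A)) = card A" for i
  proof -
    have "{v. v - c i \<in> A} = (\<lambda>a. a + c i) ` A"
      by (force simp: image_iff)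
    then have "card {v. v - c i \<in> A} = card A"
      by (simp add: card_image)
    moreover have "(\<Sum>v\<in>UNIV. of_bool (v - c i \<in> A)) = card {v. v - c i \<in> A}"
      by (simp add: of_bool_def sum.If_cases)
    ultimately show ?thesis by simp
  qed
  have "5 * card A = (\<Sum>v\<in>UNIV. of_bool (v - c 0 \<in> A) + of_bool (v - c 1 \<in> A)
      + of_bool (v - c 2 \<in> A) + of_bool (v - c 3 \<in> A) + of_bool (v - c 4 \<in> A))"
    by (simp only: sum.distrib card)
  also have "\<dots> \<le> (\<Sum>v\<in>(UNIV::'g set). 2)"
  proof (rule sum_mono)
    fix v
    show "of_bool (v - c 0 \<in> A) + of_bool (v - c 1 \<in> A) + of_bool (v - c 2 \<in> A)
        + of_bool (v - c 3 \<in> A) + of_bool (v - c 4 \<in> A) \<le> (2::nat)"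
      using adj[of v] by (auto simp: of_bool_def)
  qed
  finally show ?thesis by simp
qed

text \<open>
  In a shortest odd zero-sum sequence over \<open>A\<close>, five consecutive partial sums satisfy the hypothesis
  of the pentagon count. An element with two neighbours among them at the wrong distance
  would close a triangle or a shorter odd walk. This is the argument of Andrasfai for dense
  triangle-free graphs, in a Cayley graph.
\<close>

lemma no_odd_zero_sum_of_dense:
  fixes A :: "'g::{finite, ab_group_add} set"
  assumes sym: "\<And>a. a \<in> A \<Longrightarrow> - a \<in> A"
    and free: "\<And>x y z. x \<in> A \<Longrightarrow> y \<in> A \<Longrightarrow> z \<in> A \<Longrightarrow> x + y + z \<noteq> 0"
    and dense: "2 * CARD('g) < 5 * card A" and "odd n"
  shows "0 \<notin> iterated_sumset A n"
proof
  assume ex: "0 \<in> iterated_sumset A n"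
  define L where "L = (LEAST l. odd l \<and> 0 \<in> iterated_sumset A l)"
  have L: "odd L" "0 \<in> iterated_sumset A L"
    using LeastI[of "\<lambda>l. odd l \<and> 0 \<in> iterated_sumset A l" n] ex \<open>odd n\<close> by (auto simp: L_def)
  have minimal: "\<not> (odd l \<and> 0 \<in> iterated_sumset A l)" if "l < L" for l
    using not_less_Least that unfolding L_def by blast
  have "L \<noteq> 1" using L(2) free[of 0 0 0] by auto
  moreover have "L \<noteq> 3"
  proof
    assume "L = 3"
    then obtain x y z where "x \<in> A" "y \<in> A" "z \<in> A" "0 = x + (y + z)"
      using L(2) by (auto simp: numeral_3_eq_3)
    then show False using free[of x y z] by (simp add: add.assoc)
  qed
  ultimately have "L \<ge> 5" using L(1) by presburger
  define r where "r = L - 4"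
  have r: "L = Suc (Suc (Suc (Suc r)))" using \<open>L \<ge> 5\<close> by (simp add: r_def)
  obtain a1 a2 a3 a4 s where a: "a1 \<in> A" "a2 \<in> A" "a3 \<in> A" "a4 \<in> A" "s \<in> iterated_sumset A r"
      "0 = a1 + (a2 + (a3 + (a4 + s)))"
    using L(2) unfolding r by auto
  define c where "c i = [0, a1, a1 + a2, a1 + a2 + a3, a1 + a2 + a3 + a4] ! i" for i :: nat
  have step: "v - q \<notin> A" if "v - p \<in> A" "q - p \<in> A" for v p q
  proof
    assume "v - q \<in> A"
    then have "(v - p) + - (v - q) + - (q - p) \<noteq> 0" using free that sym by blast
    then show False by simp
  qed
  \<comment> \<open>A common neighbour of the two ends shortcuts four steps of the closed walk by two.\<close>
  have wrap: "v - c 4 \<notin> A" if v: "v - c 0 \<in> A" for v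
  proof
    assume "v - c 4 \<in> A"
    then have "- (v - c 4) + s \<in> iterated_sumset A (Suc r)" using a(5) sym by (intro iterated_sumset_SucI)
    then have "(v - c 0) + (- (v - c 4) + s) \<in> iterated_sumset A (Suc (Suc r))"
      using v by (rule iterated_sumset_SucI[rotated])
    moreover have "(v - c 0) + (- (v - c 4) + s) = 0"
      using a(6) by (simp add: c_def algebra_simps)
    ultimately have "0 \<in> iterated_sumset A (Suc (Suc r))" by metis
    moreover have "odd (Suc (Suc r))" "Suc (Suc r) < L" using L(1) r by auto
    ultimately show False using minimal by blast
  qed
  have "c 1 - c 0 \<in> A" "c 2 - c 1 \<in> A" "c 3 - c 2 \<in> A" "c 4 - c 3 \<in> A"
    using a(1-4) by (simp_all add: c_def)
  then have "5 * card A \<le> 2 * CARD('g)"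
    using step wrap by (intro card_le_double_of_pentagon[of c A]) blast+
  with dense show False by simp
qed

text \<open>
  The sums of evenly many elements of \<open>A\<close> form a subgroup \<open>H\<close>. It misses \<open>A\<close>, since otherwise there
  would be an odd zero-sum sequence. A translate of \<open>H\<close> contains \<open>A\<close>, hence \<open>H\<close> has more than two fifths
  of the elements, and there is no room for a third coset.
\<close>

lemma dense_triangle_free_index_two:
  fixes A :: "'g::{finite, ab_group_add} set"
  assumes sym: "\<And>a. a \<in> A \<Longrightarrow> - a \<in> A"
    and free: "\<And>x y z. x \<in> A \<Longrightarrow> y \<in> A \<Longrightarrow> z \<in> A \<Longrightarrow> x + y + z \<noteq> 0"
    and dense: "2 * CARD('g) < 5 * card A"
  obtains H where "\<And>x y. x \<in> H \<Longrightarrow> y \<in> H \<Longrightarrow> x + y \<in> H" "\<And>x. x \<in> H \<Longrightarrow> - x \<in> H"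
    "\<And>x y. x \<notin> H \<Longrightarrow> y \<notin> H \<Longrightarrow> x + y \<in> H" "2 * card H = CARD('g)" "A \<inter> H = {}"
proof
  define H where "H = (\<Union>n\<in>{n. even n}. iterated_sumset A n)"
  show add: "x + y \<in> H" if xy: "x \<in> H" "y \<in> H" for x y
  proof -
    obtain i j where ij: "even i" "x \<in> iterated_sumset A i" "even j" "y \<in> iterated_sumset A j"
      using xy by (auto simp: H_def)
    then have "x + y \<in> iterated_sumset A (i + j)" by (intro iterated_sumset_add)
    then show ?thesis using ij unfolding H_def by (intro UN_I[of "i + j"]) simp_all
  qed
  show neg: "- x \<in> H" if "x \<in> H" for x
    using that iterated_sumset_uminus[OF sym] by (auto simp: H_def)
  have one: "a \<in> iterated_sumset A 1" if "a \<in> A" for a using that by simp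
  show disj: "A \<inter> H = {}"
  proof (rule ccontr)
    assume "A \<inter> H \<noteq> {}"
    then obtain a n where "a \<in> A" "even n" "a \<in> iterated_sumset A n" by (auto simp: H_def)
    then have "- a + a \<in> iterated_sumset A (1 + n)"
      using iterated_sumset_add[OF one] sym by blast
    then show False using no_odd_zero_sum_of_dense[OF sym free dense, of "1 + n"] \<open>even n\<close> by simp
  qed
  have "A \<noteq> {}" using dense by auto
  then obtain a0 where a0: "a0 \<in> A" by blast
  have coset: "A \<subseteq> (+) a0 ` H"
  proof
    fix a assume "a \<in> A"
    then have "- a0 + a \<in> iterated_sumset A (1 + 1)"
      using iterated_sumset_add[OF one one] sym a0 by blast
    then have "- a0 + a \<in> H" unfolding H_def by (intro UN_I[of 2]) (simp_all add: numeral_2_eq_2)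
    then show "a \<in> (+) a0 ` H" by (intro image_eqI[of _ _ "- a0 + a"]) simp_all
  qed
  then have "card A \<le> card H"
    using card_mono[of "(+) a0 ` H" A] by (simp add: card_image)
  then have big: "2 * CARD('g) < 5 * card H" using dense by linarith
  have disj_coset: "p + h \<notin> H" if "p \<notin> H" "h \<in> H" for p h
    using add[OF _ neg[OF that(2)], of "p + h"] that by auto
  have cover: "v - a0 \<in> H" if v: "v \<notin> H" for v
  proof (rule ccontr)
    assume "v - a0 \<notin> H"
    have a0H: "a0 \<notin> H" using disj a0 by blast
    have "H \<inter> (+) a0 ` H = {}" "H \<inter> (+) v ` H = {}"
      using disj_coset a0H v by auto
    moreover have "(+) a0 ` H \<inter> (+) v ` H = {}"
    proof (rule ccontr)
      assume "(+) a0 ` H \<inter> (+) v ` H \<noteq> {}"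
      then obtain h k where "h \<in> H" "k \<in> H" "a0 + h = v + k" by auto
      then have "v - a0 = h + - k" by (simp add: algebra_simps)
      then show False using \<open>v - a0 \<notin> H\<close> add[OF \<open>h \<in> H\<close> neg[OF \<open>k \<in> H\<close>]] by simp
    qed
    ultimately have "card (H \<union> (+) a0 ` H \<union> (+) v ` H) = 3 * card H"
      by (simp add: card_Un_disjoint Int_Un_distrib2 card_image)
    then have "3 * card H \<le> CARD('g)" by (metis card_mono finite top_greatest)
    then show False using big by linarith
  qed
  have "UNIV = H \<union> (+) a0 ` H"
  proof (intro equalityI subsetI)
    fix v show "v \<in> H \<union> (+) a0 ` H"
      using cover[of v] by (cases "v \<in> H") (auto intro!: image_eqI[of _ _ "v - a0"])
  qed simp
  moreover have "H \<inter> (+) a0 ` H = {}" using disj_coset disj a0 by auto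
  ultimately have "CARD('g) = card H + card ((+) a0 ` H)"
    by (metis card_Un_disjoint finite)
  then show "2 * card H = CARD('g)" by (simp add: card_image)
  show "x + y \<in> H" if "x \<notin> H" "y \<notin> H" for x y
  proof -
    have "a0 + a0 \<in> H"
      using iterated_sumset_add[OF one one, OF a0 a0] unfolding H_def
      by (intro UN_I[of 2]) (simp_all add: numeral_2_eq_2)
    then have "(x - a0) + (y - a0) + (a0 + a0) \<in> H" using cover that add by blast
    then show ?thesis by (simp add: algebra_simps)
  qed
qed

section \<open>Disjoint zero-sum triples of classes\<close>

text \<open>
  Two systems of classes are used: the couples \<open>{x, -x}\<close> of elements of order greater than 2, and
  the cosets of a Klein four-subgroup that contains all doubles. The condition \<open>cls_shift\<close> is what
  they share: elements of one class are opposite or differ by a common period of all classes. It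
  keeps each class on one side of an index-2 subgroup whose complement contains a class.
\<close>

locale class_system =
  fixes V :: "'g::{finite, ab_group_add} set" and cls :: "'g \<Rightarrow> 'g set" and c :: nat
  assumes cls_self: "x \<in> V \<Longrightarrow> x \<in> cls x"
    and cls_subset: "x \<in> V \<Longrightarrow> cls x \<subseteq> V"
    and card_cls: "x \<in> V \<Longrightarrow> card (cls x) = c"
    and cls_uminus: "x \<in> V \<Longrightarrow> - x \<in> cls x"
    and cls_eq: "x \<in> V \<Longrightarrow> y \<in> cls x \<Longrightarrow> cls y = cls x"
    and cls_shift: "x \<in> V \<Longrightarrow> y \<in> cls x \<Longrightarrow> a \<in> V \<Longrightarrow> y = - x \<or> y - x + a \<in> cls a"
begin

definition triple :: "'g \<times> 'g \<times> 'g \<Rightarrow> bool" where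
  "triple = (\<lambda>(x, y, z). x \<in> V \<and> y \<in> V \<and> z \<in> V \<and> x + y + z = 0 \<and>
     cls x \<noteq> cls y \<and> cls x \<noteq> cls z \<and> cls y \<noteq> cls z)"

definition block :: "'g \<times> 'g \<times> 'g \<Rightarrow> 'g set" where
  "block = (\<lambda>(x, y, z). cls x \<union> cls y \<union> cls z)"

definition family :: "('g \<times> 'g \<times> 'g) set \<Rightarrow> bool" where
  "family D \<longleftrightarrow> (\<forall>d\<in>D. triple d) \<and> (\<forall>d\<in>D. \<forall>e\<in>D. d \<noteq> e \<longrightarrow> block d \<inter> block e = {})"

definition used :: "('g \<times> 'g \<times> 'g) set \<Rightarrow> 'g set" where
  "used D = \<Union> (block ` D)"

lemma cls_disjoint: "x \<in> V \<Longrightarrow> y \<in> V \<Longrightarrow> cls x \<noteq> cls y \<Longrightarrow> cls x \<inter> cls y = {}"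
  using cls_eq by blast

lemma card_block:
  assumes "triple d"
  shows "card (block d) = 3 * c"
proof -
  obtain x y z where d: "d = (x, y, z)" by (cases d)
  have "cls x \<inter> cls y = {}" "cls x \<inter> cls z = {}" "cls y \<inter> cls z = {}"
    and "card (cls x) = c" "card (cls y) = c" "card (cls z) = c"
    using assms cls_disjoint card_cls unfolding d triple_def by simp_all
  then show ?thesis unfolding d block_def by (simp add: card_Un_disjoint Int_Un_distrib2)
qed

lemma block_subset: "triple d \<Longrightarrow> block d \<subseteq> V"
  using cls_subset by (auto simp: triple_def block_def)

lemma card_used: "family D \<Longrightarrow> card (used D) = 3 * c * card D"
  unfolding used_def
  by (subst card_UN_disjoint) (auto simp: family_def card_block)

lemma used_subset: "family D \<Longrightarrow> used D \<subseteq> V"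
  using block_subset by (auto simp: family_def used_def)

lemma block_closed:
  assumes "triple d" "x \<in> block d"
  shows "cls x \<subseteq> block d"
proof -
  obtain p q r where d: "d = (p, q, r)" by (cases d)
  then consider "x \<in> cls p" | "x \<in> cls q" | "x \<in> cls r"
    using assms(2) by (auto simp: block_def)
  then have "cls x = cls p \<or> cls x = cls q \<or> cls x = cls r"
    using cls_eq assms(1) unfolding d triple_def by cases simp_all
  then show ?thesis unfolding d block_def by auto
qed

lemma unused_closed:
  assumes "family D" "x \<in> V - used D"
  shows "cls x \<subseteq> V - used D"
proof
  fix y assume y: "y \<in> cls x"
  then have yV: "y \<in> V" using assms(2) cls_subset by auto
  have xy: "x \<in> cls y" using cls_eq[of x y] y assms(2) cls_self by auto
  have "y \<notin> used D"
  proof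
    assume "y \<in> used D"
    then obtain d where d: "d \<in> D" "y \<in> block d" by (auto simp: used_def)
    then have "x \<in> block d" using block_closed[of d y] assms(1) xy by (auto simp: family_def)
    then show False using d(1) assms(2) by (auto simp: used_def)
  qed
  with yV show "y \<in> V - used D" by blast
qed

lemma block_nonempty: "triple d \<Longrightarrow> block d \<noteq> {}"
  using cls_self by (auto simp: triple_def block_def)

lemma family_insert:
  assumes "family D" "triple d" "block d \<inter> used D = {}"
  shows "family (insert d D)" "card (insert d D) = Suc (card D)"
proof -
  have "d \<notin> D" using assms(3) block_nonempty[OF assms(2)] by (auto simp: used_def)
  then show "card (insert d D) = Suc (card D)" by simp
  show "family (insert d D)"
    using assms by (auto simp: family_def used_def)
qed

text \<open>
  If no unused triple is left, the unused set \<open>A\<close> lies in the nontrivial coset of a subgroup \<open>H\<close> of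
  index 2. All of \<open>V \<inter> H\<close> is used. A triple that meets both cosets has one class in \<open>H\<close> and
  two outside, so if all triples were of this kind, there would be too many used elements outside
  \<open>H\<close>. Hence some triple \<open>(x, y, z)\<close> lies in \<open>H\<close>, and it is traded for two triples \<open>(x, a, b)\<close> and
  \<open>(y, a', b')\<close> with \<open>a\<close>, \<open>b\<close>, \<open>a'\<close>, \<open>b'\<close> in \<open>A\<close>. At most \<open>e + 4 * c\<close> choices of \<open>a'\<close> are spoilt. The bound 46
  is implied in this situation, because \<open>A\<close> has at least \<open>(2 * m + 23) / 5\<close> and at most \<open>m / 2\<close> elements
  in a group of order \<open>m\<close>.
\<close>

lemma family_extend:
  assumes fam: "family D" and dense: "2 * CARD('g) + 23 \<le> 5 * card (V - used D)"
    and degenerate: "\<And>A x y z. A \<subseteq> V \<Longrightarrow> (\<And>x. x \<in> A \<Longrightarrow> cls x \<subseteq> A) \<Longrightarrow>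
      2 * CARD('g) + 23 \<le> 5 * card A \<Longrightarrow>
      (\<And>x y z. x \<in> A \<Longrightarrow> y \<in> A \<Longrightarrow> z \<in> A \<Longrightarrow> \<not> triple (x, y, z)) \<Longrightarrow>
      x \<in> A \<Longrightarrow> y \<in> A \<Longrightarrow> z \<in> A \<Longrightarrow> x + y + z \<noteq> 0"
    and few: "\<And>x. x \<in> V \<Longrightarrow> card {a \<in> V. - x - a \<in> cls a} \<le> e"
    and e: "46 \<le> CARD('g) \<Longrightarrow> 10 * (e + 4 * c) < 3 * CARD('g) + 92"
    and V: "46 \<le> CARD('g) \<Longrightarrow> 5 * card (- V) \<le> CARD('g)"
  shows "\<exists>D'. family D' \<and> card D' = Suc (card D)"
proof (rule ccontr)
  assume no: "\<not> ?thesis"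
  define A where "A = V - used D"
  have AV: "A \<subseteq> V" by (auto simp: A_def)
  have Acl: "cls x \<subseteq> A" if "x \<in> A" for x using unused_closed[OF fam] that by (auto simp: A_def)
  have noT: "\<not> triple (x, y, z)" if "x \<in> A" "y \<in> A" "z \<in> A" for x y z
  proof
    assume t: "triple (x, y, z)"
    have "block (x, y, z) \<subseteq> A" using Acl that by (auto simp: block_def)
    then have "block (x, y, z) \<inter> used D = {}" by (auto simp: A_def)
    then show False using family_insert[OF fam t] no by blast
  qed
  have free: "x + y + z \<noteq> 0" if "x \<in> A" "y \<in> A" "z \<in> A" for x y z
    using degenerate[OF AV Acl _ noT that] dense by (auto simp: A_def)
  have sym: "- a \<in> A" if "a \<in> A" for a using Acl[OF that] cls_uminus that AV by blast
  have dense': "2 * CARD('g) < 5 * card A" using dense by (simp add: A_def)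
  obtain H where Hadd: "\<And>x y. x \<in> H \<Longrightarrow> y \<in> H \<Longrightarrow> x + y \<in> H" and Hneg: "\<And>x. x \<in> H \<Longrightarrow> - x \<in> H"
    and Hodd: "\<And>x y. x \<notin> H \<Longrightarrow> y \<notin> H \<Longrightarrow> x + y \<in> H" and cardH: "2 * card H = CARD('g)"
    and AH: "A \<inter> H = {}"
    using dense_triangle_free_index_two[OF sym free dense'] by blast
  have cardH': "2 * card (- H) = CARD('g)" using cardH by (simp add: Compl_eq_Diff_UNIV card_Diff_subset)
  have "card A \<le> card (- H)" using AH by (intro card_mono) auto
  then have m: "46 \<le> CARD('g)" using dense cardH' by (simp add: A_def)
  have Hmix: "x + y \<notin> H" if "x \<in> H" "y \<notin> H" for x y
    using Hadd[OF Hneg[OF that(1)], of "x + y"] that by auto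
  obtain a0 where a0: "a0 \<in> A" using dense' by fastforce
  have Hcls: "y \<in> H \<longleftrightarrow> x \<in> H" if "x \<in> V" "y \<in> cls x" for x y
  proof (cases "y = - x")
    case True
    then show ?thesis using Hneg[of x] Hneg[of y] by auto
  next
    case False
    then have "y - x + a0 \<in> A" using cls_shift[OF that, of a0] a0 AV Acl[OF a0] by blast
    then have "y - x + a0 + - a0 \<in> H" using Hodd AH sym[OF a0] by blast
    then have yx: "y - x \<in> H" by simp
    show ?thesis using Hadd[OF yx, of x] Hmix[OF yx, of x] by auto
  qed
  \<comment> \<open>Some triple lies entirely in the subgroup.\<close>
  have "\<exists>d\<in>D. fst d \<in> H \<and> fst (snd d) \<in> H \<and> snd (snd d) \<in> H"
  proof (rule ccontr)
    assume none: "\<not> ?thesis"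
    have le: "card (block d \<inter> H) \<le> c" if d: "d \<in> D" for d
    proof -
      obtain x y z where xyz: "d = (x, y, z)" by (cases d)
      then have t: "triple (x, y, z)" using fam d by (auto simp: family_def)
      then have V': "x \<in> V" "y \<in> V" "z \<in> V" and s: "x + y + z = 0" by (auto simp: triple_def)
      have n: "\<not> (x \<in> H \<and> y \<in> H \<and> z \<in> H)" using none d xyz by auto
      have "- (x + y) = z" "- (x + z) = y" "- (y + z) = x"
        by (rule minus_unique, use s in \<open>simp add: ac_simps\<close>)+
      then have "x \<in> H \<Longrightarrow> y \<in> H \<Longrightarrow> z \<in> H" "x \<in> H \<Longrightarrow> z \<in> H \<Longrightarrow> y \<in> H" "y \<in> H \<Longrightarrow> z \<in> H \<Longrightarrow> x \<in> H"
        using Hneg[OF Hadd, of x y] Hneg[OF Hadd, of x z] Hneg[OF Hadd, of y z] by metis+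
      with n consider "x \<notin> H" "y \<notin> H" | "x \<notin> H" "z \<notin> H" | "y \<notin> H" "z \<notin> H" by blast
      moreover have "p \<notin> H \<Longrightarrow> cls p \<inter> H = {}" if "p \<in> V" for p using Hcls[OF that] by blast
      ultimately have "block d \<inter> H \<subseteq> cls z \<or> block d \<inter> H \<subseteq> cls y \<or> block d \<inter> H \<subseteq> cls x"
        using V' by cases (simp_all add: block_def xyz Int_Un_distrib2)
      then show ?thesis using card_cls V' by (metis card_mono finite)
    qed
    have "card (used D \<inter> H) \<le> (\<Sum>d\<in>D. card (block d \<inter> H))"
    proof -
      have "used D \<inter> H = (\<Union>d\<in>D. block d \<inter> H)" by (auto simp: used_def)
      then show ?thesis using card_UN_le[of D "\<lambda>d. block d \<inter> H"] by simp
    qed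
    also have "\<dots> \<le> (\<Sum>d\<in>D. c)" using le by (rule sum_mono)
    finally have 1: "card (used D \<inter> H) \<le> c * card D" by (simp add: mult.commute)
    have "card (used D) = card (used D \<inter> H) + card (used D \<inter> - H)"
      by (subst card_Un_disjoint[symmetric]) (auto intro: arg_cong[of _ _ card])
    then have 2: "3 * c * card D = card (used D \<inter> H) + card (used D \<inter> - H)"
      using card_used[OF fam] by simp
    have 3: "card (used D \<inter> - H) \<le> card (- H)" by (intro card_mono) auto
    have "H \<subseteq> (used D \<inter> H) \<union> - V" using AH by (auto simp: A_def)
    then have "card H \<le> card (used D \<inter> H) + card (- V)"
      by (meson card_Un_le card_mono finite le_trans)
    then have 4: "3 * CARD('g) \<le> 10 * card (used D \<inter> H)" using V[OF m] cardH by linarith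
    show False using 1 2 3 4 cardH' m by linarith
  qed
  then obtain x y z where d: "(x, y, z) \<in> D" and xH: "x \<in> H" and yH: "y \<in> H" by fastforce
  define D0 where "D0 = D - {(x, y, z)}"
  have t: "triple (x, y, z)" using fam d by (auto simp: family_def)
  then have xV: "x \<in> V" and yV: "y \<in> V" and xy: "cls x \<noteq> cls y" by (auto simp: triple_def)
  have fam0: "family D0" using fam by (auto simp: family_def D0_def)
  have disj0: "block (x, y, z) \<inter> used D0 = {}"
  proof -
    have "block (x, y, z) \<inter> block e = {}" if "e \<in> D0" for e
      using fam d that unfolding family_def D0_def by blast
    then show ?thesis unfolding used_def by blast
  qed
  have A0: "A \<inter> used D0 = {}" by (auto simp: A_def D0_def used_def)
  have reps: "e + 4 * c < card {a \<in> A. - p - a \<in> A}" if p: "p \<in> H" for p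
  proof -
    have inj: "inj_on (\<lambda>a. - p - a) A" by (auto simp: inj_on_def)
    have sub: "A \<union> (\<lambda>a. - p - a) ` A \<subseteq> - H"
    proof -
      have "- p - a \<notin> H" if "a \<in> A" for a
        using Hmix[OF Hneg[OF p], of "- a"] sym[OF that] AH by auto
      then show ?thesis using AH by auto
    qed
    have "{a \<in> A. - p - a \<in> A} = A \<inter> (\<lambda>a. - p - a) ` A"
    proof (intro set_eqI iffI)
      fix a assume "a \<in> {a \<in> A. - p - a \<in> A}"
      then show "a \<in> A \<inter> (\<lambda>a. - p - a) ` A"
        by (auto intro!: image_eqI[of _ _ "- p - a"])
    qed auto
    moreover have "card A + card A = card (A \<union> (\<lambda>a. - p - a) ` A) + card (A \<inter> (\<lambda>a. - p - a) ` A)"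
      using card_Un_Int[of A "(\<lambda>a. - p - a) ` A"] by (simp add: card_image[OF inj])
    moreover have "card (A \<union> (\<lambda>a. - p - a) ` A) \<le> card (- H)" using sub by (intro card_mono) auto
    ultimately show ?thesis using dense cardH' e[OF m] by (simp add: A_def)
  qed
  have new: "\<exists>a. a \<in> A \<and> - p - a \<in> A \<and> triple (p, a, - p - a) \<and> a \<notin> X \<and> - p - a \<notin> X"
    if p: "p \<in> V" "p \<in> H" and X: "card X \<le> 2 * c" for p X
  proof -
    let ?bad = "{a \<in> V. - p - a \<in> cls a} \<union> X \<union> (\<lambda>b. - p - b) ` X"
    have "card ?bad \<le> card {a \<in> V. - p - a \<in> cls a} + card X + card ((\<lambda>b. - p - b) ` X)"
      by (meson add_le_mono1 card_Un_le le_trans)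
    also have "\<dots> \<le> e + 4 * c" using few[OF p(1)] X card_image_le[of X "\<lambda>b. - p - b"] by simp
    finally have "\<not> {a \<in> A. - p - a \<in> A} \<subseteq> ?bad"
      using reps[OF p(2)] by (metis (no_types, lifting) card_mono finite leD le_trans)
    then obtain a where a: "a \<in> A" "- p - a \<in> A" "a \<notin> ?bad" by blast
    have "cls p \<noteq> cls q" if "q \<in> A" for q
      using Hcls[OF p(1), of q] p(2) that AH AV cls_self by blast
    moreover have "cls a \<noteq> cls (- p - a)" using a AV cls_self by blast
    ultimately have "triple (p, a, - p - a)" using a p AV by (auto simp: triple_def)
    moreover have "- p - a \<notin> X" using a(3) by (auto simp: image_iff)
    ultimately show ?thesis using a by blast
  qed
  obtain a where a: "a \<in> A" "- x - a \<in> A" "triple (x, a, - x - a)"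
    using new[OF xV xH, of "{}"] by auto
  define b where "b = - x - a"
  have "card (cls a \<union> cls b) \<le> 2 * c"
    using card_Un_le[of "cls a" "cls b"] card_cls[of a] card_cls[of b] a AV by (simp add: b_def subset_iff)
  then obtain a' where a': "a' \<in> A" "- y - a' \<in> A" "triple (y, a', - y - a')"
      "a' \<notin> cls a \<union> cls b" "- y - a' \<notin> cls a \<union> cls b"
    using new[OF yV yH, of "cls a \<union> cls b"] by blast
  have 1: "block (x, a, b) \<inter> used D0 = {}"
    using disj0 A0 Acl a by (auto simp: block_def b_def)
  have fam1: "family (insert (x, a, b) D0)" "card (insert (x, a, b) D0) = Suc (card D0)"
    using family_insert[OF fam0 _ 1] a by (auto simp: b_def)
  have disjcls: "cls p \<inter> cls q = {}" if "p \<in> V" "q \<in> V" "p \<notin> cls q" for p q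
    using cls_disjoint[OF that(1,2)] cls_self that by auto
  have xA: "cls p \<inter> cls q = {}" if "p \<in> V" "p \<in> H" "q \<in> A" for p q
    using Hcls that AH AV by blast
  have "block (y, a', - y - a') \<inter> block (x, a, b) = {}"
  proof -
    have "cls y \<inter> cls x = {}" using cls_disjoint xV yV xy by blast
    moreover have "cls y \<inter> cls a = {}" "cls y \<inter> cls b = {}" "cls a' \<inter> cls x = {}"
      "cls (- y - a') \<inter> cls x = {}"
      using xA[OF yV yH] xA[OF xV xH] a a' by (auto simp: b_def)
    moreover have "cls a' \<inter> cls a = {}" "cls a' \<inter> cls b = {}"
      "cls (- y - a') \<inter> cls a = {}" "cls (- y - a') \<inter> cls b = {}"
      using disjcls a a' AV by (auto simp: b_def)
    ultimately show ?thesis by (auto simp: block_def)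
  qed
  moreover have "block (y, a', - y - a') \<inter> used D0 = {}"
    using disj0 A0 Acl a' by (auto simp: block_def)
  ultimately have "block (y, a', - y - a') \<inter> used (insert (x, a, b) D0) = {}"
    by (auto simp: used_def)
  then have "\<exists>D'. family D' \<and> card D' = Suc (Suc (card D0))"
    using family_insert[OF fam1(1) a'(3)] fam1(2) by metis
  moreover have "Suc (card D0) = card D" using d by (simp add: D0_def card_Suc_Diff1 del: card_Diff_insert)
  ultimately show False using no by simp
qed

lemma card_unused:
  assumes "family D"
  shows "card (V - used D) = card V - 3 * c * card D"
  using card_used[OF assms] used_subset[OF assms] by (simp add: card_Diff_subset)

lemma family_exists:
  assumes extend: "\<And>D. family D \<Longrightarrow> 2 * CARD('g) + 23 \<le> 5 * card (V - used D) \<Longrightarrow>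
      \<exists>D'. family D' \<and> card D' = Suc (card D)"
    and room: "\<And>i. Suc i = k \<Longrightarrow> 2 * CARD('g) + 23 \<le> 5 * (card V - 3 * c * i)"
  shows "\<exists>D. family D \<and> card D = k"
  using room
proof (induction k)
  case 0
  have "family {}" by (simp add: family_def)
  then show ?case by (intro exI[of _ "{}"]) simp
next
  case (Suc k)
  have "2 * CARD('g) + 23 \<le> 5 * (card V - 3 * c * i)" if "Suc i = k" for i
  proof -
    have "3 * c * i \<le> 3 * c * k" using that by (intro mult_le_mono) auto
    then show ?thesis using Suc.prems[of k] by linarith
  qed
  then obtain D where D: "family D" "card D = k" using Suc.IH by blast
  then show ?case using extend[OF D(1)] Suc.prems[of k] card_unused[OF D(1)] by auto
qed

end

section \<open>Cosets of a Klein four-subgroup\<close>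

lemma exists_outside:
  "finite X \<Longrightarrow> card X < card S \<Longrightarrow> \<exists>x. x \<in> S \<and> x \<notin> X"
  by (meson card_mono not_le subsetI)

lemma packable_two:
  assumes "finite S" "finite T" "S \<inter> T = {}" "\<Sum>S = 0" "\<Sum>T = 0" "card S = i" "card T = j" "S \<union> T = U"
  shows "packable U {#i, j#}"
  using packable_union[OF packable_single[of S] packable_single[of T]] assms
  by (simp add: add_mset_commute)

locale klein_subgroup =
  fixes a b :: "'g::{finite, ab_group_add}"
  assumes a: "a \<noteq> 0" "a + a = 0" and b: "b \<noteq> 0" "b + b = 0" and ab: "a \<noteq> b"
begin

definition K :: "'g set" where "K = {0, a, b, a + b}"

definition coset :: "'g \<Rightarrow> 'g set" where "coset x = (+) x ` K"

lemma ab_neq [simp]: "a \<noteq> 0" "b \<noteq> 0" "a \<noteq> b" "b \<noteq> a" "a + b \<noteq> 0" "a + b \<noteq> a" "a + b \<noteq> b"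
  "0 \<noteq> a + b" "a \<noteq> a + b" "b \<noteq> a + b" "0 \<noteq> a" "0 \<noteq> b"
proof -
  have "a + b \<noteq> 0"
  proof
    assume "a + b = 0"
    then have "a + b = a + a" using a by simp
    then show False using ab by simp
  qed
  then show "a + b \<noteq> 0" "0 \<noteq> a + b" by auto
qed (use a b ab in auto)

lemma double [simp]: "a + a = 0" "b + b = 0" "a + (a + x) = x" "b + (b + x) = x"
  using a b by (simp_all add: add.assoc[symmetric])

lemma double_K: "k \<in> K \<Longrightarrow> k + k = 0"
  by (auto simp: K_def ac_simps)

lemma uminus_K: "k \<in> K \<Longrightarrow> - k = k"
  using double_K by (simp add: minus_unique)

lemma zero_K [simp]: "0 \<in> K" by (simp add: K_def)

lemma add_K: "k \<in> K \<Longrightarrow> l \<in> K \<Longrightarrow> k + l \<in> K"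
  by (auto simp: K_def ac_simps)

lemma diff_K: "k \<in> K \<Longrightarrow> l \<in> K \<Longrightarrow> k - l \<in> K"
  by (simp only: diff_conv_add_uminus uminus_K add_K)

lemma card_K: "card K = 4" by (simp add: K_def)

lemma mem_coset: "y \<in> coset x \<longleftrightarrow> y - x \<in> K"
  by (force simp: coset_def image_iff algebra_simps)

lemma coset_self: "x \<in> coset x" by (simp add: mem_coset)

lemma coset_eq: "y \<in> coset x \<Longrightarrow> coset y = coset x"
proof -
  assume "y \<in> coset x"
  then have yx: "y - x \<in> K" by (simp add: mem_coset)
  have "z - y \<in> K \<longleftrightarrow> z - x \<in> K" for z
    using add_K[OF yx, of "z - y"] diff_K[OF _ yx, of "z - x"] by (auto simp: algebra_simps)
  then show ?thesis by (auto simp: mem_coset)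
qed

lemma coset_disjoint: "coset x \<noteq> coset y \<Longrightarrow> coset x \<inter> coset y = {}"
  using coset_eq by blast

lemma coset_double: "coset p = coset q \<Longrightarrow> p + p = q + q"
proof -
  assume "coset p = coset q"
  then have "p - q \<in> K" using coset_self[of p] by (simp add: mem_coset)
  then have "(p - q) + (p - q) = 0" by (rule double_K)
  then have "(p + p) - (q + q) = 0" by (simp add: algebra_simps)
  then show ?thesis by simp
qed

lemma card_coset: "card (coset x) = 4"
  by (simp add: coset_def card_image card_K)

lemma coset_zero: "coset 0 = K" by (simp add: coset_def)

lemma coset_explicit: "coset x = {x, x + a, x + b, x + (a + b)}"
  by (simp add: coset_def K_def)

text \<open>
  Both halves of a coset have the same sum, which can be any element of \<open>x + x + K\<close> except \<open>x + x\<close>.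
\<close>

lemma coset_halves:
  assumes "k \<in> K" "k \<noteq> 0"
  obtains S T where "S \<union> T = coset x" "S \<inter> T = {}" "card S = 2" "card T = 2"
    "\<Sum>S = x + x + k" "\<Sum>T = x + x + k"
proof -
  obtain l where l: "l \<in> K" "l \<noteq> 0" "l \<noteq> k" "K = {0, k, l, l + k}"
  proof (cases "k = a")
    case True
    then show thesis using that[of b] by (auto simp: K_def ac_simps insert_commute)
  next
    case False
    then show thesis using that[of a] assms by (auto simp: K_def ac_simps insert_commute)
  qed
  have lk: "l + k \<noteq> 0" "l + k \<noteq> k" "l + k \<noteq> l"
    using l assms double_K by (auto simp: eq_neg_iff_add_eq_0[symmetric] uminus_K)
  let ?S = "{x, x + k}" and ?T = "{x + l, x + (l + k)}"
  have "?S \<union> ?T = coset x" using l(4) by (auto simp: coset_def)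
  moreover have "?S \<inter> ?T = {}" using l lk by auto
  moreover have "card ?S = 2" "card ?T = 2" using assms lk by auto
  moreover have "\<Sum>?S = x + x + k" using assms by (simp add: ac_simps)
  moreover have "\<Sum>?T = x + x + k" 
  proof -
    have "\<Sum>?T = (x + x + k) + (l + l)" using lk assms by (simp add: ac_simps)
    then show ?thesis using double_K[OF l(1)] by simp
  qed
  ultimately show thesis by (rule that)
qed

lemma coset_packable: "x + x \<in> K \<Longrightarrow> packable (coset x) {#4#}"
proof -
  assume x: "x + x \<in> K"
  have aK: "a \<in> K" "a \<noteq> 0" by (auto simp: K_def)
  obtain S T where ST: "S \<union> T = coset x" "S \<inter> T = {}" "card S = 2" "card T = 2"
    "\<Sum>S = x + x + a" "\<Sum>T = x + x + a"
    by (rule coset_halves[OF aK])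
  have "\<Sum>(coset x) = \<Sum>S + \<Sum>T" using ST by (metis finite sum.union_disjoint)
  also have "\<dots> = 0" using double_K[OF add_K[OF x, of a]] ST by (simp add: K_def)
  finally show ?thesis using packable_single[of "coset x"] card_coset by simp
qed

lemma K_packable: "packable K {#1, 3#}"
  by (rule packable_two[of "{0}" "{a, b, a + b}"]) (auto simp: K_def ac_simps)

text \<open>
  A pool consists of cosets that are zero-sum 4-sets and whose halves have their sum in \<open>K\<close>.
\<close>

definition pool :: "'g set set \<Rightarrow> bool" where
  "pool \<P> \<longleftrightarrow> (\<forall>X\<in>\<P>. \<exists>p. X = coset p \<and> p + p \<in> K)"

lemma pool_disjoint: "pool \<P> \<Longrightarrow> X \<in> \<P> \<Longrightarrow> Y \<in> \<P> \<Longrightarrow> X \<noteq> Y \<Longrightarrow> X \<inter> Y = {}"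
  using coset_disjoint unfolding pool_def by metis

lemma pool_subset: "pool \<P> \<Longrightarrow> \<Q> \<subseteq> \<P> \<Longrightarrow> pool \<Q>"
  by (auto simp: pool_def)

lemma pool_Union_disjoint: "pool \<P> \<Longrightarrow> \<Q> \<subseteq> \<P> \<Longrightarrow> \<Union>\<Q> \<inter> \<Union>(\<P> - \<Q>) = {}"
  using pool_disjoint by blast

lemma pool_quads: "pool \<P> \<Longrightarrow> packable (\<Union>\<P>) (replicate_mset (card \<P>) 4)"
proof (induction \<P> rule: finite_induct[OF finite])
  case 1
  show ?case by (simp add: packable_empty)
next
  case (2 X \<P>)
  have "packable X {#4#}" using 2(4) coset_packable by (auto simp: pool_def)
  moreover have "packable (\<Union>\<P>) (replicate_mset (card \<P>) 4)" using 2 pool_subset by blast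
  moreover have "X \<inter> \<Union>\<P> = {}" using pool_disjoint[OF 2(4)] 2(2) by blast
  ultimately have "packable (X \<union> \<Union>\<P>) ({#4#} + replicate_mset (card \<P>) 4)" by (rule packable_union)
  then show ?case using 2 by simp
qed

lemma three_nonzero: "k \<in> K \<Longrightarrow> \<exists>k1\<in>K - {0}. \<exists>k2\<in>K - {0}. \<exists>k3\<in>K - {0}. k1 + k2 + k3 = k"
proof -
  have "a + b + (a + b) = 0" "a + b + b = a" "b + a + a = b" "(a + b) + a + a = a + b"
    by (simp_all add: ac_simps)
  moreover assume "k \<in> K"
  ultimately show ?thesis unfolding K_def by (elim insertE) (fastforce intro: rev_bexI)+
qed

lemma two_nonzero: "k \<in> K \<Longrightarrow> \<exists>k1\<in>K - {0}. \<exists>k2\<in>K - {0}. k1 + k2 = k"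
proof -
  have "a + a = 0" "b + (a + b) = a" "a + (a + b) = b" "a + b = a + b"
    by (simp_all add: ac_simps)
  moreover assume "k \<in> K"
  ultimately show ?thesis unfolding K_def by (elim insertE) (fastforce intro: rev_bexI)+
qed

text \<open>
  Each 6-set consists of one half from each coset. The three half sums can be chosen to cancel,
  because every element of \<open>K\<close> is a sum of three nonzero ones.
\<close>

lemma three_cosets_packable:
  assumes "pool {X, Y, Z}" "X \<noteq> Y" "X \<noteq> Z" "Y \<noteq> Z"
  shows "packable (X \<union> Y \<union> Z) {#6, 6#}"
proof -
  obtain x y z where xyz: "X = coset x" "Y = coset y" "Z = coset z" "x + x \<in> K" "y + y \<in> K" "z + z \<in> K"
    using assms(1) by (auto simp: pool_def)
  obtain k1 k2 k3 where k: "k1 \<in> K" "k1 \<noteq> 0" "k2 \<in> K" "k2 \<noteq> 0" "k3 \<in> K" "k3 \<noteq> 0"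
      "k1 + k2 + k3 = (x + x) + (y + y) + (z + z)"
    using three_nonzero[OF add_K[OF add_K[OF xyz(4,5)] xyz(6)]] by blast
  obtain S1 T1 where 1: "S1 \<union> T1 = X" "S1 \<inter> T1 = {}" "card S1 = 2" "card T1 = 2"
    "\<Sum>S1 = x + x + k1" "\<Sum>T1 = x + x + k1" unfolding xyz(1) by (rule coset_halves[OF k(1,2)])
  obtain S2 T2 where 2: "S2 \<union> T2 = Y" "S2 \<inter> T2 = {}" "card S2 = 2" "card T2 = 2"
    "\<Sum>S2 = y + y + k2" "\<Sum>T2 = y + y + k2" unfolding xyz(2) by (rule coset_halves[OF k(3,4)])
  obtain S3 T3 where 3: "S3 \<union> T3 = Z" "S3 \<inter> T3 = {}" "card S3 = 2" "card T3 = 2"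
    "\<Sum>S3 = z + z + k3" "\<Sum>T3 = z + z + k3" unfolding xyz(3) by (rule coset_halves[OF k(5,6)])
  have disj: "X \<inter> Y = {}" "X \<inter> Z = {}" "Y \<inter> Z = {}"
    using pool_disjoint[OF assms(1)] assms by auto
  have sum: "(x + x + k1) + (y + y + k2) + (z + z + k3) = 0"
  proof -
    have "(x + x + k1) + (y + y + k2) + (z + z + k3) = ((x + x) + (y + y) + (z + z)) + (k1 + k2 + k3)"
      by (simp add: ac_simps)
    also have "\<dots> = (k1 + k2 + k3) + (k1 + k2 + k3)" by (simp only: k(7))
    finally show ?thesis using double_K[OF add_K[OF add_K[OF k(1,3)] k(5)]] by simp
  qed
  have d: "S1 \<inter> S2 = {}" "S1 \<inter> S3 = {}" "S2 \<inter> S3 = {}" "T1 \<inter> T2 = {}" "T1 \<inter> T3 = {}" "T2 \<inter> T3 = {}"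
    using disj 1(1) 2(1) 3(1) by blast+
  show ?thesis
  proof (rule packable_two)
    show "(S1 \<union> S2 \<union> S3) \<inter> (T1 \<union> T2 \<union> T3) = {}" using disj 1(1,2) 2(1,2) 3(1,2) by blast
    show "\<Sum>(S1 \<union> S2 \<union> S3) = 0" "\<Sum>(T1 \<union> T2 \<union> T3) = 0"
      using sum d 1 2 3 by (simp_all add: sum.union_disjoint Int_Un_distrib2)
    show "card (S1 \<union> S2 \<union> S3) = 6" "card (T1 \<union> T2 \<union> T3) = 6"
      using d 1 2 3 by (simp_all add: card_Un_disjoint Int_Un_distrib2)
    show "S1 \<union> S2 \<union> S3 \<union> (T1 \<union> T2 \<union> T3) = X \<union> Y \<union> Z" using 1(1) 2(1) 3(1) by blast
  qed simp_all
qed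

lemma pool_packable:
  "pool \<P> \<Longrightarrow> card \<P> = q + 3 * h \<Longrightarrow> packable (\<Union>\<P>) (replicate_mset q 4 + replicate_mset (2 * h) 6)"
proof (induction h arbitrary: \<P>)
  case 0
  then show ?case using pool_quads[of \<P>] by simp
next
  case (Suc h)
  then have "3 \<le> card \<P>" by simp
  then obtain \<Q> where \<Q>: "\<Q> \<subseteq> \<P>" "card \<Q> = 3" by (metis obtain_subset_with_card_n)
  then obtain X Y Z where XYZ: "\<Q> = {X, Y, Z}" "X \<noteq> Y" "X \<noteq> Z" "Y \<noteq> Z" by (auto simp: card_3_iff)
  have "packable (\<Union>\<Q>) {#6, 6#}"
    using three_cosets_packable[of X Y Z] pool_subset[OF Suc.prems(1) \<Q>(1)] XYZ by (simp add: Un_assoc)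
  moreover have "packable (\<Union>(\<P> - \<Q>)) (replicate_mset q 4 + replicate_mset (2 * h) 6)"
    by (rule Suc.IH) (use Suc.prems \<Q> pool_subset[of \<P> "\<P> - \<Q>"] in \<open>auto simp: card_Diff_subset\<close>)
  moreover have "\<Union>\<Q> \<inter> \<Union>(\<P> - \<Q>) = {}" using pool_Union_disjoint Suc.prems(1) \<Q>(1) by blast
  ultimately have "packable (\<Union>\<Q> \<union> \<Union>(\<P> - \<Q>)) ({#6, 6#} + (replicate_mset q 4 + replicate_mset (2 * h) 6))"
    by (rule packable_union)
  moreover have "\<Union>\<Q> \<union> \<Union>(\<P> - \<Q>) = \<Union>\<P>" using \<Q>(1) by blast
  ultimately show ?case by (simp add: ac_simps)
qed

text \<open>
  The elements \<open>k\<close>, \<open>\<rho> k\<close> and \<open>\<rho> (\<rho> k)\<close> of \<open>K\<close> add up to zero, where \<open>\<rho>\<close> permutes the nonzero elements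
  cyclically; shifting one coset by \<open>s\<close> makes all four sums equal to \<open>s\<close>.
\<close>

lemma line_transversals:
  assumes "x + y + z = 0" "coset x \<inter> coset y = {}" "coset x \<inter> coset z = {}" "coset y \<inter> coset z = {}" "s \<in> K"
  obtains T1 T2 T3 T4 where "T1 \<union> T2 \<union> (T3 \<union> T4) = coset x \<union> coset y \<union> coset z"
    "T1 \<inter> T2 = {}" "T3 \<inter> T4 = {}" "(T1 \<union> T2) \<inter> (T3 \<union> T4) = {}"
    "card T1 = 3" "card T2 = 3" "card T3 = 3" "card T4 = 3"
    "\<Sum>T1 = s" "\<Sum>T2 = s" "\<Sum>T3 = s" "\<Sum>T4 = s"
proof -
  define w where "w = z + s"
  have w: "coset w = coset z" using assms(5) by (intro coset_eq) (simp add: mem_coset w_def)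
  have xyw: "x + y + w = s" using assms(1) by (simp add: w_def add.assoc[symmetric])
  have d: "x + i \<noteq> y + j" "x + i \<noteq> w + j" "y + i \<noteq> w + j" if "i \<in> K" "j \<in> K" for i j
  proof -
    have "x + i \<in> coset x" "y + i \<in> coset y" "y + j \<in> coset y" "w + j \<in> coset z"
      using that by (simp_all add: mem_coset w[symmetric])
    then show "x + i \<noteq> y + j" "x + i \<noteq> w + j" "y + i \<noteq> w + j"
      using assms(2-4) by (metis disjoint_iff)+
  qed
  have tr: "card {x + i, y + j, w + k} = 3" "\<Sum>{x + i, y + j, w + k} = s"
    if ijk: "i \<in> K" "j \<in> K" "k \<in> K" "i + j + k = 0" for i j k
  proof -
    show "card {x + i, y + j, w + k} = 3" using d ijk by auto
    have "\<Sum>{x + i, y + j, w + k} = (x + y + w) + (i + j + k)" using d ijk by (simp add: ac_simps)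
    then show "\<Sum>{x + i, y + j, w + k} = s" using xyw ijk by simp
  qed
  let ?T1 = "{x + 0, y + 0, w + 0}" and ?T2 = "{x + a, y + b, w + (a + b)}"
    and ?T3 = "{x + b, y + (a + b), w + a}" and ?T4 = "{x + (a + b), y + a, w + b}"
  have Ks: "0 \<in> K" "a \<in> K" "b \<in> K" "a + b \<in> K" by (auto simp: K_def)
  note D = d[OF Ks(1) Ks(1)] d[OF Ks(1) Ks(2)] d[OF Ks(1) Ks(3)] d[OF Ks(1) Ks(4)]
    d[OF Ks(2) Ks(1)] d[OF Ks(2) Ks(2)] d[OF Ks(2) Ks(3)] d[OF Ks(2) Ks(4)]
    d[OF Ks(3) Ks(1)] d[OF Ks(3) Ks(2)] d[OF Ks(3) Ks(3)] d[OF Ks(3) Ks(4)]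
    d[OF Ks(4) Ks(1)] d[OF Ks(4) Ks(2)] d[OF Ks(4) Ks(3)] d[OF Ks(4) Ks(4)]
  show thesis
  proof (rule that)
    show "?T1 \<union> ?T2 \<union> (?T3 \<union> ?T4) = coset x \<union> coset y \<union> coset z"
      unfolding w[symmetric] unfolding coset_explicit by auto
    show "?T1 \<inter> ?T2 = {}" "?T3 \<inter> ?T4 = {}" "(?T1 \<union> ?T2) \<inter> (?T3 \<union> ?T4) = {}"
      using D D[symmetric] by simp_all
  qed (rule tr; simp add: K_def ac_simps)+
qed

text \<open>
  Two transversals of a line, that is, half of its elements, form two zero-sum sets together with
  \<open>c\<close> cosets of a pool: each transversal gets one half of every coset. For \<open>c = 0\<close> the two
  transversals are joined to one set of size 6.
\<close>

definition half_line_sizes :: "nat \<Rightarrow> nat multiset" where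
  "half_line_sizes c = (if c = 0 then {#6#} else if c = 1 then {#5, 5#} else {#7, 7#})"

text \<open>
  The transversals have sum \<open>s\<close>, and the halves of a coset can have any sum in \<open>K\<close> except one, so a single
  coset excludes one value of \<open>s\<close>; two cosets exclude none, since every element of \<open>K\<close> is a sum
  of two nonzero ones.
\<close>

lemma half_line_packable:
  assumes T: "T \<inter> T' = {}" "card T = 3" "card T' = 3" "\<Sum>T = s" "\<Sum>T' = s" "s \<in> K"
    and \<Q>: "pool \<Q>" "card \<Q> = c" "c \<le> 2" "(T \<union> T') \<inter> \<Union>\<Q> = {}"
    and s: "\<And>p. \<Q> = {coset p} \<Longrightarrow> s \<noteq> p + p"
  shows "packable (T \<union> T' \<union> \<Union>\<Q>) (half_line_sizes c)"
proof -
  consider "c = 0" | "c = 1" | "c = 2" using \<Q>(3) by linarith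
  then show ?thesis
  proof cases
    case 1
    then have "\<Q> = {}" using \<Q>(2) by simp
    moreover have "\<Sum>(T \<union> T') = 0" "card (T \<union> T') = 6"
      using T double_K[of s] by (simp_all add: sum.union_disjoint card_Un_disjoint)
    ultimately show ?thesis using packable_single[of "T \<union> T'"] 1 by (simp add: half_line_sizes_def)
  next
    case 2
    then obtain X where X: "\<Q> = {X}" using \<Q>(2) by (auto simp: card_1_singleton_iff)
    then obtain p where p: "X = coset p" "p + p \<in> K" using \<Q>(1) by (auto simp: pool_def)
    define k where "k = s + (p + p)"
    have k: "k \<in> K" "k \<noteq> 0"
    proof -
      show "k \<in> K" using add_K T(6) p by (simp add: k_def)
      show "k \<noteq> 0" using s[of p] X p uminus_K[OF p(2)] by (auto simp: k_def eq_neg_iff_add_eq_0[symmetric])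
    qed
    obtain P P' where P: "P \<union> P' = X" "P \<inter> P' = {}" "card P = 2" "card P' = 2"
      "\<Sum>P = p + p + k" "\<Sum>P' = p + p + k" unfolding p(1) by (rule coset_halves[OF k])
    have z: "s + (p + p + k) = 0"
    proof -
      have "s + (p + p + k) = k + k" by (simp add: k_def ac_simps)
      then show ?thesis using double_K[OF k(1)] by simp
    qed
    have d: "T \<inter> P = {}" "T' \<inter> P' = {}" using \<Q>(4) X P(1) by auto
    have "packable (T \<union> T' \<union> X) {#5, 5#}"
    proof (rule packable_two)
      show "(T \<union> P) \<inter> (T' \<union> P') = {}" using \<Q>(4) X P(1,2) T(1) by auto
      show "\<Sum>(T \<union> P) = 0" "\<Sum>(T' \<union> P') = 0" using d P T z by (simp_all add: sum.union_disjoint)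
      show "card (T \<union> P) = 5" "card (T' \<union> P') = 5" using d P T by (simp_all add: card_Un_disjoint)
      show "T \<union> P \<union> (T' \<union> P') = T \<union> T' \<union> X" using P(1) by blast
    qed simp_all
    then show ?thesis using 2 X by (simp add: half_line_sizes_def)
  next
    case 3
    then obtain X Y where X: "\<Q> = {X, Y}" "X \<noteq> Y" using \<Q>(2) by (auto simp: card_2_iff)
    then obtain p q where p: "X = coset p" "p + p \<in> K" "Y = coset q" "q + q \<in> K"
      using \<Q>(1) by (auto simp: pool_def)
    have XY: "X \<inter> Y = {}" using pool_disjoint[OF \<Q>(1)] X by auto
    obtain k l where k: "k \<in> K" "k \<noteq> 0" "l \<in> K" "l \<noteq> 0" "k + l = s + (p + p) + (q + q)"
      using two_nonzero[of "s + (p + p) + (q + q)"] add_K T(6) p by blast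
    obtain P P' where P: "P \<union> P' = X" "P \<inter> P' = {}" "card P = 2" "card P' = 2"
      "\<Sum>P = p + p + k" "\<Sum>P' = p + p + k" unfolding p(1) by (rule coset_halves[OF k(1,2)])
    obtain Q Q' where Q: "Q \<union> Q' = Y" "Q \<inter> Q' = {}" "card Q = 2" "card Q' = 2"
      "\<Sum>Q = q + q + l" "\<Sum>Q' = q + q + l" unfolding p(3) by (rule coset_halves[OF k(3,4)])
    have z: "s + (p + p + k) + (q + q + l) = 0"
    proof -
      have "s + (p + p + k) + (q + q + l) = (s + (p + p) + (q + q)) + (k + l)"
        by (simp add: ac_simps)
      also have "\<dots> = (k + l) + (k + l)" by (simp only: k(5))
      finally show ?thesis using double_K[OF add_K[OF k(1,3)]] by simp
    qed
    have d: "T \<inter> P = {}" "T' \<inter> P' = {}" "T \<inter> Q = {}" "T' \<inter> Q' = {}" "P \<inter> Q = {}" "P' \<inter> Q' = {}"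
      using \<Q>(4) X P(1) Q(1) XY by auto
    have "packable (T \<union> T' \<union> (X \<union> Y)) {#7, 7#}"
    proof (rule packable_two)
      show "(T \<union> P \<union> Q) \<inter> (T' \<union> P' \<union> Q') = {}" using \<Q>(4) X P(1,2) Q(1,2) T(1) XY by auto
      show "\<Sum>(T \<union> P \<union> Q) = 0" "\<Sum>(T' \<union> P' \<union> Q') = 0"
        using d P Q T z by (simp_all add: sum.union_disjoint Int_Un_distrib2)
      show "card (T \<union> P \<union> Q) = 7" "card (T' \<union> P' \<union> Q') = 7"
        using d P Q T by (simp_all add: card_Un_disjoint Int_Un_distrib2)
      show "T \<union> P \<union> Q \<union> (T' \<union> P' \<union> Q') = T \<union> T' \<union> (X \<union> Y)" using P(1) Q(1) by blast
    qed simp_all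
    then show ?thesis using 3 X by (simp add: half_line_sizes_def)
  qed
qed

text \<open>
  The two half lines exclude at most two of the four elements of \<open>K\<close> as common sum of the
  transversals.
\<close>

lemma line_packable:
  assumes line: "x + y + z = 0" "coset x \<inter> coset y = {}" "coset x \<inter> coset z = {}" "coset y \<inter> coset z = {}"
    and \<P>: "pool \<P>" "card \<P> = c + c'" "c \<le> 2" "c' \<le> 2"
      "(coset x \<union> coset y \<union> coset z) \<inter> \<Union>\<P> = {}"
  shows "packable (coset x \<union> coset y \<union> coset z \<union> \<Union>\<P>) (half_line_sizes c + half_line_sizes c')"
proof -
  obtain \<Q> where \<Q>: "\<Q> \<subseteq> \<P>" "card \<Q> = c" using \<P>(2) by (metis le_add1 obtain_subset_with_card_n)
  let ?\<R> = "\<P> - \<Q>"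
  have cR: "card ?\<R> = c'" using \<P>(2) \<Q> by (simp add: card_Diff_subset)
  \<comment> \<open>The excluded value for a pool that consists of a single coset, and a junk value otherwise.\<close>
  define u where "u \<C> = (SOME k. \<exists>p. \<C> = {coset p} \<and> k = p + p)" for \<C> :: "'g set set"
  have u: "u {coset p} = p + p" for p
    unfolding u_def
  proof (rule some_equality)
    fix k assume "\<exists>q. {coset p} = {coset q} \<and> k = q + q"
    then obtain q where "coset p = coset q" "k = q + q" by blast
    then show "k = p + p" using coset_double[of p q] by simp
  qed blast
  have "card (K - {u \<Q>, u ?\<R>}) \<noteq> 0"
  proof -
    have "card K - card {u \<Q>, u ?\<R>} \<le> card (K - {u \<Q>, u ?\<R>})" by (rule diff_card_le_card_Diff) simp
    moreover have "card {u \<Q>, u ?\<R>} \<le> 2" by (simp add: card_insert_if)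
    ultimately show ?thesis using card_K by linarith
  qed
  then obtain s where s: "s \<in> K" "s \<noteq> u \<Q>" "s \<noteq> u ?\<R>" by (metis Diff_iff card.empty equals0I insert_iff)
  obtain T1 T2 T3 T4 where T: "T1 \<union> T2 \<union> (T3 \<union> T4) = coset x \<union> coset y \<union> coset z"
    "T1 \<inter> T2 = {}" "T3 \<inter> T4 = {}" "(T1 \<union> T2) \<inter> (T3 \<union> T4) = {}"
    "card T1 = 3" "card T2 = 3" "card T3 = 3" "card T4 = 3"
    "\<Sum>T1 = s" "\<Sum>T2 = s" "\<Sum>T3 = s" "\<Sum>T4 = s"
    using line_transversals[OF line s(1)] by blast
  have avoid: "s \<noteq> p + p" if "\<C> = {coset p}" "s \<noteq> u \<C>" for \<C> p
    using that u[of p] by simp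
  have pools: "pool \<Q>" "pool ?\<R>" using pool_subset[OF \<P>(1)] \<Q>(1) by auto
  have dj: "(T1 \<union> T2) \<inter> \<Union>\<Q> = {}" "(T3 \<union> T4) \<inter> \<Union>?\<R> = {}" using \<P>(5) T(1) \<Q>(1) by blast+
  have "packable (T1 \<union> T2 \<union> \<Union>\<Q>) (half_line_sizes c)"
    by (rule half_line_packable[OF T(2,5,6,9,10) s(1) pools(1) \<Q>(2) \<P>(3) dj(1)])
      (use avoid s(2) in blast)
  moreover have "packable (T3 \<union> T4 \<union> \<Union>?\<R>) (half_line_sizes c')"
    by (rule half_line_packable[OF T(3,7,8,11,12) s(1) pools(2) cR \<P>(4) dj(2)])
      (use avoid s(3) in blast)
  moreover have "(T1 \<union> T2 \<union> \<Union>\<Q>) \<inter> (T3 \<union> T4 \<union> \<Union>?\<R>) = {}"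
  proof -
    have "(T1 \<union> T2) \<inter> \<Union>?\<R> = {}" "(T3 \<union> T4) \<inter> \<Union>\<Q> = {}" using \<P>(5) T(1) \<Q>(1) by blast+
    then show ?thesis using T(4) pool_Union_disjoint[OF \<P>(1) \<Q>(1)] by blast
  qed
  ultimately have "packable ((T1 \<union> T2 \<union> \<Union>\<Q>) \<union> (T3 \<union> T4 \<union> \<Union>?\<R>)) (half_line_sizes c + half_line_sizes c')"
    by (rule packable_union)
  moreover have "(T1 \<union> T2 \<union> \<Union>\<Q>) \<union> (T3 \<union> T4 \<union> \<Union>?\<R>) = coset x \<union> coset y \<union> coset z \<union> \<Union>\<P>"
    using T(1) \<Q>(1) by blast
  ultimately show ?thesis by simp
qed

end

section \<open>Groups whose doubles lie in a Klein four-subgroup\<close>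

locale square_klein_subgroup = klein_subgroup +
  assumes squares: "x + x \<in> K"
begin

sublocale lines: class_system "- K" coset 4
proof
  fix x y z assume x: "x \<in> - K"
  show "x \<in> coset x" by (rule coset_self)
  show "card (coset x) = 4" by (rule card_coset)
  show "coset x \<subseteq> - K"
  proof
    fix u assume "u \<in> coset x"
    then have "u - x \<in> K" by (simp add: mem_coset)
    then show "u \<in> - K" using diff_K[of u "u - x"] x by auto
  qed
  show "- x \<in> coset x" using diff_K[OF zero_K squares[of x]] by (simp add: mem_coset)
  assume y: "y \<in> coset x"
  then show "coset y = coset x" by (rule coset_eq)
  show "y = - x \<or> y - x + z \<in> coset z" using y by (simp add: mem_coset)
qed

text \<open>
  Degenerate triples do not occur: if \<open>x\<close> and \<open>y\<close> lie in the same coset, then \<open>x + y\<close> is in \<open>K\<close>.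
\<close>

lemma lines_exist:
  assumes "20 * k \<le> CARD('a) + 4"
  shows "\<exists>D. lines.family D \<and> card D = k"
proof (rule lines.family_exists)
  have cK: "card (- K) = CARD('a) - 4" by (simp add: Compl_eq_Diff_UNIV card_Diff_subset card_K)
  show "2 * CARD('a) + 23 \<le> 5 * (card (- K) - 3 * 4 * i)" if "Suc i = k" for i
    using assms that unfolding cK by auto
  fix D assume D: "lines.family D" "2 * CARD('a) + 23 \<le> 5 * card (- K - lines.used D)"
  show "\<exists>D'. lines.family D' \<and> card D' = Suc (card D)"
  proof (rule lines.family_extend[where e = 0, OF D])
    fix A x y z
    assume A: "A \<subseteq> - K" and none: "\<And>x y z. x \<in> A \<Longrightarrow> y \<in> A \<Longrightarrow> z \<in> A \<Longrightarrow> \<not> lines.triple (x, y, z)"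
      and xyz: "x \<in> A" "y \<in> A" "z \<in> A"
    have distinct: "coset p \<noteq> coset q" if "p + q + r = 0" "r \<in> A" for p q r
    proof
      assume "coset p = coset q"
      then have "p - q \<in> K" using coset_self[of p] by (simp add: mem_coset)
      then have "- ((p - q) + (q + q)) \<in> K" using add_K squares uminus_K by metis
      moreover have "- ((p - q) + (q + q)) = r"
        using that(1) by (intro minus_unique) (simp add: algebra_simps)
      ultimately show False using that A by auto
    qed
    show "x + y + z \<noteq> 0"
    proof
      assume 0: "x + y + z = 0"
      then have "x + z + y = 0" "y + z + x = 0" by (simp_all add: ac_simps)
      then have "lines.triple (x, y, z)"
        using 0 distinct[of x y z] distinct[of x z y] distinct[of y z x] xyz A
        by (auto simp: lines.triple_def)
      then show False using none xyz by blast
    qed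
  next
    fix x assume x: "x \<in> - K"
    have "{u \<in> - K. - x - u \<in> coset u} = {}"
    proof -
      have False if "- x - u \<in> coset u" for u
      proof -
        have "- x - u - u \<in> K" using that by (simp add: mem_coset)
        then have "- (- x - u - u + (u + u)) \<in> K" using add_K squares uminus_K by metis
        then show False using x by simp
      qed
      then show ?thesis by blast
    qed
    then show "card {u \<in> - K. - x - u \<in> coset u} \<le> 0" by simp
  qed (use card_K in auto)
qed

lemma lines_packable:
  assumes "lines.family D" "length cs = 2 * card D" "\<forall>c\<in>set cs. c \<le> 2"
    "pool \<P>" "\<Union>\<P> \<inter> lines.used D = {}" "card \<P> = sum_list cs"
  shows "packable (lines.used D \<union> \<Union>\<P>) (sum_list (map half_line_sizes cs))"
  using assms
proof (induction "card D" arbitrary: D cs \<P>)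
  case 0
  then show ?case by (simp add: packable_empty)
next
  case (Suc n)
  from Suc.hyps(2) have "D \<noteq> {}" by auto
  then obtain d where d: "d \<in> D" by blast
  obtain x y z where xyz: "d = (x, y, z)" by (cases d)
  have "length cs = Suc (Suc (2 * n))" using Suc.prems(2) Suc.hyps(2) by simp
  then obtain c c' cs' where cs: "cs = c # c' # cs'" "length cs' = 2 * n"
    by (auto simp: length_Suc_conv)
  have "c + c' \<le> card \<P>" using Suc.prems(6) cs by simp
  then obtain \<Q> where \<Q>: "\<Q> \<subseteq> \<P>" "card \<Q> = c + c'" by (metis obtain_subset_with_card_n)
  let ?D = "D - {d}" and ?\<P> = "\<P> - \<Q>"
  have t: "lines.triple (x, y, z)" using Suc.prems(1) d xyz by (auto simp: lines.family_def)
  have used: "lines.used D = lines.block d \<union> lines.used ?D" using d by (auto simp: lines.used_def)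
  have disj: "lines.block d \<inter> lines.used ?D = {}"
  proof -
    have "lines.block d \<inter> lines.block e = {}" if "e \<in> ?D" for e
      using Suc.prems(1) d that unfolding lines.family_def by blast
    then show ?thesis unfolding lines.used_def by blast
  qed
  have b: "lines.block d = coset x \<union> coset y \<union> coset z" by (simp add: xyz lines.block_def)
  have "packable (coset x \<union> coset y \<union> coset z \<union> \<Union>\<Q>) (half_line_sizes c + half_line_sizes c')"
  proof (rule line_packable)
    show "x + y + z = 0" "coset x \<inter> coset y = {}" "coset x \<inter> coset z = {}" "coset y \<inter> coset z = {}"
      using t coset_disjoint by (simp_all add: lines.triple_def)
    show "(coset x \<union> coset y \<union> coset z) \<inter> \<Union>\<Q> = {}" using Suc.prems(5) \<Q>(1) used b by blast
  qed (use pool_subset[OF Suc.prems(4)] \<Q> Suc.prems(3) cs in auto)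
  moreover have "packable (lines.used ?D \<union> \<Union>?\<P>) (sum_list (map half_line_sizes cs'))"
  proof (rule Suc.hyps(1))
    show "n = card ?D" using Suc.hyps(2) d by simp
    then show "length cs' = 2 * card ?D" using cs by simp
    show "lines.family ?D" using Suc.prems(1) by (auto simp: lines.family_def)
    show "pool ?\<P>" using pool_subset[OF Suc.prems(4)] by auto
    show "\<Union>?\<P> \<inter> lines.used ?D = {}" using Suc.prems(5) used by blast
    show "card ?\<P> = sum_list cs'" using \<Q> Suc.prems(6) cs by (simp add: card_Diff_subset)
  qed (use Suc.prems(3) cs in auto)
  moreover have "(lines.block d \<union> \<Union>\<Q>) \<inter> (lines.used ?D \<union> \<Union>?\<P>) = {}"
    using disj pool_Union_disjoint[OF Suc.prems(4) \<Q>(1)] Suc.prems(5) used \<Q>(1) by blast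
  ultimately have "packable ((lines.block d \<union> \<Union>\<Q>) \<union> (lines.used ?D \<union> \<Union>?\<P>))
      (half_line_sizes c + half_line_sizes c' + sum_list (map half_line_sizes cs'))"
    using packable_union b by metis
  moreover have "(lines.block d \<union> \<Union>\<Q>) \<union> (lines.used ?D \<union> \<Union>?\<P>) = lines.used D \<union> \<Union>\<P>"
    using used \<Q>(1) by blast
  ultimately show ?case using cs by (simp add: add.assoc)
qed

lemma sum_half_line_sizes:
  "sum_list (map half_line_sizes (replicate x 1 @ replicate y 2 @ replicate z 0)) =
    replicate_mset (2 * x) 5 + replicate_mset (2 * y) 7 + replicate_mset z 6"
proof -
  have "sum_list (map half_line_sizes (replicate n 1)) = replicate_mset (2 * n) 5"
    "sum_list (map half_line_sizes (replicate n 2)) = replicate_mset (2 * n) 7"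
    "sum_list (map half_line_sizes (replicate n 0)) = replicate_mset n 6" for n
    by (induction n) (auto simp: half_line_sizes_def)
  then show ?thesis by (simp add: add.assoc)
qed

text \<open>
  The fives are treated in pairs and the sevens in pairs, each pair by half a line. The set \<open>{0}\<close>
  and a coset form a single five, and \<open>K - {0}\<close> and a coset form a single seven. The waste is at most
  9: at most three elements of \<open>K\<close> if there is just a single five or seven, and six elements because of an
  unused half line or an unpaired six (these two compensate each other). As cosets have four
  elements, the difference 6 between the order of the group and the total size pays for that.
\<close>

lemma square_klein_packable:
  assumes n: "4 * n4 + 5 * n5 + 6 * n6 + 7 * n7 + 6 \<le> CARD('a)"
  shows "packable (UNIV :: 'a set)
    (replicate_mset n4 4 + replicate_mset n5 5 + replicate_mset n6 6 + replicate_mset n7 7)"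
proof -
  define x i y j where "x = n5 div 2" and "i = n5 mod 2" and "y = n7 div 2" and "j = n7 mod 2"
  have n5: "n5 = 2 * x + i" "i \<le> 1" and n7: "n7 = 2 * y + j" "j \<le> 1"
    by (auto simp: x_def i_def y_def j_def)
  define sp where "sp = (x + y) mod 2"
  define k where "k = (x + y + sp) div 2"
  have k: "2 * k = x + y + sp" and sp: "sp \<le> 1"
    unfolding k_def sp_def by presburger+
  \<comment> \<open>A left over half line (\<open>sp = 1\<close>) serves one of the sixes, the others are treated in pairs.\<close>
  define z where "z = (n6 - sp + 1) div 2"
  have z: "n6 \<le> sp + 2 * z" "2 * z + sp \<le> n6 + 1 \<or> (z = 0 \<and> n6 = 0)"
    using sp unfolding z_def by presburger+
  have n': "4 * n4 + 10 * x + 5 * i + 6 * n6 + 14 * y + 7 * j + 6 \<le> CARD('a)"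
    using n unfolding n5 n7 by simp
  have "20 * k \<le> CARD('a) + 4" using n' k sp by linarith
  then obtain D where D: "lines.family D" "card D = k" using lines_exist by blast
  define \<P>0 where "\<P>0 = coset ` (- K - lines.used D)"
  have pool0: "pool \<P>0" using squares by (auto simp: \<P>0_def pool_def)
  have cover: "\<Union>\<P>0 = - K - lines.used D"
    using lines.unused_closed[OF D(1)] coset_self unfolding \<P>0_def by blast
  have "card (\<Union>\<P>0) = 4 * card \<P>0"
  proof -
    have "card (\<Union>\<P>0) = (\<Sum>X\<in>\<P>0. card X)"
      using pool_disjoint[OF pool0] by (intro card_Union_disjoint) (auto simp: pairwise_def disjnt_def)
    also have "\<dots> = (\<Sum>X\<in>\<P>0. 4)" by (intro sum.cong) (auto simp: \<P>0_def card_coset)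
    finally show ?thesis by simp
  qed
  moreover have "card (- K - lines.used D) = CARD('a) - 4 - 12 * k"
    using lines.card_unused[OF D(1)] D(2) by (simp add: Compl_eq_Diff_UNIV card_Diff_subset card_K)
  moreover have "12 * k \<le> CARD('a) - 4"
    using card_mono[OF finite lines.used_subset[OF D(1)]] lines.card_used[OF D(1)] D(2)
    by (simp add: Compl_eq_Diff_UNIV card_Diff_subset card_K)
  ultimately have card0: "CARD('a) = 4 + 12 * k + 4 * card \<P>0" using cover n by simp
  \<comment> \<open>The subgroup \<open>K\<close> itself is an ordinary coset unless it is needed for a single five or seven.\<close>
  define \<P> where "\<P> = (if i = 0 \<and> j = 0 then insert K \<P>0 else \<P>0)"
  have "K \<notin> \<P>0" using cover zero_K by blast
  then have cardP: "card \<P> = (if i = 0 \<and> j = 0 then Suc (card \<P>0) else card \<P>0)"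
    by (simp add: \<P>_def)
  have pool: "pool \<P>" using pool0 coset_zero[symmetric] by (auto simp: \<P>_def pool_def)
  have need: "x + 2 * y + (n4 + i + j + 3 * z) \<le> card \<P>"
  proof -
    have 1: "4 * (x + 2 * y + (n4 + i + j + 3 * z)) + 12 * k + i + 3 * j \<le> CARD('a)"
      using z(2) n' k sp by (elim disjE) simp_all
    show ?thesis
    proof (cases "i = 0 \<and> j = 0")
      case True
      then show ?thesis using 1 card0 cardP by simp
    next
      case False
      then have "1 \<le> i + 3 * j" "card \<P> = card \<P>0" using cardP by auto
      then have "4 * (x + 2 * y + (n4 + i + j + 3 * z)) + 12 * k < CARD('a)" using 1 by linarith
      then show ?thesis using card0 \<open>card \<P> = card \<P>0\<close> by simp
    qed
  qed
  obtain \<P>1 where \<P>1: "\<P>1 \<subseteq> \<P>" "card \<P>1 = x + 2 * y"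
    using need by (metis add_leD1 obtain_subset_with_card_n)
  have "n4 + i + j + 3 * z \<le> card (\<P> - \<P>1)" using need \<P>1 by (simp add: card_Diff_subset)
  then obtain \<P>2 where \<P>2: "\<P>2 \<subseteq> \<P> - \<P>1" "card \<P>2 = n4 + i + j + 3 * z"
    by (metis obtain_subset_with_card_n)
  have KD: "K \<inter> lines.used D = {}" using lines.used_subset[OF D(1)] by blast
  have PD: "\<Union>\<P> \<inter> lines.used D = {}" using cover KD by (auto simp: \<P>_def)
  have "packable (lines.used D \<union> \<Union>\<P>1)
      (sum_list (map half_line_sizes (replicate x 1 @ replicate y 2 @ replicate sp 0)))"
    using D k \<P>1 pool_subset[OF pool \<P>1(1)] PD
    by (intro lines_packable) (auto simp: sum_list_replicate)
  then have p1: "packable (lines.used D \<union> \<Union>\<P>1)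
      (replicate_mset (2 * x) 5 + replicate_mset (2 * y) 7 + replicate_mset sp 6)"
    by (simp only: sum_half_line_sizes)
  have "pool \<P>2" using pool_subset[OF pool] \<P>2 by blast
  then have p2: "packable (\<Union>\<P>2) (replicate_mset (n4 + i + j) 4 + replicate_mset (2 * z) 6)"
    using \<P>2(2) by (rule pool_packable)
  have "(lines.used D \<union> \<Union>\<P>1) \<inter> \<Union>\<P>2 = {}"
    using PD \<P>1(1) \<P>2(1) pool_Union_disjoint[OF pool \<P>1(1)] by blast
  from packable_union[OF p1 p2 this]
  have p12: "packable (lines.used D \<union> \<Union>\<P>1 \<union> \<Union>\<P>2)
      (replicate_mset (2 * x) 5 + replicate_mset (2 * y) 7 + replicate_mset sp 6
        + (replicate_mset (n4 + i + j) 4 + replicate_mset (2 * z) 6))" .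
  define M :: "nat multiset" where "M = replicate_mset n4 4 + replicate_mset (2 * x) 5 + replicate_mset n6 6
    + replicate_mset (2 * y) 7"
  have M: "packable (lines.used D \<union> \<Union>\<P>1 \<union> \<Union>\<P>2) (M + replicate_mset (i + j) 4)"
  proof (rule packable_subset_mset[OF p12])
    show "M + replicate_mset (i + j) 4 \<subseteq># replicate_mset (2 * x) 5 + replicate_mset (2 * y) 7
        + replicate_mset sp 6 + (replicate_mset (n4 + i + j) 4 + replicate_mset (2 * z) 6)"
      using z(1) by (intro mset_subset_eqI) (simp add: M_def)
  qed
  have goal: "replicate_mset n4 (4::nat) + replicate_mset n5 5 + replicate_mset n6 6 + replicate_mset n7 7
      = M + replicate_mset i 5 + replicate_mset j 7"
    by (intro multiset_eqI) (simp add: M_def n5 n7)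
  have "packable (UNIV :: 'a set) (M + replicate_mset i 5 + replicate_mset j 7)"
  proof (cases "i = 0 \<and> j = 0")
    case True
    then show ?thesis using packable_mono[OF M subset_UNIV] by simp
  next
    case False
    have "K \<inter> (lines.used D \<union> \<Union>\<P>1 \<union> \<Union>\<P>2) = {}"
    proof -
      have "\<Union>\<P> \<inter> K = {}" using False cover by (auto simp: \<P>_def)
      then show ?thesis using KD \<P>1(1) \<P>2(1) by blast
    qed
    then have "packable (UNIV :: 'a set) ({#1, 3#} + (M + replicate_mset (i + j) 4))"
      using packable_mono[OF packable_union[OF K_packable M] subset_UNIV] by simp
    moreover have "i = 1 \<and> j = 0 \<or> i = 0 \<and> j = 1 \<or> i = 1 \<and> j = 1"
      using False n5(2) n7(2) by auto
    ultimately consider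
      "i = 1" "j = 0" "packable (UNIV :: 'a set) (add_mset 1 (add_mset 4 (add_mset 3 M)))"
      | "i = 0" "j = 1" "packable (UNIV :: 'a set) (add_mset 3 (add_mset 4 (add_mset 1 M)))"
      | "i = 1" "j = 1" "packable (UNIV :: 'a set) (add_mset 1 (add_mset 4 (add_mset 3 (add_mset 4 M))))"
      by (auto simp: add_mset_commute numeral_2_eq_2)
    then show ?thesis
    proof cases
      case 1
      from packable_drop[of _ 3] packable_merge[OF 1(3)]
      have "packable (UNIV :: 'a set) (add_mset 5 M)" by (simp add: add_mset_commute)
      then show ?thesis using 1 by simp
    next
      case 2
      from packable_drop[of _ 1] packable_merge[OF 2(3)]
      have "packable (UNIV :: 'a set) (add_mset 7 M)" by (simp add: add_mset_commute)
      then show ?thesis using 2 by simp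
    next
      case 3
      from packable_merge[OF 3(3)] have "packable (UNIV :: 'a set) (add_mset 3 (add_mset 4 (add_mset 5 M)))"
        by (simp add: add_mset_commute)
      from packable_merge[OF this] have "packable (UNIV :: 'a set) (add_mset 5 (add_mset 7 M))"
        by (simp add: add_mset_commute)
      then show ?thesis using 3 by (simp add: add_mset_commute)
    qed
  qed
  then show ?thesis by (simp only: goal)
qed

end

section \<open>Lines in elementary abelian 2-groups\<close>

definition involutions :: "'g::ab_group_add set" where
  "involutions = {x. x + x = 0}"

lemma mem_involutions: "x \<in> involutions \<longleftrightarrow> x + x = 0" by (simp add: involutions_def)

lemma zero_involution [simp]: "0 \<in> involutions" by (simp add: mem_involutions)

lemma add_involutions: "x \<in> involutions \<Longrightarrow> y \<in> involutions \<Longrightarrow> x + y \<in> involutions"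
proof -
  assume "x \<in> involutions" "y \<in> involutions"
  moreover have "(x + y) + (x + y) = (x + x) + (y + y)" by (simp add: ac_simps)
  ultimately show ?thesis by (simp only: mem_involutions) simp
qed

lemma uminus_involution: "x \<in> involutions \<Longrightarrow> - x = x"
  by (simp add: mem_involutions minus_unique)

lemma diff_involutions: "x \<in> involutions \<Longrightarrow> y \<in> involutions \<Longrightarrow> x - y \<in> involutions"
  using add_involutions[of x y] uminus_involution[of y] by (metis diff_conv_add_uminus)

lemma double_eq_iff: "x + x = y + y \<longleftrightarrow> x - y \<in> involutions"
proof -
  have "(x - y) + (x - y) = (x + x) - (y + y)" by (simp add: algebra_simps)
  then show ?thesis by (simp only: mem_involutions) simp
qed

definition elementary_subgroup :: "'g::ab_group_add set \<Rightarrow> bool" where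
  "elementary_subgroup G \<longleftrightarrow> 0 \<in> G \<and> (\<forall>x\<in>G. \<forall>y\<in>G. x + y \<in> G) \<and> (\<forall>x\<in>G. x + x = 0)"

text \<open>
  Complete mappings of a group: both \<open>\<sigma>\<close> and \<open>x + \<sigma> x\<close> are permutations.
\<close>

definition complete_mapping :: "'g::ab_group_add set \<Rightarrow> ('g \<Rightarrow> 'g) \<Rightarrow> bool" where
  "complete_mapping G \<sigma> \<longleftrightarrow> \<sigma> ` G \<subseteq> G \<and> inj_on \<sigma> G \<and> inj_on (\<lambda>x. x + \<sigma> x) G"

definition line_packing :: "'g::ab_group_add set \<Rightarrow> 'g set set \<Rightarrow> bool" where
  "line_packing G F \<longleftrightarrow> (\<forall>L\<in>F. L \<subseteq> G - {0} \<and> card L = 3 \<and> \<Sum>L = 0) \<and>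
     (\<forall>L\<in>F. \<forall>M\<in>F. L \<noteq> M \<longrightarrow> L \<inter> M = {})"

lemma elementary_uminus: "elementary_subgroup G \<Longrightarrow> x \<in> G \<Longrightarrow> - x = x"
  by (simp add: elementary_subgroup_def minus_unique)

context klein_subgroup
begin

definition rot :: "'g \<Rightarrow> 'g" where
  "rot k = (if k = 0 then 0 else if k = a then b else if k = b then a + b else a)"

lemma rot: "rot 0 = 0" "rot a = b" "rot b = a + b" "rot (a + b) = a"
  by (simp_all add: rot_def)

lemma rot_K: "k \<in> K \<Longrightarrow> rot k \<in> K"
  by (auto simp: K_def rot)

lemma inj_rot: "inj_on rot K"
  unfolding K_def by (rule inj_onI) (auto simp: rot)

lemma inj_add_rot: "inj_on (\<lambda>k. k + rot k) K"
proof -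
  have *: "b + (a + b) = a" "a + b + a = b" by (simp_all add: ac_simps)
  show ?thesis unfolding K_def by (simp add: inj_on_def rot *)
qed

text \<open>
  The three nontrivial cosets of \<open>G\<close> in \<open>G + K\<close> are partitioned into the lines formed by \<open>g + a\<close>,
  \<open>\<sigma> g + b\<close> and \<open>g + \<sigma> g + (a + b)\<close>. The new complete mapping is the sum of \<open>\<sigma>\<close> on \<open>G\<close> and the rotation on
  \<open>K\<close>.
\<close>

lemma elementary_extension:
  assumes G: "elementary_subgroup G" "G \<inter> K = {0}"
    and \<sigma>: "complete_mapping G \<sigma>" and F: "line_packing G F"
  obtains G' :: "'g set" and \<sigma>' F' where "elementary_subgroup G'" "complete_mapping G' \<sigma>'" "line_packing G' F'"
    "card G' = 4 * card G" "card F' = card F + card G"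
proof -
  define s where "s = (\<lambda>(g, k). g + k :: 'g)"
  define G' where "G' = s ` (G \<times> K)"
  have add: "x + y \<in> G" if "x \<in> G" "y \<in> G" for x y using G that by (simp add: elementary_subgroup_def)
  have zero: "0 \<in> G" using G by (simp add: elementary_subgroup_def)
  have dbl: "x + x = 0" if "x \<in> G" for x using G that by (simp add: elementary_subgroup_def)
  have unique: "g = g' \<and> k = k'" if "g \<in> G" "g' \<in> G" "k \<in> K" "k' \<in> K" "g + k = g' + k'" for g g' k k'
  proof -
    have "g + g' = g - g'" using elementary_uminus[OF G(1) that(2)] by (metis diff_conv_add_uminus)
    moreover have "g - g' = k' - k" using that(5) by (simp add: algebra_simps)
    ultimately have "g + g' \<in> G \<inter> K" using add[OF that(1,2)] diff_K[OF that(4,3)] by simp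
    then have "g - g' = 0" using G(2) \<open>g + g' = g - g'\<close> by auto
    then show ?thesis using that(5) by simp
  qed
  have inj_s: "inj_on s (G \<times> K)" using unique by (auto simp: inj_on_def s_def)
  have mem: "g + k \<in> G'" if "g \<in> G" "k \<in> K" for g k
    using that by (auto simp: G'_def s_def)
  have memE: "\<exists>g\<in>G. \<exists>k\<in>K. x = g + k" if "x \<in> G'" for x
    using that by (auto simp: G'_def s_def)
  \<comment> \<open>The two coordinates of an element of \<open>G + K\<close>.\<close>
  define d where "d = inv_into (G \<times> K) s"
  have d: "d (g + k) = (g, k)" if "g \<in> G" "k \<in> K" for g k
    using inv_into_f_f[OF inj_s, of "(g, k)"] that by (simp add: d_def s_def)
  define \<sigma>' where "\<sigma>' x = \<sigma> (fst (d x)) + rot (snd (d x))" for x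
  have \<sigma>': "\<sigma>' (g + k) = \<sigma> g + rot k" if "g \<in> G" "k \<in> K" for g k
    using d[OF that] by (simp add: \<sigma>'_def)
  have \<sigma>G: "\<sigma> g \<in> G" if "g \<in> G" for g using \<sigma> that by (auto simp: complete_mapping_def)
  have inj: "inj_on f G'" if f: "\<And>g k. g \<in> G \<Longrightarrow> k \<in> K \<Longrightarrow> f (g + k) = h g + t k"
    and h: "inj_on h G" "h ` G \<subseteq> G" and t: "inj_on t K" "t ` K \<subseteq> K" for f h t
  proof (rule inj_onI)
    fix x y assume "x \<in> G'" "y \<in> G'" and eq: "f x = f y"
    then obtain g k g' k' where gk: "g \<in> G" "k \<in> K" "x = g + k" "g' \<in> G" "k' \<in> K" "y = g' + k'"
      using memE by meson
    then have "h g + t k = h g' + t k'" using eq f by simp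
    moreover have "h g \<in> G" "h g' \<in> G" "t k \<in> K" "t k' \<in> K" using h(2) t(2) gk by auto
    ultimately have "h g = h g' \<and> t k = t k'" using unique by blast
    then show "x = y" using h(1) t(1) gk by (auto dest: inj_onD)
  qed
  have "elementary_subgroup G'"
    unfolding elementary_subgroup_def
  proof (intro conjI ballI)
    show "0 \<in> G'" using mem[OF zero zero_K] by simp
    fix x assume "x \<in> G'"
    then obtain g k where x: "x = g + k" "g \<in> G" "k \<in> K" using memE by meson
    have "x + x = (g + g) + (k + k)" by (simp add: x ac_simps)
    then show "x + x = 0" using dbl[OF x(2)] double_K[OF x(3)] by simp
    fix y assume "y \<in> G'"
    then obtain g' k' where y: "y = g' + k'" "g' \<in> G" "k' \<in> K" using memE by meson
    have "x + y = (g + g') + (k + k')" by (simp add: x y ac_simps)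
    then show "x + y \<in> G'" using mem[OF add[OF x(2) y(2)] add_K[OF x(3) y(3)]] by simp
  qed
  moreover have "complete_mapping G' \<sigma>'"
    unfolding complete_mapping_def
  proof (intro conjI)
    show "\<sigma>' ` G' \<subseteq> G'"
    proof clarify
      fix x assume "x \<in> G'"
      then obtain g k where "x = g + k" "g \<in> G" "k \<in> K" using memE by meson
      then show "\<sigma>' x \<in> G'" using mem[OF \<sigma>G rot_K] \<sigma>' by simp
    qed
    show "inj_on \<sigma>' G'"
      by (rule inj[of \<sigma>' \<sigma> rot]) (use \<sigma> \<sigma>' inj_rot rot_K in \<open>auto simp: complete_mapping_def\<close>)
    show "inj_on (\<lambda>x. x + \<sigma>' x) G'"
      by (rule inj[of _ "\<lambda>g. g + \<sigma> g" "\<lambda>k. k + rot k"])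
        (use \<sigma> \<sigma>' \<sigma>G inj_add_rot rot_K add add_K in \<open>auto simp: complete_mapping_def ac_simps\<close>)
  qed
  moreover have cardG': "card G' = 4 * card G"
    unfolding G'_def using inj_s by (simp add: card_image card_cartesian_product card_K)
  moreover define line where "line g = {g + a, \<sigma> g + b, (g + \<sigma> g) + (a + b)}" for g
  define F' where "F' = F \<union> line ` G"
  have Ks: "0 \<in> K" "a \<in> K" "b \<in> K" "a + b \<in> K" by (auto simp: K_def)
  have line_meet: "g = h" if gh: "g \<in> G" "h \<in> G" "line g \<inter> line h \<noteq> {}" for g h
  proof -
    have in_G: "\<sigma> g \<in> G" "\<sigma> h \<in> G" "g + \<sigma> g \<in> G" "h + \<sigma> h \<in> G" using gh \<sigma>G add by auto
    define P where "P g = {(g, a), (\<sigma> g, b), (g + \<sigma> g, a + b)}" for g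
    have P: "line g = s ` P g" "line h = s ` P h" by (simp_all add: line_def P_def s_def)
    have "P g \<subseteq> G \<times> K" "P h \<subseteq> G \<times> K" using gh in_G Ks by (auto simp: P_def)
    then have "s ` (P g \<inter> P h) \<noteq> {}"
      using gh(3) unfolding P by (simp add: inj_on_image_Int[OF inj_s])
    then have "g = h \<or> \<sigma> g = \<sigma> h \<or> g + \<sigma> g = h + \<sigma> h" by (auto simp: P_def)
    then show ?thesis using \<sigma> gh by (auto simp: complete_mapping_def dest: inj_onD)
  qed
  have line: "line g \<subseteq> G' - G" "card (line g) = 3" "\<Sum>(line g) = 0" if g: "g \<in> G" for g
  proof -
    have in_G: "\<sigma> g \<in> G" "g + \<sigma> g \<in> G" using g \<sigma>G add by auto
    have out: "x + k \<notin> G" if "x \<in> G" "k \<in> K" "k \<noteq> 0" for x k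
    proof
      assume "x + k \<in> G"
      then show False using unique[of "x + k" x 0 k] that zero_K by simp
    qed
    show "line g \<subseteq> G' - G"
      using mem out g in_G Ks by (auto simp: line_def)
    have ne: "g + a \<noteq> \<sigma> g + b" "g + a \<noteq> (g + \<sigma> g) + (a + b)" "\<sigma> g + b \<noteq> (g + \<sigma> g) + (a + b)"
      using unique[of g "\<sigma> g" a b] unique[of g "g + \<sigma> g" a "a + b"]
        unique[of "\<sigma> g" "g + \<sigma> g" b "a + b"] g in_G Ks by auto
    then show "card (line g) = 3" by (simp add: line_def)
    have "\<Sum>(line g) = (g + a) + (\<sigma> g + b) + ((g + \<sigma> g) + (a + b))"
      unfolding line_def using ne by (simp add: add.assoc)
    also have "\<dots> = (g + g) + (\<sigma> g + \<sigma> g) + (a + a) + (b + b)" by (simp add: ac_simps)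
    finally show "\<Sum>(line g) = 0" using dbl g in_G by simp
  qed
  have FG: "L \<subseteq> G" if "L \<in> F" for L using F that by (auto simp: line_packing_def)
  have GG': "G \<subseteq> G'" using mem[OF _ zero_K] by fastforce
  have "line_packing G' F'"
    unfolding line_packing_def
  proof (intro conjI ballI impI)
    fix L assume "L \<in> F'"
    then consider "L \<in> F" | g where "g \<in> G" "L = line g" by (auto simp: F'_def)
    then have "L \<subseteq> G' - {0} \<and> card L = 3 \<and> \<Sum>L = 0"
    proof cases
      case 1
      then have "L \<subseteq> G - {0} \<and> card L = 3 \<and> \<Sum>L = 0" using F by (simp add: line_packing_def)
      then show ?thesis using GG' by blast
    next
      case (2 g)
      then show ?thesis using line[of g] zero by auto
    qed
    then show "L \<subseteq> G' - {0}" "card L = 3" "\<Sum>L = 0" by simp_all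
  next
    fix L M assume LM: "L \<in> F'" "M \<in> F'" "L \<noteq> M"
    then consider "L \<in> F" "M \<in> F" | g where "L \<in> F" "g \<in> G" "M = line g"
      | g where "M \<in> F" "g \<in> G" "L = line g" | g h where "g \<in> G" "h \<in> G" "L = line g" "M = line h"
      by (auto simp: F'_def)
    then show "L \<inter> M = {}"
    proof cases
      case 1
      then show ?thesis using F LM(3) by (auto simp: line_packing_def)
    next
      case (2 g)
      then show ?thesis using FG[of L] line(1)[of g] by auto
    next
      case (3 g)
      then show ?thesis using FG[of M] line(1)[of g] by auto
    next
      case (4 g h)
      then show ?thesis using line_meet[of g h] LM(3) by auto
    qed
  qed
  moreover have "card F' = card F + card G"
  proof -
    have ne: "line g \<noteq> {}" for g by (simp add: line_def)
    have "inj_on line G"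
    proof (rule inj_onI)
      fix g h assume "g \<in> G" "h \<in> G" "line g = line h"
      then show "g = h" using line_meet[of g h] ne[of h] by simp
    qed
    moreover have "F \<inter> line ` G = {}"
    proof -
      have "line g \<notin> F" if "g \<in> G" for g using FG[of "line g"] line(1)[OF that] ne[of g] by blast
      then show ?thesis by auto
    qed
    ultimately show ?thesis unfolding F'_def by (simp add: card_Un_disjoint card_image)
  qed
  ultimately show thesis using that by blast
qed

text \<open>
  In coordinates the complete mapping is multiplication by a root of \<open>X\<^sup>3 + X + 1\<close> in the
  field with eight elements. The order 8 starts the chain for groups of odd rank. Any
  two lines in the group of order 8 meet, so one line is all that can be packed.
\<close>

lemma elementary_order_eight:
  assumes c: "c + c = 0" "c \<notin> K"
  obtains G :: "'g set" and \<sigma> F where "elementary_subgroup G" "complete_mapping G \<sigma>" "line_packing G F"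
    "card G = 8" "card F = 1"
proof -
  define e where "e = (\<lambda>(p, q, r). (if p then a else 0) + (if q then b else 0) + (if r then c else 0))"
  have add: "e (p, q, r) + e (p', q', r') = e (p \<noteq> p', q \<noteq> q', r \<noteq> r')" for p q r p' q' r'
  proof -
    have "(if p then x else 0) + (if p' then x else 0) = (if p \<noteq> p' then x else 0)"
      if "x + x = 0" for p p' and x :: 'g using that by auto
    note parts = this[OF a(2), of p p'] this[OF b(2), of q q'] this[OF c(1), of r r']
    have swap: "(x + y + z) + (x' + y' + z') = (x + x') + (y + y') + (z + z')" for x y z x' y' z' :: 'g
      by (simp add: ac_simps)
    show ?thesis unfolding e_def prod.case swap parts ..
  qed
  have nonzero: "e (p, q, r) \<noteq> 0" if "p \<or> q \<or> r" for p q r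
  proof (cases r)
    case False
    then show ?thesis using that by (auto simp: e_def)
  next
    case True
    define k where "k = (if p then a else 0) + (if q then b else 0)"
    have k: "k \<in> K" by (auto simp: k_def K_def)
    have "k + c \<noteq> 0"
    proof
      assume "k + c = 0"
      then have "c = k" using uminus_K[OF k] by (metis minus_unique)
      then show False using c k by simp
    qed
    then show ?thesis using True by (simp add: e_def k_def)
  qed
  have ne: "e (p, q, r) = 0 \<longleftrightarrow> \<not> p \<and> \<not> q \<and> \<not> r" for p q r
    using nonzero[of p q r] by (cases "p \<or> q \<or> r") (auto simp: e_def)
  have inj: "inj e"
  proof (rule injI)
    fix x y assume "e x = e y"
    obtain p q r p' q' r' where xy: "x = (p, q, r)" "y = (p', q', r')" by (metis surj_pair)
    have "e y + e y = 0" unfolding xy add by (simp add: ne)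
    then have "e x + e y = 0" using \<open>e x = e y\<close> by simp
    then show "x = y" unfolding xy add by (simp add: ne)
  qed
  define G where "G = range e"
  define m where "m = (\<lambda>(p, q, r). (r :: bool, p \<noteq> r, q :: bool))"
  define \<sigma> where "\<sigma> x = e (m (inv e x))" for x
  have \<sigma>: "\<sigma> (e v) = e (m v)" for v by (simp add: \<sigma>_def inv_f_f[OF inj])
  have "elementary_subgroup G"
    unfolding elementary_subgroup_def
  proof (intro conjI ballI)
    have "0 = e (False, False, False)" by (simp add: e_def)
    then show "0 \<in> G" by (auto simp: G_def)
    fix x assume "x \<in> G"
    then obtain p q r where x: "x = e (p, q, r)" by (auto simp: G_def)
    show "x + x = 0" unfolding x add by (simp add: ne)
    fix y assume "y \<in> G"
    then obtain p' q' r' where y: "y = e (p', q', r')" by (auto simp: G_def)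
    show "x + y \<in> G" unfolding x y add by (simp add: G_def)
  qed
  moreover have "complete_mapping G \<sigma>"
    unfolding complete_mapping_def
  proof (intro conjI)
    show "\<sigma> ` G \<subseteq> G" using \<sigma> by (auto simp: G_def)
    show "inj_on \<sigma> G"
    proof (rule inj_onI)
      fix x y assume "x \<in> G" "y \<in> G" and eq: "\<sigma> x = \<sigma> y"
      then obtain p q r p' q' r' where xy: "x = e (p, q, r)" "y = e (p', q', r')" by (auto simp: G_def)
      have "m (p, q, r) = m (p', q', r')" using eq inj unfolding xy \<sigma> by (rule injD[rotated])
      then show "x = y" unfolding xy m_def
        by (cases p; cases q; cases r; cases p'; cases q'; cases r') simp_all
    qed
    show "inj_on (\<lambda>x. x + \<sigma> x) G"
    proof (rule inj_onI)
      fix x y assume "x \<in> G" "y \<in> G" and eq: "x + \<sigma> x = y + \<sigma> y"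
      then obtain p q r p' q' r' where xy: "x = e (p, q, r)" "y = e (p', q', r')" by (auto simp: G_def)
      have "(p \<noteq> r, q \<noteq> (p \<noteq> r), r \<noteq> q) = (p' \<noteq> r', q' \<noteq> (p' \<noteq> r'), r' \<noteq> q')"
        using eq inj unfolding xy \<sigma> m_def prod.case add by (rule injD[rotated])
      then show "x = y" unfolding xy
        by (cases p; cases q; cases r; cases p'; cases q'; cases r') simp_all
    qed
  qed
  moreover have "line_packing G {{a, b, a + b}}"
  proof -
    have "a = e (True, False, False)" "b = e (False, True, False)" "a + b = e (True, True, False)"
      by (simp_all add: e_def)
    then have "{a, b, a + b} \<subseteq> G" unfolding G_def by blast
    then show ?thesis by (simp add: line_packing_def ac_simps)
  qed
  moreover have "card G = 8" unfolding G_def by (simp add: card_image inj card_UNIV_bool card_prod)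
  ultimately show thesis using that[of G \<sigma> "{{a, b, a + b}}"] by simp
qed

end

text \<open>
  The rank grows by two in each step until at most one generator is missing. The number \<open>t\<close> of
  elements outside all lines does not change.
\<close>

lemma extend_line_packing:
  fixes G :: "'g::{finite, ab_group_add} set"
  assumes "elementary_subgroup G" "complete_mapping G \<sigma>" "line_packing G F" "3 * card F + t = card G"
    "odd t" "odd (card F) \<or> card F = 0"
  shows "\<exists>(H :: 'g set) E. elementary_subgroup H \<and> line_packing H E \<and> 3 * card E + t = card H \<and>
    (odd (card E) \<or> card E = 0) \<and> (H = involutions \<or> card (involutions :: 'g set) = 2 * card H)"
  using assms
proof (induction "CARD('g) - card G" arbitrary: G \<sigma> F rule: less_induct)
  case less
  have Gsub: "G \<subseteq> involutions" using less.prems(1) by (auto simp: elementary_subgroup_def involutions_def)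
  have zero: "0 \<in> G" using less.prems(1) by (simp add: elementary_subgroup_def)
  have add: "x + y \<in> G" if "x \<in> G" "y \<in> G" for x y
    using less.prems(1) that by (simp add: elementary_subgroup_def)
  \<comment> \<open>Either \<open>G\<close> is everything, or one generator is missing, or two further generators are adjoined.\<close>
  show ?case
  proof (cases "G = involutions")
    case True
    then show ?thesis using less.prems by blast
  next
    case False
    then obtain u where u: "u \<in> involutions" "u \<notin> G" using Gsub by blast
    have disj: "G \<inter> (+) u ` G = {}"
    proof (rule ccontr)
      assume "G \<inter> (+) u ` G \<noteq> {}"
      then obtain g where "g \<in> G" "u + g \<in> G" by auto
      then have "(u + g) + g \<in> G" using add by blast
      then show False using less.prems(1) \<open>g \<in> G\<close> u by (simp add: elementary_subgroup_def add.assoc)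
    qed
    show ?thesis
    proof (cases "G \<union> (+) u ` G = involutions")
      case True
      then have "card (involutions :: 'g set) = 2 * card G"
        using disj card_Un_disjoint[of G "(+) u ` G"] by (simp add: card_image)
      then show ?thesis using less.prems by blast
    next
      case False
      have "G \<union> (+) u ` G \<subseteq> involutions" using Gsub u add_involutions by auto
      then obtain v where v: "v \<in> involutions" "v \<notin> G" "v \<notin> (+) u ` G" using False by blast
      interpret klein_subgroup u v
        using u v zero by unfold_locales (auto simp: mem_involutions image_iff)
      have "u + v \<notin> G"
      proof
        assume "u + v \<in> G"
        then have "u + (u + v) \<in> (+) u ` G" by (rule imageI)
        then show False using v by simp
      qed
      then have "G \<inter> K = {0}" using zero u v by (auto simp: K_def)
      then obtain G' :: "'g set" and \<sigma>' F' where G': "elementary_subgroup G'" "complete_mapping G' \<sigma>'"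
          "line_packing G' F'" "card G' = 4 * card G" "card F' = card F + card G"
        using elementary_extension[of G \<sigma> F] less.prems by blast
      have "0 < card G" using zero by (auto simp: card_gt_0_iff)
      moreover have "card G' \<le> CARD('g)" using card_mono[of UNIV G'] by simp
      ultimately have "CARD('g) - card G' < CARD('g) - card G" using G'(4) by simp
      moreover have "3 * card F' + t = card G'" using less.prems(4) G'(4,5) by simp
      moreover have "odd (card F')"
      proof -
        have "card F' = 4 * card F + t" using G'(5) less.prems(4) by simp
        then show ?thesis using less.prems(5) by simp
      qed
      ultimately show ?thesis using less.hyps[of G' \<sigma>' F'] G' less.prems(5) by blast
    qed
  qed
qed

text \<open>
  The chain from the trivial group ends at the whole group or at a subgroup of index 2, and so does
  the chain from a subgroup of order 8. If both ended at index 2, the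
  order of the whole group would be 2 modulo 3 by the first chain and 1 modulo 3 by the second.
\<close>

lemma involutions_line_packing:
  assumes "4 < card (involutions :: 'g::{finite, ab_group_add} set)"
  shows "\<exists>F. line_packing (involutions :: 'g set) F \<and> odd (card F) \<and>
    (3 * card F + 1 = card (involutions :: 'g set) \<or> 3 * card F + 5 = card (involutions :: 'g set))"
proof -
  have "elementary_subgroup {0::'g}" "complete_mapping {0::'g} id" "line_packing {0::'g} {}"
    by (simp_all add: elementary_subgroup_def complete_mapping_def line_packing_def)
  then obtain H :: "'g set" and E where H: "elementary_subgroup H" "line_packing H E" "3 * card E + 1 = card H"
      "odd (card E) \<or> card E = 0" "H = involutions \<or> card (involutions :: 'g set) = 2 * card H"
    using extend_line_packing[of "{0::'g}" id "{}" 1] by auto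
  show ?thesis
  proof (cases "H = involutions")
    case True
    then have "card E \<noteq> 0" using H(3) assms by auto
    then show ?thesis using H True by (intro exI[of _ E]) auto
  next
    case False
    have pick: "\<exists>x. x \<in> involutions \<and> x \<notin> X" if "card X \<le> 4" for X :: "'g set"
      using exists_outside[of X involutions] that assms by simp
    obtain u :: 'g where u: "u \<in> involutions" "u \<notin> {0}" using pick[of "{0}"] by auto
    have "card {0, u} \<le> 4" by (simp add: card_insert_if)
    then obtain v where v: "v \<in> involutions" "v \<notin> {0, u}" using pick by blast
    interpret klein_subgroup u v using u v by unfold_locales (auto simp: mem_involutions)
    obtain c where "c \<in> involutions" "c \<notin> K" using pick[of K] card_K by auto
    then obtain G :: "'g set" and \<sigma> F where "elementary_subgroup G" "complete_mapping G \<sigma>"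
        "line_packing G F" "card G = 8" "card F = 1"
      using elementary_order_eight[of c] by (auto simp: mem_involutions)
    then obtain H' :: "'g set" and E' where H': "line_packing H' E'" "3 * card E' + 5 = card H'"
      "odd (card E') \<or> card E' = 0" "H' = involutions \<or> card (involutions :: 'g set) = 2 * card H'"
      using extend_line_packing[of G \<sigma> F 5] by auto
    have "card (involutions :: 'g set) = 2 * (3 * card E + 1)" using H False by simp
    moreover have "2 * (3 * card E + 1) \<noteq> 2 * (3 * card E' + 5)" by presburger
    ultimately have "H' = involutions" using H' by auto
    moreover have "card E' \<noteq> 0"
    proof
      assume "card E' = 0"
      then have "card (involutions :: 'g set) = 5" using H'(2) \<open>H' = involutions\<close> by simp
      then show False using \<open>card (involutions :: 'g set) = 2 * (3 * card E + 1)\<close> by presburger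
    qed
    ultimately show ?thesis using H' by (intro exI[of _ E']) auto
  qed
qed

section \<open>Pairs of opposite zero-sum triples\<close>

text \<open>
  A triple of classes stands for the two opposite zero-sum sets \<open>{x, y, z}\<close> and \<open>{-x, -y, -z}\<close>.
\<close>

interpretation opp: class_system "- involutions :: 'g::{finite, ab_group_add} set" "\<lambda>x. {x, - x}" 2
proof
  fix x y a :: 'g assume x: "x \<in> - involutions"
  have ne: "x \<noteq> - x" using x by (metis ComplD mem_involutions right_minus)
  then show "card {x, - x} = 2" by simp
  have "- x \<notin> involutions"
  proof
    assume "- x \<in> involutions"
    have "- (x + x) = - x + - x" by simp
    also have "\<dots> = 0" using \<open>- x \<in> involutions\<close> by (simp only: mem_involutions)
    finally have "x + x = 0" by (simp only: neg_equal_0_iff_equal)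
    then show False using x by (simp add: mem_involutions)
  qed
  then show "{x, - x} \<subseteq> - involutions" using x by blast
  assume "y \<in> {x, - x}"
  then show "{y, - y} = {x, - x}" "y = - x \<or> y - x + a \<in> {a, - a}" by auto
qed auto

lemma card_halves_le:
  "card {v :: 'g::{finite, ab_group_add}. v + v = x} \<le> card (involutions :: 'g set)"
proof (cases "\<exists>v. v + v = x")
  case True
  then obtain v where v: "v + v = x" by blast
  have "{u. u + u = x} \<subseteq> (+) v ` involutions"
  proof
    fix u assume "u \<in> {u. u + u = x}"
    then have "u - v \<in> involutions" using v double_eq_iff[of u v] by simp
    then show "u \<in> (+) v ` involutions" by (intro image_eqI[of _ _ "u - v"]) simp_all
  qed
  then have "card {u. u + u = x} \<le> card ((+) v ` involutions)" by (rule card_mono[rotated]) simp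
  then show ?thesis by (simp add: card_image)
next
  case False
  then show ?thesis by simp
qed

lemma opp_triple_iff:
  "opp.triple (x, y, z) \<longleftrightarrow> x \<notin> involutions \<and> y \<notin> involutions \<and> z \<notin> involutions \<and>
     x + y + z = 0 \<and> x \<noteq> y \<and> x \<noteq> - y \<and> x \<noteq> z \<and> x \<noteq> - z \<and> y \<noteq> z \<and> y \<noteq> - z"
  by (auto simp: opp.triple_def doubleton_eq_iff)

text \<open>
  Put \<open>I\<close> for the set of involutions and zero. If \<open>y + y = x\<close> and \<open>y\<close>, \<open>y + t\<close> are in \<open>A\<close> with \<open>t\<close> in \<open>I\<close>, then
  \<open>y\<close>, \<open>y + t\<close> and \<open>-(x + t)\<close> add up to zero, so in general \<open>x + t\<close> is not in \<open>A\<close>. Hence the halves of \<open>x\<close>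
  in \<open>A\<close> and the halves of \<open>x + x\<close> in \<open>A\<close> cannot both be numerous.
\<close>

lemma card_halves_add_le:
  fixes A :: "'g::{finite, ab_group_add} set"
  assumes A: "A \<subseteq> - involutions" "\<And>a. a \<in> A \<Longrightarrow> - a \<in> A"
    and none: "\<And>x y z. x \<in> A \<Longrightarrow> y \<in> A \<Longrightarrow> z \<in> A \<Longrightarrow> \<not> opp.triple (x, y, z)"
    and x: "x \<in> A" "x + x \<in> A"
  shows "card {v \<in> A. v + v = x} + card {v \<in> A. v + v = x + x} \<le> card (involutions :: 'g set) + 2"
proof -
  let ?I = "involutions :: 'g set" and ?S = "{v \<in> A. v + v = x}" and ?R = "{v \<in> A. v + v = x + x}"
  let ?C = "{v. v + v = x + x}"
  have xI: "x \<notin> ?I" using A x by blast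
  have cC: "card ?C \<le> card ?I" by (rule card_halves_le)
  have "?R \<subseteq> ?C" by blast
  then have "card ?R \<le> card ?C" by (rule card_mono[OF finite])
  then have R: "card ?R \<le> card ?I" using cC by linarith
  show ?thesis
  proof (cases "?S = {}")
    case True
    then show ?thesis using R by (simp only: card.empty)
  next
    case False
    then obtain y where y: "y \<in> A" "y + y = x" by blast
    have yI: "y \<notin> ?I" using A y by blast
    define T where "T = (\<lambda>v. v - y) ` ?S"
    have cT: "card T = card ?S" by (simp add: T_def card_image inj_on_def)
    have TI: "t \<in> ?I" if "t \<in> T" for t
      using that y by (auto simp: T_def double_eq_iff[symmetric])
    have TA: "y + t \<in> A" if "t \<in> T" for t using that by (auto simp: T_def)
    \<comment> \<open>If \<open>y\<close> has order 3, the triples above are degenerate, but then the two sets of halves are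
      opposite, and three elements \<open>y + t\<close>, \<open>y + r\<close>, \<open>y + (t + r)\<close> add up to zero instead.\<close>
    show ?thesis
    proof (cases "y + y + y = 0")
      case False
      have out: "x + t \<notin> A" if t: "t \<in> T - {0, y + y + y}" for t
      proof
        assume xt: "x + t \<in> A"
        have tI: "t \<in> ?I" "t + t = 0" "- t = t" using TI t uminus_involution by (auto simp: mem_involutions)
        have sum: "y + (y + t) + - (x + t) = 0" using y by (simp add: algebra_simps)
        have "\<not> opp.triple (y, y + t, - (x + t))" using none TA t y xt A by blast
        then have "y = y + t \<or> y = - (y + t) \<or> y = - (x + t) \<or> y = x + t
            \<or> y + t = - (x + t) \<or> y + t = x + t"
        proof -
          have "y + t \<in> A" "- (x + t) \<in> A" using TA t A(2)[OF xt] by blast+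
          then have "y \<notin> ?I" "y + t \<notin> ?I" "- (x + t) \<notin> ?I" using A(1) y(1) by blast+
          with \<open>\<not> opp.triple (y, y + t, - (x + t))\<close> sum show ?thesis
            unfolding opp_triple_iff minus_minus by blast
        qed
        then show False
        proof (elim disjE)
          assume "y = - (y + t)"
          then have "y + (y + t) = 0" by (metis right_minus neg_equal_iff_equal add.inverse_inverse minus_add_cancel add.commute)
          then have "x + t = 0" using y by (simp add: add.assoc[symmetric])
          then have "x = t" using tI by (metis minus_unique add.commute)
          then show False using xI tI by simp
        next
          assume "y = - (x + t)"
          then have "y + (x + t) = 0" by (metis left_minus)
          then have "(y + y + y) + t = 0" using y by (simp add: ac_simps)
          then have "y + y + y = t" using tI by (metis minus_unique add.commute)
          then show False using t by simp
        next
          assume "y = x + t"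
          then have "y + t = x + (t + t)" by (simp add: add.assoc)
          then have "y + t = y + y" using tI y by simp
          then show False using tI yI by simp
        next
          assume "y + t = - (x + t)"
          then have "(y + t) + (x + t) = 0" by (metis left_minus)
          then have "y + x + (t + t) = 0" by (simp add: ac_simps)
          then show False using False tI y by (simp add: ac_simps)
        next
          assume "y + t = x + t"
          then show False using y yI by (simp add: mem_involutions)
        qed (use t in auto)
      qed
      have "(+) x ` (T - {0, y + y + y}) \<subseteq> ?C - ?R"
      proof
        fix v assume "v \<in> (+) x ` (T - {0, y + y + y})"
        then obtain t where t: "t \<in> T - {0, y + y + y}" "v = x + t" by blast
        have "v + v = (x + x) + (t + t)" using t by (simp add: ac_simps)
        then have "v + v = x + x" using TI[of t] t by (simp add: mem_involutions)
        then show "v \<in> ?C - ?R" using out[OF t(1)] t(2) by simp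
      qed
      then have "card ((+) x ` (T - {0, y + y + y})) \<le> card (?C - ?R)" by (intro card_mono) auto
      then have 1: "card (T - {0, y + y + y}) \<le> card (?C - ?R)" by (simp add: card_image)
      have 2: "card (?C - ?R) = card ?C - card ?R" by (intro card_Diff_subset) auto
      have 3: "card ?R \<le> card ?C" by (intro card_mono) auto
      have "card T - card {0, y + y + y} \<le> card (T - {0, y + y + y})" by (rule diff_card_le_card_Diff) simp
      moreover have "card {0, y + y + y} \<le> 2" by (simp add: card_insert_if)
      ultimately show ?thesis using 1 2 3 cC cT by linarith
    next
      case True
      have xy: "x = - y" using True y by (metis minus_unique minus_equation_iff)
      have "?R = uminus ` ?S"
      proof (intro set_eqI iffI)
        fix v assume v: "v \<in> ?R"
        have "- v + - v = - (v + v)" by simp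
        also have "\<dots> = - (x + x)" using v by simp
        also have "\<dots> = y + y" using xy by simp
        finally have "- v \<in> ?S" using v A y by simp
        then show "v \<in> uminus ` ?S" by (intro image_eqI[of _ _ "- v"]) simp_all
      next
        fix v assume "v \<in> uminus ` ?S"
        then obtain u where u: "u \<in> A" "u + u = x" "v = - u" by blast
        have "v + v = - (u + u)" unfolding u(3) by simp
        also have "\<dots> = - (y + y)" unfolding u(2) y(2) ..
        also have "\<dots> = x + x" unfolding xy by simp
        finally show "v \<in> ?R" using u A by simp
      qed
      then have RS: "card ?R = card ?S" by (simp add: card_image)
      have "2 * card T \<le> card ?I + 2"
      proof (cases "T \<subseteq> {0}")
        case True
        then have "card T \<le> card {0::'g}" by (intro card_mono) auto
        then show ?thesis by simp
      next
        case False
        then obtain t where t: "t \<in> T" "t \<noteq> 0" by blast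
        have tI: "t \<in> ?I" "t + t = 0" using TI t by (auto simp: mem_involutions)
        have "t + r \<notin> T" if r: "r \<in> T - {0, t}" for r
        proof
          assume tr: "t + r \<in> T"
          have rI: "r \<in> ?I" "r + r = 0" "t + r \<in> ?I" using TI r tr by (auto simp: mem_involutions)
          have eq: "y + p \<noteq> - (y + q)" if pq: "p \<in> ?I" "q \<in> ?I" for p q
          proof
            assume "y + p = - (y + q)"
            then have "(y + p) + (y + q) = 0" by (metis left_minus)
            then have "x + (p + q) = 0" using y by (simp add: ac_simps)
            then have "x = - (p + q)" by (metis minus_unique minus_equation_iff)
            then show False using xI add_involutions[OF pq] uminus_involution by metis
          qed
          have "(y + t) + (y + r) + (y + (t + r)) = (y + y + y) + (t + t) + (r + r)"
            by (simp add: ac_simps)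
          then have "(y + t) + (y + r) + (y + (t + r)) = 0" using True tI rI by simp
          moreover have "t \<noteq> r" "t \<noteq> t + r" "r \<noteq> t + r" using r t by auto
          ultimately have "opp.triple (y + t, y + r, y + (t + r))"
            unfolding opp_triple_iff using eq tI rI TA[OF t(1)] TA[of r] TA[OF tr] r A by auto
          then show False using none TA t r tr by blast
        qed
        then have "(+) t ` (T - {0, t}) \<subseteq> ?I - T" using TI tI add_involutions by auto
        then have "card ((+) t ` (T - {0, t})) \<le> card (?I - T)" by (intro card_mono) auto
        then have 1: "card (T - {0, t}) \<le> card (?I - T)" by (simp add: card_image)
        have 2: "card (?I - T) = card ?I - card T" "card T \<le> card ?I"
          using TI by (auto intro!: card_Diff_subset card_mono)
        have "card T - card {0, t} \<le> card (T - {0, t})" by (rule diff_card_le_card_Diff) simp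
        moreover have "card {0, t} \<le> 2" by (simp add: card_insert_if)
        ultimately show ?thesis using 1 2 by linarith
      qed
      then show ?thesis using RS cT by simp
    qed
  qed
qed

text \<open>
  Suppose that \<open>x\<close> and \<open>x + x\<close> are in \<open>A\<close>. The differences of \<open>0\<close>, \<open>x\<close>, \<open>x + x\<close> are in \<open>A\<close> up to sign, so the
  translates of \<open>A\<close> by these elements are disjoint except for degenerate triples. There are many
  of these only if elements have many halves in \<open>A\<close>, which \<open>card_halves_add_le\<close> limits. In
  total \<open>3 * card A \<le> m + w + 10\<close>, where \<open>w\<close> is the number of solutions of \<open>v + v = 0\<close> and \<open>m\<close> the order of the
  group. This contradicts the density if \<open>5 * w \<le> m\<close>.
\<close>

lemma double_notin_dense:
  fixes A :: "'g::{finite, ab_group_add} set"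
  assumes A: "A \<subseteq> - involutions" "\<And>a. a \<in> A \<Longrightarrow> - a \<in> A"
    and none: "\<And>x y z. x \<in> A \<Longrightarrow> y \<in> A \<Longrightarrow> z \<in> A \<Longrightarrow> \<not> opp.triple (x, y, z)"
    and dense: "2 * CARD('g) + 23 \<le> 5 * card A" and few: "5 * card (involutions :: 'g set) \<le> CARD('g)"
    and x: "x \<in> A"
  shows "x + x \<notin> A"
proof
  assume xx: "x + x \<in> A"
  let ?I = "involutions :: 'g set" and ?S = "{v \<in> A. v + v = x}" and ?R = "{v \<in> A. v + v = x + x}"
  let ?C = "{v. v + v = x + x}"
  define B C where "B = (\<lambda>a. a + x) ` A" and "C = (\<lambda>a. a + (x + x)) ` A"
  have card: "card B = card A" "card C = card A" by (simp_all add: B_def C_def card_image)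
  have memB: "v \<in> B \<longleftrightarrow> v - x \<in> A" and memC: "v \<in> C \<longleftrightarrow> v - (x + x) \<in> A" for v
    by (force simp: B_def C_def image_iff)+
  have xI: "x \<notin> ?I" "x \<noteq> 0" "x + x \<noteq> 0" using x xx A(1) by (auto simp: subset_iff)
  have zA: "0 \<notin> A" using A(1) by (auto simp: subset_iff)
  have shift: "v + v = p \<or> v = - p \<or> v = p + p" if "v \<in> A" "v - p \<in> A" "p \<in> A" for v p
  proof (rule ccontr)
    assume not: "\<not> ?thesis"
    have "opp.triple (v, - (v - p), - p)"
      unfolding opp_triple_iff
    proof (intro conjI)
      show "v \<notin> involutions" "- (v - p) \<notin> involutions" "- p \<notin> involutions"
        using A that by blast+
      show "v + - (v - p) + - p = 0" by simp
      show "v \<noteq> - (v - p)" using not by (metis add_diff_cancel_left' diff_add_cancel minus_diff_eq)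
      show "v \<noteq> - (- (v - p))" using zA that(3) by auto
      show "v \<noteq> - p" using not by simp
      show "v \<noteq> - (- p)" using that(2) zA by auto
      show "- (v - p) \<noteq> - p"
      proof
        assume "- (v - p) = - p"
        then have "v - p = p" by (simp only: neg_equal_iff_equal)
        then show False using not by (simp add: diff_eq_eq)
      qed
      show "- (v - p) \<noteq> - (- p)" using that(1) zA by auto
    qed
    then show False using none that A(2) by blast
  qed
  have AB: "card (A \<inter> B) \<le> card ?S + 2"
  proof -
    have "A \<inter> B \<subseteq> ?S \<union> {- x, x + x}" using shift[of _ x] x memB by blast
    then have "card (A \<inter> B) \<le> card (?S \<union> {- x, x + x})" by (intro card_mono) auto
    also have "\<dots> \<le> card ?S + card {- x, x + x}" by (rule card_Un_le)
    also have "\<dots> \<le> card ?S + 2" by (simp add: card_insert_if)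
    finally show ?thesis .
  qed
  have AC: "card (A \<inter> C) \<le> card ?R + 2"
  proof -
    have "A \<inter> C \<subseteq> ?R \<union> {- (x + x), x + x + (x + x)}" using shift[of _ "x + x"] xx memC by blast
    then have "card (A \<inter> C) \<le> card (?R \<union> {- (x + x), x + x + (x + x)})" by (intro card_mono) auto
    also have "\<dots> \<le> card ?R + card {- (x + x), x + x + (x + x)}" by (rule card_Un_le)
    also have "\<dots> \<le> card ?R + 2" by (simp add: card_insert_if)
    finally show ?thesis .
  qed
  have BC: "card (B \<inter> C) = card (A \<inter> B)"
  proof -
    have "B \<inter> C = (\<lambda>a. a + x) ` (A \<inter> B)"
    proof (intro set_eqI iffI)
      fix v assume "v \<in> B \<inter> C"
      then have "v - x \<in> A \<inter> B" by (simp add: memB memC algebra_simps)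
      then show "v \<in> (\<lambda>a. a + x) ` (A \<inter> B)" by (intro image_eqI[of _ _ "v - x"]) simp_all
    qed (auto simp: memB memC algebra_simps)
    then show ?thesis by (simp add: card_image)
  qed
  have cC: "card ?C = card ?I"
  proof -
    have "?C = (+) x ` ?I"
    proof (intro set_eqI iffI)
      fix v assume "v \<in> ?C"
      then have "v - x \<in> ?I" using double_eq_iff[of v x] by simp
      then show "v \<in> (+) x ` ?I" by (intro image_eqI[of _ _ "v - x"]) simp_all
    next
      fix v assume "v \<in> (+) x ` ?I"
      then show "v \<in> ?C" using double_eq_iff[of v x] by auto
    qed
    then show ?thesis by (simp add: card_image)
  qed
  have "A \<union> B \<union> C \<subseteq> - (?C - ?R)"
  proof
    fix v assume v: "v \<in> A \<union> B \<union> C"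
    show "v \<in> - (?C - ?R)"
    proof
      assume vC: "v \<in> ?C - ?R"
      then have "v \<notin> A" by blast
      moreover have "v - x \<notin> A" using vC double_eq_iff[of v x] A(1) by auto
      moreover have "v - (x + x) = - v" using vC by (simp add: algebra_simps)
      ultimately show False using v memB memC A(2)[of "- v"] by auto
    qed
  qed
  then have "card (A \<union> B \<union> C) \<le> card (- (?C - ?R))" by (intro card_mono) auto
  also have "\<dots> = CARD('g) - (card ?I - card ?R)"
    using cC by (simp add: Compl_eq_Diff_UNIV card_Diff_subset subset_iff)
  finally have U: "card (A \<union> B \<union> C) \<le> CARD('g) - (card ?I - card ?R)" .
  have "card A + card B + card C \<le> card (A \<union> B \<union> C) + card (A \<inter> B) + card (B \<inter> C) + card (A \<inter> C)"
  proof -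
    have "card A + card B = card (A \<union> B) + card (A \<inter> B)" by (rule card_Un_Int) auto
    moreover have "card (A \<union> B) + card C = card (A \<union> B \<union> C) + card ((A \<union> B) \<inter> C)"
      by (rule card_Un_Int) auto
    moreover have "card ((A \<union> B) \<inter> C) \<le> card (A \<inter> C) + card (B \<inter> C)"
      by (metis Int_Un_distrib2 card_Un_le)
    ultimately show ?thesis by linarith
  qed
  moreover have "card ?R \<le> card ?I"
  proof -
    have "?R \<subseteq> ?C" by blast
    then have "card ?R \<le> card ?C" by (rule card_mono[OF finite])
    then show ?thesis unfolding cC .
  qed
  moreover have "card ?I \<le> CARD('g)" by (rule card_mono) auto
  ultimately have "3 * card A + card ?I \<le> CARD('g) + card ?R + (2 * card ?S + 4) + (card ?R + 2)"
    using U AB AC BC card by linarith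
  moreover have "card ?S + card ?R \<le> card ?I + 2" by (rule card_halves_add_le[OF A none x xx])
  ultimately have "3 * card A \<le> CARD('g) + card ?I + 10" by linarith
  then show False using dense few by linarith
qed

lemma opposite_triples_extend_large_index:
  fixes D :: "('g::{finite, ab_group_add} \<times> 'g \<times> 'g) set"
  assumes few: "5 * card (involutions :: 'g set) \<le> CARD('g)"
    and D: "opp.family D" "2 * CARD('g) + 23 \<le> 5 * card (- involutions - opp.used D)"
  shows "\<exists>D' :: ('g \<times> 'g \<times> 'g) set. opp.family D' \<and> card D' = Suc (card D)"
proof (rule opp.family_extend[where e = "card (involutions :: 'g set)", OF D])
  show "5 * card (- (- involutions) :: 'g set) \<le> CARD('g)" using few by simp
  show "10 * (card (involutions :: 'g set) + 4 * 2) < 3 * CARD('g) + 92" using few by simp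
next
  fix A :: "'g set" and x y z
  assume A: "A \<subseteq> - involutions" and closed: "\<And>x. x \<in> A \<Longrightarrow> {x, - x} \<subseteq> A"
    and dense: "2 * CARD('g) + 23 \<le> 5 * card A"
    and none: "\<And>x y z. x \<in> A \<Longrightarrow> y \<in> A \<Longrightarrow> z \<in> A \<Longrightarrow> \<not> opp.triple (x, y, z)"
    and xyz: "x \<in> A" "y \<in> A" "z \<in> A"
  have neg: "- a \<in> A" if "a \<in> A" for a using closed[OF that] by simp
  have no: "a + a \<notin> A" if "a \<in> A" for a
    by (rule double_notin_dense[OF A neg none dense few that])
  have ne: "p \<noteq> q \<and> p \<noteq> - q" if "p + q + r = 0" "p \<in> A" "q \<in> A" "r \<in> A" for p q r
  proof
    show "p \<noteq> q"
    proof
      assume "p = q"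
      then have "p + p = - r" using that(1) by (metis minus_unique minus_equation_iff)
      then show False using no[OF that(2)] neg[OF that(4)] by simp
    qed
    show "p \<noteq> - q" using that A by (auto simp: subset_iff)
  qed
  show "x + y + z \<noteq> 0"
  proof
    assume 0: "x + y + z = 0"
    then have "x + z + y = 0" "y + z + x = 0" by (simp_all add: ac_simps)
    then have "opp.triple (x, y, z)"
      unfolding opp_triple_iff using 0 ne[of x y z] ne[of x z y] ne[of y z x] xyz A by auto
    then show False using none xyz by blast
  qed
next
  fix x :: 'g assume x: "x \<in> - involutions"
  have "{a \<in> - involutions. - x - a \<in> {a, - a}} \<subseteq> {a. a + a = - x}"
  proof
    fix a assume a: "a \<in> {a \<in> - involutions. - x - a \<in> {a, - a}}"
    have "- x - a \<noteq> - a" using x by auto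
    then have "- x - a = a" using a by auto
    then show "a \<in> {a. a + a = - x}" by (simp add: diff_eq_eq)
  qed
  then have "card {a \<in> - involutions. - x - a \<in> {a, - a}} \<le> card {a. a + a = - x}"
    by (intro card_mono) auto
  then show "card {a \<in> - involutions. - x - a \<in> {a, - a}} \<le> card (involutions :: 'g set)"
    using card_halves_le[of "- x"] by linarith
qed

lemma opposite_triples_insert:
  fixes D :: "('g::{finite, ab_group_add} \<times> 'g \<times> 'g) set"
  assumes D: "opp.family D" and t: "opp.triple (x, y, z)"
    and free: "x \<notin> opp.used D" "y \<notin> opp.used D" "z \<notin> opp.used D"
  shows "opp.family (insert (x, y, z) D)" "card (insert (x, y, z) D) = Suc (card D)"
proof -
  have "{v, - v} \<inter> opp.used D = {}" if "v \<notin> involutions" "v \<notin> opp.used D" for v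
    using opp.unused_closed[OF D, of v] that by blast
  then have "opp.block (x, y, z) \<inter> opp.used D = {}"
    using t free unfolding opp_triple_iff opp.block_def by auto
  then show "opp.family (insert (x, y, z) D)" "card (insert (x, y, z) D) = Suc (card D)"
    using opp.family_insert[OF D t] by blast+
qed

lemma meets_image_of_dense:
  assumes "B \<subseteq> X" "f ` B \<subseteq> X" "inj_on f B" "card X < 2 * card B" "finite X"
  shows "\<exists>x\<in>B. f x \<in> B"
proof (rule ccontr)
  assume "\<not> ?thesis"
  then have "B \<inter> f ` B = {}" by blast
  moreover have "finite B" using assms(1,5) by (rule finite_subset)
  ultimately have "card (B \<union> f ` B) = card B + card B"
    using assms(3) by (simp add: card_Un_disjoint card_image)
  moreover have "card (B \<union> f ` B) \<le> card X" using assms by (intro card_mono) auto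
  ultimately show False using assms(4) by simp
qed

text \<open>
  The unused elements are \<open>u + s\<close> and \<open>-(u + s)\<close> for \<open>s\<close> in a set \<open>S\<close> that contains more than half of
  the subgroup of involutions. Hence \<open>S\<close> contains \<open>s\<close>, \<open>b\<close> and \<open>s + b\<close>, all different, and
  the corresponding elements add up to \<open>u + u + u = 0\<close>.
\<close>

lemma opposite_triples_extend_index_three:
  fixes D :: "('g::{finite, ab_group_add} \<times> 'g \<times> 'g) set" and u :: 'g
  assumes u: "u \<notin> involutions" "u + u + u = 0" and index: "CARD('g) = 3 * card (involutions :: 'g set)"
    and D: "opp.family D" "card (involutions :: 'g set) + 3 \<le> card (- involutions - opp.used D)"
  shows "\<exists>D' :: ('g \<times> 'g \<times> 'g) set. opp.family D' \<and> card D' = Suc (card D)"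
proof -
  let ?I = "involutions :: 'g set"
  define A where "A = - ?I - opp.used D"
  have neg: "- v \<in> A" if "v \<in> A" for v
    using opp.unused_closed[OF D(1), of v] that by (auto simp: A_def)
  have uu: "u + u = - u" using u(2) by (metis minus_unique minus_equation_iff)
  have cosets: "v - u \<in> ?I \<or> v + u \<in> ?I \<or> v \<in> ?I" for v
  proof -
    let ?P = "(+) u ` ?I" and ?M = "(+) (- u) ` ?I"
    have "?I \<inter> ?P = {}"
    proof (rule ccontr)
      assume "?I \<inter> ?P \<noteq> {}"
      then obtain w where "w \<in> ?I" "u + w \<in> ?I" by blast
      then show False using diff_involutions[of "u + w" w] u(1) by simp
    qed
    moreover have "?I \<inter> ?M = {}"
    proof (rule ccontr)
      assume "?I \<inter> ?M \<noteq> {}"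
      then obtain w where "w \<in> ?I" "- u + w \<in> ?I" by blast
      then show False using diff_involutions[of w "- u + w"] u(1) by simp
    qed
    moreover have "?P \<inter> ?M = {}"
    proof (rule ccontr)
      assume "?P \<inter> ?M \<noteq> {}"
      then obtain w w' where w: "w \<in> ?I" "w' \<in> ?I" "u + w = - u + w'" by blast
      then have "w' - w = u + u" by (simp add: algebra_simps)
      then have "- (w' - w) = u" using uu by simp
      then show False using diff_involutions[OF w(2,1)] uminus_involution u(1) by metis
    qed
    ultimately have "card (?I \<union> ?P \<union> ?M) = 3 * card ?I"
      by (simp add: card_Un_disjoint Int_Un_distrib2 card_image)
    then have "?I \<union> ?P \<union> ?M = UNIV" using index by (intro card_subset_eq) auto
    then have "v \<in> ?I \<union> ?P \<union> ?M" by simp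
    then show ?thesis by auto
  qed
  define S where "S = {w \<in> ?I. u + w \<in> A}"
  have "A \<subseteq> (+) u ` S \<union> (\<lambda>w. - (u + w)) ` S"
  proof
    fix v assume v: "v \<in> A"
    then have "v \<notin> ?I" by (simp add: A_def)
    then consider "v - u \<in> ?I" | "v + u \<in> ?I" using cosets by blast
    then show "v \<in> (+) u ` S \<union> (\<lambda>w. - (u + w)) ` S"
    proof cases
      case 1
      then have "v - u \<in> S" using v by (simp add: S_def)
      then show ?thesis by (intro UnI1 image_eqI[of _ _ "v - u"]) simp_all
    next
      case 2
      have "u + (- (v + u)) = - v" by simp
      then have "- (v + u) \<in> S" using neg[OF v] diff_involutions[of 0 "v + u"] 2 by (simp add: S_def)
      then show ?thesis by (intro UnI2 image_eqI[of _ _ "- (v + u)"]) simp_all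
    qed
  qed
  then have "card A \<le> card ((+) u ` S \<union> (\<lambda>w. - (u + w)) ` S)" by (intro card_mono) auto
  also have "\<dots> \<le> card ((+) u ` S) + card ((\<lambda>w. - (u + w)) ` S)" by (rule card_Un_le)
  also have "\<dots> = 2 * card S" by (simp add: card_image inj_on_def)
  finally have S: "card ?I + 3 \<le> 2 * card S" using D(2) by (simp add: A_def)
  obtain s where s: "s \<in> S" "s \<noteq> 0" using exists_outside[of "{0}" S] S by auto
  then have sI: "s \<in> ?I" "s + s = 0" by (simp_all add: S_def mem_involutions)
  have SI: "S \<subseteq> ?I" by (auto simp: S_def)
  have "\<exists>b\<in>S - {0, s}. s + b \<in> S - {0, s}"
  proof (rule meets_image_of_dense[of _ "?I - {0, s}"])
    show "(+) s ` (S - {0, s}) \<subseteq> ?I - {0, s}"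
    proof
      fix v assume "v \<in> (+) s ` (S - {0, s})"
      then obtain b where b: "b \<in> S" "b \<noteq> 0" "b \<noteq> s" "v = s + b" by blast
      have "s + b \<noteq> 0" using b(3) sI by (metis minus_unique)
      then show "v \<in> ?I - {0, s}" using b add_involutions sI SI by auto
    qed
    have "card (?I - {0, s}) = card ?I - 2" using s sI by (simp add: card_Diff_subset)
    moreover have "card S - 2 \<le> card (S - {0, s})"
      using diff_card_le_card_Diff[of "{0, s}" S] s by simp
    moreover have "2 \<le> card ?I" using card_mono[of ?I "{0, s}"] s sI by simp
    ultimately show "card (?I - {0, s}) < 2 * card (S - {0, s})" using S by linarith
  qed (use SI in \<open>auto simp: inj_on_def\<close>)
  then obtain b where b: "b \<in> S" "b \<noteq> 0" "b \<noteq> s" "s + b \<in> S" by blast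
  then have bI: "b \<in> ?I" "b + b = 0" by (simp_all add: S_def mem_involutions)
  have opposite: "u + p \<noteq> - (u + q)" if "p \<in> ?I" "q \<in> ?I" for p q
  proof
    assume "u + p = - (u + q)"
    then have "(u + p) + (u + q) = 0" by (metis left_minus)
    then have "(u + u) + (p + q) = 0" by (simp add: ac_simps)
    then have "p + q = u" unfolding uu by (simp add: eq_neg_iff_add_eq_0[symmetric])
    then show False using add_involutions[OF that] u(1) by simp
  qed
  have "(u + s) + (u + b) + (u + (s + b)) = (u + u + u) + (s + s) + (b + b)" by (simp add: ac_simps)
  then have "(u + s) + (u + b) + (u + (s + b)) = 0" using u(2) sI bI by simp
  moreover have "u + s \<in> A" "u + b \<in> A" "u + (s + b) \<in> A" using s b by (simp_all add: S_def)
  moreover have "s \<noteq> s + b" "b \<noteq> s + b" using s b by simp_all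
  ultimately have "opp.triple (u + s, u + b, u + (s + b))"
    unfolding opp_triple_iff using opposite sI bI add_involutions[OF sI(1) bI(1)] b(3)
    by (auto simp: A_def)
  then show ?thesis
    using opposite_triples_insert[OF D(1)] \<open>u + s \<in> A\<close> \<open>u + b \<in> A\<close> \<open>u + (s + b) \<in> A\<close>
    unfolding A_def by blast
qed

text \<open>
  In index 4 with cyclic quotient, the set of unused elements can be dense and outside the index-2
  subgroup up to a few degenerate elements. Keeping track of the cosets of the chosen triples
  makes a direct count possible.
\<close>

definition balanced :: "'g::ab_group_add \<Rightarrow> ('g \<times> 'g \<times> 'g) set \<Rightarrow> bool" where
  "balanced u D \<longleftrightarrow> (\<forall>(x, y, z)\<in>D. x - u \<in> involutions \<and> y - u \<in> involutions \<and> z - (u + u) \<in> involutions)"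

lemma coset_of_involutions:
  "{x :: 'g::{finite, ab_group_add}. x - u \<in> involutions} = (+) u ` involutions"
  "card {x :: 'g. x - u \<in> involutions} = card (involutions :: 'g set)"
proof -
  show *: "{x :: 'g. x - u \<in> involutions} = (+) u ` involutions"
  proof (intro set_eqI iffI)
    fix x assume "x \<in> {x. x - u \<in> involutions}"
    then show "x \<in> (+) u ` involutions" by (intro image_eqI[of _ _ "x - u"]) simp_all
  qed auto
  show "card {x :: 'g. x - u \<in> involutions} = card (involutions :: 'g set)"
    unfolding * by (simp add: card_image)
qed

text \<open>
  Each chosen triple takes two elements of the coset of \<open>u\<close> and two of the coset of \<open>u + u\<close>. As long as more
  than half of the first coset is unused, the involution \<open>x \<mapsto> - z - x\<close> of this coset maps some unused element to
  an unused one. The choice of \<open>z\<close> excludes a fixed point.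
\<close>

lemma opposite_triples_extend_balanced:
  fixes D :: "('g::{finite, ab_group_add} \<times> 'g \<times> 'g) set" and u :: 'g
  assumes u: "u \<notin> involutions" "u + u \<notin> involutions" "u + u + u \<notin> involutions"
      "u + u + (u + u) \<in> involutions"
    and D: "opp.family D" "balanced u D"
    and room: "4 * card D < card (involutions :: 'g set)" "2 + 2 * card D \<le> card (involutions :: 'g set)"
  shows "\<exists>D' :: ('g \<times> 'g \<times> 'g) set. opp.family D' \<and> balanced u D' \<and> card D' = Suc (card D)"
proof -
  let ?I = "involutions :: 'g set" and ?X = "{x. x - u \<in> involutions}" and ?Z = "{z. z - (u + u) \<in> involutions}"
  have neg: "- v \<in> ?I \<longleftrightarrow> v \<in> ?I" for v
    using uminus_involution[of v] uminus_involution[of "- v"] by auto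
  have incompatible:
    "\<not> (- v - u \<in> ?I \<and> v - u \<in> ?I)" "\<not> (v - u \<in> ?I \<and> v - (u + u) \<in> ?I)"
    "\<not> (- v - u \<in> ?I \<and> v - (u + u) \<in> ?I)" "\<not> (v - u \<in> ?I \<and> - v - (u + u) \<in> ?I)" for v
  proof -
    have "(- v - u) + (v - u) = - (u + u)" "(v - u) - (v - (u + u)) = u"
      "(- v - u) + (v - (u + u)) = - (u + u + u)" "(v - u) + (- v - (u + u)) = - (u + u + u)"
      by (simp_all add: algebra_simps)
    then show "\<not> (- v - u \<in> ?I \<and> v - u \<in> ?I)" "\<not> (v - u \<in> ?I \<and> v - (u + u) \<in> ?I)"
      "\<not> (- v - u \<in> ?I \<and> v - (u + u) \<in> ?I)" "\<not> (v - u \<in> ?I \<and> - v - (u + u) \<in> ?I)"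
      using add_involutions diff_involutions neg u(1-3) by metis+
  qed
  define px py pz where "px = fst ` D" and "py = (fst \<circ> snd) ` D" and "pz = (snd \<circ> snd) ` D"
  have card_p: "card px \<le> card D" "card py \<le> card D" "card pz \<le> card D"
    by (simp_all add: px_def py_def pz_def card_image_le)
  have usedE: "\<exists>p q r. (p, q, r) \<in> D \<and> v \<in> {p, - p, q, - q, r, - r}" if "v \<in> opp.used D" for v
    using that by (auto simp: opp.used_def opp.block_def)
  have X: "?X \<inter> opp.used D \<subseteq> px \<union> py"
  proof
    fix v assume v: "v \<in> ?X \<inter> opp.used D"
    then obtain p q r where d: "(p, q, r) \<in> D" "v \<in> {p, - p, q, - q, r, - r}" using usedE by blast
    then have "p - u \<in> ?I" "q - u \<in> ?I" "r - (u + u) \<in> ?I" using D(2) by (auto simp: balanced_def)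
    then have "v = p \<or> v = q" using v d(2) incompatible by blast
    moreover have "p \<in> px" "q \<in> py" using d(1) by (force simp: px_def py_def)+
    ultimately show "v \<in> px \<union> py" by blast
  qed
  have Z: "?Z \<inter> opp.used D \<subseteq> pz \<union> uminus ` pz"
  proof
    fix v assume v: "v \<in> ?Z \<inter> opp.used D"
    then obtain p q r where d: "(p, q, r) \<in> D" "v \<in> {p, - p, q, - q, r, - r}" using usedE by blast
    then have "p - u \<in> ?I" "q - u \<in> ?I" "r - (u + u) \<in> ?I" using D(2) by (auto simp: balanced_def)
    then have "v = r \<or> v = - r" using v d(2) incompatible by blast
    moreover have "r \<in> pz" using d(1) by (force simp: pz_def)
    ultimately show "v \<in> pz \<union> uminus ` pz" by blast
  qed
  have free: "card ?I - 2 * card D \<le> card (W - opp.used D)"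
    if "card W = card ?I" "W \<inter> opp.used D \<subseteq> P \<union> Q" "card P \<le> card D" "card Q \<le> card D" for W P Q
  proof -
    have "card (W \<inter> opp.used D) \<le> card (P \<union> Q)" using that(2) by (intro card_mono) auto
    also have "\<dots> \<le> 2 * card D" using card_Un_le[of P Q] that(3,4) by linarith
    finally have "card (W \<inter> opp.used D) \<le> 2 * card D" .
    moreover have "card (W - opp.used D) = card W - card (W \<inter> opp.used D)"
      by (simp add: card_Diff_subset_Int)
    ultimately show ?thesis using that(1) by simp
  qed
  have BX: "card ?I - 2 * card D \<le> card (?X - opp.used D)"
    by (rule free[OF coset_of_involutions(2) X card_p(1,2)])
  have BZ: "card ?I - 2 * card D \<le> card (?Z - opp.used D)"
    by (rule free[OF coset_of_involutions(2) Z card_p(3)]) (use card_p(3) in \<open>simp add: card_image\<close>)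
  have "\<exists>z. z \<in> ?Z - opp.used D \<and> z \<notin> {- (u + u)}"
    by (rule exists_outside) (use BZ room(2) in auto)
  then obtain z where z: "z - (u + u) \<in> ?I" "z \<notin> opp.used D" "z \<noteq> - (u + u)" by blast
  have stable: "- z - x - u \<in> ?I" if "x - u \<in> ?I" for x
  proof -
    have "- z - x - u = - ((z - (u + u)) + (x - u) + (u + u + (u + u)))" by (simp add: algebra_simps)
    then show ?thesis using add_involutions z(1) that u(4) neg by metis
  qed
  have "\<exists>x\<in>?X - opp.used D. - z - x \<in> ?X - opp.used D"
  proof (rule meets_image_of_dense)
    show "(\<lambda>x. - z - x) ` (?X - opp.used D) \<subseteq> ?X" using stable by auto
    show "card ?X < 2 * card (?X - opp.used D)"
      using BX room unfolding coset_of_involutions(2) by linarith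
  qed (auto simp: inj_on_def)
  then obtain x where x: "x - u \<in> ?I" "x \<notin> opp.used D" "- z - x - u \<in> ?I" "- z - x \<notin> opp.used D"
    by blast
  have notI: "v \<notin> ?I" if "v - u \<in> ?I \<or> v - (u + u) \<in> ?I" for v
    using that diff_involutions[of v "v - u"] diff_involutions[of v "v - (u + u)"] u(1,2) by auto
  have apart: "p \<noteq> z \<and> p \<noteq> - z" if "p - u \<in> ?I" for p
    using incompatible(2,3)[of z] z(1) that by auto
  have "x \<noteq> - z - x"
  proof
    assume "x = - z - x"
    then have "x + x = - z" by (metis add_diff_cancel_left' diff_add_cancel)
    moreover have "x + x = u + u" using double_eq_iff x(1) by blast
    ultimately show False using z(3) by (metis minus_equation_iff)
  qed
  moreover have "x \<noteq> - (- z - x)" using notI[of z] z(1) by auto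
  moreover note apart[OF x(1)] apart[OF x(3)]
  moreover have "x \<notin> ?I" "- z - x \<notin> ?I" "z \<notin> ?I" using notI x(1,3) z(1) by blast+
  ultimately have "opp.triple (x, - z - x, z)"
    unfolding opp_triple_iff by simp
  then have "opp.family (insert (x, - z - x, z) D)" "card (insert (x, - z - x, z) D) = Suc (card D)"
    using opposite_triples_insert[OF D(1)] x z by blast+
  moreover have "balanced u (insert (x, - z - x, z) D)" using D(2) x z by (simp add: balanced_def)
  ultimately show ?thesis by blast
qed

section \<open>The index of the subgroup of involutions\<close>

text \<open>
  Doubling is a homomorphism with kernel \<open>involutions\<close>.
\<close>

lemma card_involutions_index:
  "CARD('g::{finite, ab_group_add}) = card (involutions :: 'g set) * card (range (\<lambda>x::'g. x + x))"
proof -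
  let ?T = "range (\<lambda>x::'g. x + x)"
  have fibre: "card {v. v + v = y} = card (involutions :: 'g set)" if y: "y \<in> ?T" for y
  proof -
    obtain x where "y = x + x" using y by blast
    then have "{v. v + v = y} = {v. v - x \<in> involutions}" using double_eq_iff by blast
    then show ?thesis using coset_of_involutions(2) by simp
  qed
  have "(UNIV :: 'g set) = (\<Union>y\<in>?T. {v. v + v = y})" by auto
  then have "CARD('g) = card (\<Union>y\<in>?T. {v. v + v = y})" by (rule arg_cong)
  also have "\<dots> = (\<Sum>y\<in>?T. card {v. v + v = y})" by (rule card_UN_disjoint) auto
  also have "\<dots> = (\<Sum>y\<in>?T. card (involutions :: 'g set))" by (rule sum.cong) (simp_all add: fibre)
  finally show ?thesis by simp
qed

lemma squares_add: "x \<in> range (\<lambda>x::'g::ab_group_add. x + x) \<Longrightarrow> y \<in> range (\<lambda>x. x + x) \<Longrightarrow> x + y \<in> range (\<lambda>x. x + x)"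
proof -
  assume "x \<in> range (\<lambda>x. x + x)" "y \<in> range (\<lambda>x. x + x)"
  then obtain p q where "x = p + p" "y = q + q" by blast
  then have "x + y = (p + q) + (p + q)" by (simp add: ac_simps)
  then show ?thesis by blast
qed

lemma squares_uminus: "x \<in> range (\<lambda>x::'g::ab_group_add. x + x) \<Longrightarrow> - x \<in> range (\<lambda>x. x + x)"
proof -
  assume "x \<in> range (\<lambda>x. x + x)"
  then obtain p where "x = p + p" by blast
  then have "- x = - p + - p" by simp
  then show ?thesis by blast
qed

lemma square_klein_subgroup_if_squares:
  assumes "u \<in> involutions" "v \<in> involutions" "u \<noteq> 0" "v \<noteq> 0" "u \<noteq> v"
    and "range (\<lambda>x. x + x) \<subseteq> {0, u, v, u + v}"
  shows "square_klein_subgroup (u :: 'g::{finite, ab_group_add}) v"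
proof -
  interpret klein_subgroup u v using assms by unfold_locales (auto simp: mem_involutions)
  show ?thesis using assms(6) by unfold_locales (auto simp: K_def)
qed

text \<open>
  With index at most 2 there is at most one nonzero double, and it is an involution. As the order of
  the group exceeds 4, there are involutions enough for a Klein four-subgroup that contains it.
\<close>

lemma index_at_least_three:
  assumes no: "\<not> (\<exists>a b :: 'g::{finite, ab_group_add}. square_klein_subgroup a b)" and "4 < CARD('g)"
  shows "3 \<le> card (range (\<lambda>x::'g. x + x))"
proof (rule ccontr)
  let ?T = "range (\<lambda>x::'g. x + x)" and ?I = "involutions :: 'g set"
  assume "\<not> 3 \<le> card ?T"
  then have T: "card ?T \<le> 2" by simp
  have zero: "0 \<in> ?T" by (rule range_eqI[of _ _ 0]) simp
  have "card ?I * card ?T \<le> card ?I * 2" using T by (rule mult_le_mono2)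
  then have I: "2 < card ?I" using card_involutions_index[where 'g = 'g] assms(2) by linarith
  have pick: "\<exists>x. x \<in> ?I \<and> x \<notin> X" if "card X \<le> 2" for X
    using exists_outside[of X ?I] that I by simp
  obtain k where k: "?T \<subseteq> {0, k}" "k \<in> ?T"
  proof (cases "?T \<subseteq> {0}")
    case True
    then show thesis using that[of 0] zero by simp
  next
    case False
    then obtain k where k: "k \<in> ?T" "k \<noteq> 0" by blast
    have "{0, k} = ?T"
    proof (rule card_seteq)
      show "{0, k} \<subseteq> ?T" using zero k(1) by simp
      show "card ?T \<le> card {0, k}" using T k(2) by simp
    qed simp
    then show thesis using that[of k] k by blast
  qed
  have "k + k = 0"
  proof -
    have "k + k \<in> {0, k}" using k(1) by blast
    then show ?thesis using k by auto
  qed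
  then have kI: "k \<in> ?I" by (simp add: mem_involutions)
  obtain u where u: "u \<in> ?I" "u \<noteq> 0" "k \<in> {0, u}"
  proof (cases "k = 0")
    case True
    then show thesis using that pick[of "{0}"] by auto
  next
    case False
    then show thesis using that[of k] kI by simp
  qed
  have "card {0, u} \<le> 2" by (simp add: card_insert_if)
  then obtain v where v: "v \<in> ?I" "v \<notin> {0, u}" using pick by blast
  have "square_klein_subgroup u v"
    by (rule square_klein_subgroup_if_squares) (use u v k in auto)
  then show False using no by blast
qed

lemma index_three_generator:
  assumes "card (range (\<lambda>x::'g::{finite, ab_group_add}. x + x)) = 3"
  shows "\<exists>u :: 'g. u \<notin> involutions \<and> u + u + u = 0"
proof -
  let ?T = "range (\<lambda>x::'g. x + x)"
  have zero: "0 \<in> ?T" by (rule range_eqI[of _ _ 0]) simp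
  have full: "?T = X" if "X \<subseteq> ?T" "card X = 3" for X
    using that assms card_subset_eq[of ?T X] by simp
  obtain t where t: "t \<in> ?T" "t \<noteq> 0" using exists_outside[of "{0}" ?T] assms by auto
  have "t + t \<noteq> 0"
  proof
    assume tt: "t + t = 0"
    have "card {0, t} \<le> 2" by (simp add: card_insert_if)
    then obtain s where s: "s \<in> ?T" "s \<noteq> 0" "s \<noteq> t"
      using exists_outside[of "{0, t}" ?T] assms by auto
    have "{0, t, s} \<subseteq> ?T" "card {0, t, s} = 3" using zero s t by auto
    then have "?T = {0, t, s}" by (rule full)
    then have "t + s \<in> {0, t, s}" using squares_add[OF t(1) s(1)] by metis
    then have "t + s = 0" using s t by simp
    then have "t + s = t + t" using tt by simp
    then show False using s by simp
  qed
  then have tn: "t \<noteq> - t" by (metis right_minus)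
  have "{0, t, - t} \<subseteq> ?T" "card {0, t, - t} = 3" using zero t squares_uminus[OF t(1)] tn by auto
  then have "?T = {0, t, - t}" by (rule full)
  then have "t + t \<in> {0, t, - t}" using squares_add[OF t(1) t(1)] by metis
  then have "t + t = - t" using \<open>t + t \<noteq> 0\<close> t by simp
  then have "t + t + t = 0" by simp
  moreover have "t \<notin> involutions" using \<open>t + t \<noteq> 0\<close> by (simp add: mem_involutions)
  ultimately show ?thesis by blast
qed

text \<open>
  The subgroup of doubles has order 4. If it consisted of involutions, it would be a Klein
  four-subgroup that contains all doubles; so it is cyclic.
\<close>

lemma index_four_generator:
  assumes no: "\<not> (\<exists>a b :: 'g::{finite, ab_group_add}. square_klein_subgroup a b)"
    and four: "card (range (\<lambda>x::'g. x + x)) = 4"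
  shows "\<exists>u :: 'g. u \<notin> involutions \<and> u + u \<notin> involutions \<and> u + u + u \<notin> involutions \<and>
      u + u + (u + u) \<in> involutions"
proof -
  let ?T = "range (\<lambda>x::'g. x + x)" and ?I = "involutions :: 'g set"
  have zero: "0 \<in> ?T" by (rule range_eqI[of _ _ 0]) simp
  have full: "?T = X" if "X \<subseteq> ?T" "card X = 4" for X
    using that four card_subset_eq[of ?T X] by simp
  have pick: "\<exists>x. x \<in> ?T \<and> x \<notin> X" if "card X \<le> 3" for X
    using exists_outside[of X ?T] that four by simp
  have "\<not> ?T \<subseteq> ?I"
  proof
    assume TI: "?T \<subseteq> ?I"
    obtain u where u: "u \<in> ?T" "u \<noteq> 0" using pick[of "{0}"] by auto
    have "card {0, u} \<le> 3" by (simp add: card_insert_if)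
    then obtain v where v: "v \<in> ?T" "v \<notin> {0, u}" using pick by blast
    interpret klein_subgroup u v using TI u v by unfold_locales (auto simp: mem_involutions)
    have "K \<subseteq> ?T" using zero u(1) v(1) squares_add[OF u(1) v(1)] by (simp add: K_def)
    then have "?T = K" using card_K by (rule full)
    then have "square_klein_subgroup u v"
      by (intro square_klein_subgroup_if_squares) (use TI u v in \<open>auto simp: K_def\<close>)
    then show False using no by blast
  qed
  then obtain t where tT: "t \<in> ?T" and tI: "t \<notin> ?I" by blast
  then obtain u where u: "t = u + u" by blast
  have tt: "t + t \<noteq> 0" "t \<noteq> 0" using tI by (auto simp: mem_involutions)
  have ttT: "t + t \<in> ?T" "t + t + t \<in> ?T" "t + t + t + t \<in> ?T" using squares_add tT by blast+
  have ttt: "t + t + t \<noteq> 0"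
  proof
    assume 3: "t + t + t = 0"
    have "card {0, t, t + t} \<le> 3" by (simp add: card_insert_if)
    then obtain s where s: "s \<in> ?T" "s \<notin> {0, t, t + t}" using pick by blast
    have "{0, t, t + t, s} \<subseteq> ?T" "card {0, t, t + t, s} = 4" using zero s tT tt ttT by auto
    then have "?T = {0, t, t + t, s}" by (rule full)
    then have "s + t \<in> {0, t, t + t, s}" using squares_add[OF s(1) tT] by metis
    then have "s + t = 0" using s tt by auto
    then have "s + t = (t + t) + t" using 3 by simp
    then show False using s by simp
  qed
  have "{0, t, t + t, t + t + t} \<subseteq> ?T" "card {0, t, t + t, t + t + t} = 4"
    using zero tT tt ttT ttt by (auto simp: add.assoc)
  then have T: "?T = {0, t, t + t, t + t + t}" by (rule full)
  have "t + t + t + t \<in> {0, t, t + t, t + t + t}" using ttT(3) T by blast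
  then have tttt: "t + t + t + t = 0" using tt ttt by (auto simp: add.assoc)
  have "u + u \<notin> ?I" using tI u by simp
  moreover have "u \<notin> ?I" using tt(2) u by (simp add: mem_involutions)
  moreover have "u + u + u \<notin> ?I"
  proof -
    have "(u + u + u) + (u + u + u) = t + t + t" unfolding u by (simp add: ac_simps)
    then show ?thesis using ttt by (metis mem_involutions)
  qed
  moreover have "u + u + (u + u) \<in> ?I" using tttt u by (simp add: mem_involutions ac_simps)
  ultimately show ?thesis by blast
qed

text \<open>
  The general argument needs index at least 5; the indices 3 and 4 are counted directly. The
  second alternative in the hypothesis is the weaker requirement that suffices in index 3.
\<close>

lemma opposite_triples_exist:
  fixes k :: nat
  assumes no: "\<not> (\<exists>a b :: 'g::{finite, ab_group_add}. square_klein_subgroup a b)"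
    and index: "3 \<le> card (range (\<lambda>x::'g. x + x))"
    and room: "\<And>i. Suc i = k \<Longrightarrow>
      2 * CARD('g) + 23 \<le> 5 * (card (- involutions :: 'g set) - 6 * i) \<or>
      CARD('g) = 3 * card (involutions :: 'g set) \<and>
        card (involutions :: 'g set) + 3 \<le> card (- involutions :: 'g set) - 6 * i"
  shows "\<exists>D :: ('g \<times> 'g \<times> 'g) set. opp.family D \<and> card D = k"
proof -
  let ?I = "involutions :: 'g set"
  define q where "q = card (range (\<lambda>x::'g. x + x))"
  have q: "CARD('g) = card ?I * q" using card_involutions_index by (simp add: q_def)
  have cN: "card (- ?I) = CARD('g) - card ?I" by (simp add: Compl_eq_Diff_UNIV card_Diff_subset)
  have I: "1 \<le> card ?I" using card_mono[of ?I "{0}"] by simp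
  consider "q = 3" | "q = 4" | "5 \<le> q" using index unfolding q_def by linarith
  then show ?thesis
  proof cases
    case 1
    then obtain u :: 'g where u: "u \<notin> involutions" "u + u + u = 0"
      using index_three_generator unfolding q_def by blast
    have m: "CARD('g) = 3 * card ?I" using q 1 by simp
    have room': "card ?I + 3 \<le> card (- ?I) - 6 * i" if "Suc i = k" for i
      using room[OF that] m by auto
    have "\<exists>D :: ('g \<times> 'g \<times> 'g) set. opp.family D \<and> card D = j" if "j \<le> k" for j
      using that
    proof (induction j)
      case 0
      have "opp.family ({} :: ('g \<times> 'g \<times> 'g) set)" by (simp add: opp.family_def)
      then show ?case by (intro exI[of _ "{}"]) simp
    next
      case (Suc j)
      then obtain D :: "('g \<times> 'g \<times> 'g) set" where D: "opp.family D" "card D = j" by auto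
      obtain i where "Suc i = k" "j \<le> i" using Suc.prems by (cases k) auto
      then have "card ?I + 3 \<le> card (- ?I - opp.used D)"
        using room'[of i] opp.card_unused[OF D(1)] D(2) by simp
      then show ?case using opposite_triples_extend_index_three[OF u m D(1)] D(2) by simp
    qed
    then show ?thesis by simp
  next
    case 2
    then obtain u :: 'g where u: "u \<notin> involutions" "u + u \<notin> involutions" "u + u + u \<notin> involutions"
      "u + u + (u + u) \<in> involutions"
      using index_four_generator[OF no] unfolding q_def by blast
    have m: "CARD('g) = 4 * card ?I" using q 2 by simp
    have room': "30 * i + 23 \<le> 7 * card ?I" if "Suc i = k" for i
      using room[OF that] m I unfolding cN by auto
    have "\<exists>D :: ('g \<times> 'g \<times> 'g) set. opp.family D \<and> balanced u D \<and> card D = j" if "j \<le> k" for j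
      using that
    proof (induction j)
      case 0
      have "opp.family ({} :: ('g \<times> 'g \<times> 'g) set)" by (simp add: opp.family_def)
      then show ?case by (intro exI[of _ "{}"]) (simp add: balanced_def)
    next
      case (Suc j)
      then obtain D :: "('g \<times> 'g \<times> 'g) set" where D: "opp.family D" "balanced u D" "card D = j" by auto
      obtain i where "Suc i = k" "j \<le> i" using Suc.prems by (cases k) auto
      then have "4 * card D < card ?I" "2 + 2 * card D \<le> card ?I" using room'[of i] D(3) by linarith+
      then show ?case using opposite_triples_extend_balanced[OF u D(1,2)] D(3) by simp
    qed
    then show ?thesis by blast
  next
    case 3
    have few: "5 * card ?I \<le> CARD('g)" using q 3 mult_le_mono2[OF 3, of "card ?I"] by (simp add: mult.commute)
    show ?thesis
    proof (rule opp.family_exists)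
      fix D :: "('g \<times> 'g \<times> 'g) set"
      assume "opp.family D" "2 * CARD('g) + 23 \<le> 5 * card (- involutions - opp.used D)"
      then show "\<exists>D' :: ('g \<times> 'g \<times> 'g) set. opp.family D' \<and> card D' = Suc (card D)"
        by (rule opposite_triples_extend_large_index[OF few])
    next
      show "2 * CARD('g) + 23 \<le> 5 * (card (- ?I) - 3 * 2 * i)" if "Suc i = k" for i
        using room[OF that] few I by auto
    qed
  qed
qed

lemma symmetric_packable:
  fixes S :: "'g::{finite, ab_group_add} set"
  assumes "S \<subseteq> - involutions" "\<And>x. x \<in> S \<Longrightarrow> - x \<in> S"
  shows "packable S (replicate_mset (card S div 2) 2)"
  using assms
proof (induction "card S" arbitrary: S rule: less_induct)
  case less
  show ?case
  proof (cases "S = {}")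
    case True
    then show ?thesis by (simp add: packable_empty)
  next
    case False
    then obtain x where x: "x \<in> S" by blast
    then have "card {x, - x} = 2" using opp.card_cls[of x] less.prems(1) by blast
    moreover have "{x, - x} \<subseteq> S" using x less.prems(2) by blast
    ultimately have c: "card S = card (S - {x, - x}) + 2" 
      using card_Diff_subset[of "{x, - x}" S] card_mono[of S "{x, - x}"] by simp
    have "packable (S - {x, - x}) (replicate_mset (card (S - {x, - x}) div 2) 2)"
    proof (rule less.hyps)
      show "card (S - {x, - x}) < card S" using c by simp
      show "- y \<in> S - {x, - x}" if "y \<in> S - {x, - x}" for y
        using that less.prems(2)[of y] by auto
    qed (use less.prems(1) in blast)
    moreover have "\<Sum>{x, - x} = 0" using \<open>card {x, - x} = 2\<close> by (cases "x = - x") auto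
    ultimately have "packable S (add_mset (card {x, - x}) (replicate_mset (card (S - {x, - x}) div 2) 2))"
      using \<open>{x, - x} \<subseteq> S\<close> by (intro packable_add) auto
    then show ?thesis using c \<open>card {x, - x} = 2\<close> by simp
  qed
qed

lemma opposite_triples_packable:
  fixes D :: "('g::{finite, ab_group_add} \<times> 'g \<times> 'g) set"
  assumes D: "opp.family D"
  shows "packable (- involutions :: 'g set) (replicate_mset (2 * card D) 3
    + replicate_mset ((card (- involutions :: 'g set) - 6 * card D) div 2) 2)"
proof -
  have "packable (opp.used E) (replicate_mset (2 * card E) 3)" if "E \<subseteq> D" for E
  proof -
    have "finite E" by simp
    then show ?thesis using that
    proof (induction E rule: finite_induct)
      case empty
      show ?case by (simp add: packable_empty)
    next
      case (insert d E)
      obtain x y z where d: "d = (x, y, z)" by (cases d)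
      have t: "opp.triple (x, y, z)" using D insert.prems d by (auto simp: opp.family_def)
      then have ne: "x \<noteq> y" "x \<noteq> - y" "x \<noteq> z" "x \<noteq> - z" "y \<noteq> z" "y \<noteq> - z" and sum: "x + y + z = 0"
        and out: "x \<notin> involutions" "y \<notin> involutions" "z \<notin> involutions"
        unfolding opp_triple_iff by auto
      have opp: "p \<noteq> - p" if "p \<notin> involutions" for p :: 'g
        using that by (metis mem_involutions right_minus)
      have "packable (opp.block d) {#3, 3#}"
      proof (rule packable_two)
        show "{x, y, z} \<inter> {- x, - y, - z} = {}" using ne opp out by (auto simp: equation_minus_iff)
        show "\<Sum>{x, y, z} = 0" using ne sum by (simp add: add.assoc)
        have "\<Sum>{- x, - y, - z} = - (x + y + z)" using ne by (simp add: add.assoc)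
        then show "\<Sum>{- x, - y, - z} = 0" using sum by simp
        show "card {x, y, z} = 3" "card {- x, - y, - z} = 3" using ne by auto
        show "{x, y, z} \<union> {- x, - y, - z} = opp.block d" by (auto simp: d opp.block_def)
      qed auto
      moreover have "packable (opp.used E) (replicate_mset (2 * card E) 3)"
        using insert by blast
      moreover have "opp.block d \<inter> opp.used E = {}"
      proof -
        have "opp.block d \<inter> opp.block e = {}" if "e \<in> E" for e
        proof -
          have "d \<in> D" "e \<in> D" "d \<noteq> e" using insert.prems insert.hyps(2) that by auto
          then show ?thesis using D unfolding opp.family_def by blast
        qed
        then show ?thesis unfolding opp.used_def by blast
      qed
      ultimately have "packable (opp.block d \<union> opp.used E) ({#3, 3#} + replicate_mset (2 * card E) 3)"
        by (rule packable_union)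
      moreover have "opp.used (insert d E) = opp.block d \<union> opp.used E"
        by (simp add: opp.used_def)
      ultimately show ?case using insert.hyps by simp
    qed
  qed
  from this[of D] have "packable (opp.used D) (replicate_mset (2 * card D) 3)" by simp
  moreover have "packable (- involutions - opp.used D)
      (replicate_mset (card (- involutions - opp.used D) div 2) 2)"
  proof (rule symmetric_packable)
    show "- x \<in> - involutions - opp.used D" if "x \<in> - involutions - opp.used D" for x
      using opp.unused_closed[OF D that] by blast
  qed blast
  ultimately have "packable (opp.used D \<union> (- involutions - opp.used D))
    (replicate_mset (2 * card D) 3 + replicate_mset (card (- involutions - opp.used D) div 2) 2)"
    by (rule packable_union) blast
  moreover have "opp.used D \<union> (- involutions - opp.used D) = - involutions"
    using opp.used_subset[OF D] by blast
  ultimately show ?thesis using opp.card_unused[OF D] by simp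
qed

lemma lines_of_involutions_packable:
  fixes F :: "'g::{finite, ab_group_add} set set"
  assumes F: "line_packing involutions F"
  shows "packable (involutions - {0} :: 'g set) (replicate_mset (card F) 3)"
proof -
  have "packable (\<Union>E) (replicate_mset (card E) 3)" if "E \<subseteq> F" for E
  proof -
    have "finite E" by simp
    then show ?thesis using that
    proof (induction E rule: finite_induct)
      case empty
      show ?case by (simp add: packable_empty)
    next
      case (insert L E)
      then have L: "card L = 3" "\<Sum>L = 0" using F by (auto simp: line_packing_def)
      have "packable L {#3#}" using packable_single[of L] L by simp
      moreover have "packable (\<Union>E) (replicate_mset (card E) 3)" using insert by blast
      moreover have "L \<inter> M = {}" if "M \<in> E" for M
      proof -
        have "L \<in> F" "M \<in> F" "L \<noteq> M" using insert.prems insert.hyps(2) that by auto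
        then show ?thesis using F unfolding line_packing_def by blast
      qed
      then have "L \<inter> \<Union>E = {}" by blast
      ultimately have "packable (L \<union> \<Union>E) ({#3#} + replicate_mset (card E) 3)" by (rule packable_union)
      then show ?case using insert.hyps by simp
    qed
  qed
  then have "packable (\<Union>F) (replicate_mset (card F) 3)" by simp
  then show ?thesis by (rule packable_mono) (use F in \<open>auto simp: line_packing_def\<close>)
qed

section \<open>Packing all sizes\<close>

lemma merge_copies:
  "packable U (add_mset a (M + replicate_mset k b)) \<Longrightarrow> packable U (add_mset (a + k * b) M)"
proof (induction k arbitrary: a)
  case (Suc k)
  then have "packable U (add_mset a (add_mset b (M + replicate_mset k b)))"
    by (simp add: add_mset_commute)
  then have "packable U (add_mset (a + b) (M + replicate_mset k b))" by (rule packable_merge)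
  from Suc.IH[OF this] show ?case by (simp add: ac_simps)
qed simp

lemma merge_all:
  "packable U (M + replicate_mset s a + replicate_mset s b) \<Longrightarrow> packable U (M + replicate_mset s (a + b))"
proof (induction s arbitrary: M)
  case (Suc s)
  then have "packable U (add_mset a (add_mset b (M + replicate_mset s a + replicate_mset s b)))"
    by (simp add: add_mset_commute)
  then have "packable U (add_mset (a + b) (M + replicate_mset s a + replicate_mset s b))"
    by (rule packable_merge)
  with Suc.IH[of "add_mset (a + b) M"] show ?case by simp
qed simp

text \<open>
  An odd size takes a triple first.
\<close>

definition pairs_needed :: "nat \<Rightarrow> nat" where
  "pairs_needed n = (if odd n then (n - 3) div 2 else n div 2)"

lemma packable_of_triples_and_pairs_exact:
  "\<forall>n\<in>#L. 2 \<le> n \<Longrightarrow>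
   packable U (M + replicate_mset (size (filter_mset odd L)) 3 + replicate_mset (\<Sum>n\<in>#L. pairs_needed n) 2) \<Longrightarrow>
   packable U (M + L)"
proof (induction L arbitrary: M)
  case (add n L)
  let ?t = "size (filter_mset odd L)" and ?p = "\<Sum>n\<in>#L. pairs_needed n"
  have "packable U (add_mset n M + replicate_mset ?t 3 + replicate_mset ?p 2)"
  proof (cases "odd n")
    case True
    then have n: "n = 3 + pairs_needed n * 2" using add.prems(1) by (auto simp: pairs_needed_def elim!: oddE)
    have "packable U (M + replicate_mset (Suc ?t) 3 + replicate_mset (pairs_needed n + ?p) 2)"
      using add.prems(2) True by simp
    moreover have "M + replicate_mset (Suc ?t) 3 + replicate_mset (pairs_needed n + ?p) 2
        = add_mset 3 ((M + replicate_mset ?t 3 + replicate_mset ?p 2) + replicate_mset (pairs_needed n) 2)"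
      by (intro multiset_eqI) simp
    ultimately have "packable U (add_mset (3 + pairs_needed n * 2) (M + replicate_mset ?t 3 + replicate_mset ?p 2))"
      using merge_copies by metis
    then show ?thesis using n by simp
  next
    case False
    then have n: "n = 2 + (pairs_needed n - 1) * 2" "1 \<le> pairs_needed n"
      using add.prems(1) by (auto simp: pairs_needed_def elim!: evenE)
    have "packable U (M + replicate_mset ?t 3 + replicate_mset (pairs_needed n + ?p) 2)"
      using add.prems(2) False by simp
    moreover have "M + replicate_mset ?t 3 + replicate_mset (pairs_needed n + ?p) 2
        = add_mset 2 ((M + replicate_mset ?t 3 + replicate_mset ?p 2) + replicate_mset (pairs_needed n - 1) 2)"
      using n(2) by (intro multiset_eqI) simp
    ultimately have "packable U (add_mset (2 + (pairs_needed n - 1) * 2) (M + replicate_mset ?t 3 + replicate_mset ?p 2))"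
      using merge_copies by metis
    then show ?thesis using n(1) by simp
  qed
  then show ?case using add.IH[of "add_mset n M"] add.prems(1) by simp
qed simp

lemma sum_pairs_needed:
  "\<forall>n\<in>#L. 2 \<le> n \<Longrightarrow> sum_mset L = 3 * size (filter_mset odd L) + 2 * (\<Sum>n\<in>#L. pairs_needed n)"
proof (induction L)
  case (add n L)
  then have "n = (if odd n then 3 else 0) + 2 * pairs_needed n"
    by (auto simp: pairs_needed_def elim!: oddE)
  then show ?case using add by (auto split: if_splits)
qed simp

lemma packable_of_triples_and_pairs:
  assumes "\<forall>n\<in>#L. 2 \<le> n" "packable U (replicate_mset (size (filter_mset odd L)) 3 + replicate_mset p 2)"
    "sum_mset L \<le> 3 * size (filter_mset odd L) + 2 * p"
  shows "packable U L"
proof -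
  have "(\<Sum>n\<in>#L. pairs_needed n) \<le> p" using sum_pairs_needed[OF assms(1)] assms(3) by linarith
  then have "replicate_mset (size (filter_mset odd L)) 3 + replicate_mset (\<Sum>n\<in>#L. pairs_needed n) 2
      \<subseteq># replicate_mset (size (filter_mset odd L)) 3 + replicate_mset p (2::nat)"
    by (intro mset_subset_eqI) simp
  then have "packable U (replicate_mset (size (filter_mset odd L)) 3
      + replicate_mset (\<Sum>n\<in>#L. pairs_needed n) 2)"
    by (rule packable_subset_mset[OF assms(2)])
  then show ?thesis using packable_of_triples_and_pairs_exact[OF assms(1), of U "{#}"] by simp
qed

definition short_sizes :: "nat \<Rightarrow> nat \<Rightarrow> nat \<Rightarrow> nat \<Rightarrow> nat multiset" where
  "short_sizes n4 n5 n6 n7 =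
     replicate_mset n4 4 + replicate_mset n5 5 + replicate_mset n6 6 + replicate_mset n7 7"

lemma short_sizes_props:
  "\<forall>n\<in>#short_sizes n4 n5 n6 n7. 2 \<le> n"
  "size (filter_mset odd (short_sizes n4 n5 n6 n7)) = n5 + n7"
  "sum_mset (short_sizes n4 n5 n6 n7) = 4 * n4 + 5 * n5 + 6 * n6 + 7 * n7"
proof -
  have "filter_mset odd (replicate_mset n (k::nat)) = (if odd k then replicate_mset n k else {#})" for n k
    by (induction n) auto
  then show "size (filter_mset odd (short_sizes n4 n5 n6 n7)) = n5 + n7" by (simp add: short_sizes_def)
qed (auto simp: short_sizes_def split: if_splits)

lemma reduce_to_short_sizes:
  "\<forall>n\<in>#L. 4 \<le> n \<Longrightarrow> \<exists>n4 n5 n6 n7. 4 * n4 + 5 * n5 + 6 * n6 + 7 * n7 = sum_mset L \<and>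
    (\<forall>(U :: 'g::ab_group_add set) M. packable U (M + short_sizes n4 n5 n6 n7) \<longrightarrow> packable U (M + L))"
proof (induction L)
  case empty
  show ?case by (intro exI[of _ 0]) (simp add: short_sizes_def)
next
  case (add n L)
  then obtain n4 n5 n6 n7 where IH: "4 * n4 + 5 * n5 + 6 * n6 + 7 * n7 = sum_mset L"
    "\<And>(U :: 'g set) M. packable U (M + short_sizes n4 n5 n6 n7) \<Longrightarrow> packable U (M + L)" by auto
  define q c where "q = n div 4 - 1" and "c = 4 + n mod 4"
  have "4 \<le> n" using add.prems by simp
  then have n: "n = c + q * 4" unfolding q_def c_def by presburger
  have "n mod 4 < 4" by simp
  then have c: "c \<in> {4, 5, 6, 7}" unfolding c_def by auto
  have merge: "packable U (M + add_mset n L)"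
    if "packable U (M + (add_mset c (replicate_mset q 4) + short_sizes n4 n5 n6 n7))" for U :: "'g set" and M
  proof -
    have "packable U (add_mset c ((M + short_sizes n4 n5 n6 n7) + replicate_mset q 4))"
      using that by (simp add: ac_simps)
    then have "packable U (add_mset n M + short_sizes n4 n5 n6 n7)" unfolding n
      using merge_copies by fastforce
    from IH(2)[OF this] show ?thesis by simp
  qed
  define e where "e k = (if c = k then 1 else 0 :: nat)" for k :: nat
  show ?case
  proof (intro exI conjI allI impI)
    show "4 * (n4 + q + e 4) + 5 * (n5 + e 5) + 6 * (n6 + e 6) + 7 * (n7 + e 7) = sum_mset (add_mset n L)"
      using IH(1) n c by (auto simp: e_def)
    fix U :: "'g set" and M
    have "short_sizes (n4 + q + e 4) (n5 + e 5) (n6 + e 6) (n7 + e 7)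
        = add_mset c (replicate_mset q 4) + short_sizes n4 n5 n6 n7"
      using c by (intro multiset_eqI) (auto simp: short_sizes_def e_def)
    moreover assume "packable U (M + short_sizes (n4 + q + e 4) (n5 + e 5) (n6 + e 6) (n7 + e 7))"
    ultimately show "packable U (M + add_mset n L)" using merge by simp
  qed
qed

text \<open>
  A coset can serve a four, a six or a seven, and three cosets can serve two sixes. If possible,
  all cosets are used; then the pairs suffice because of the total size. If cosets are left over, no
  pair is needed except for the fives and at most one six.
\<close>

lemma (in klein_subgroup) pack_quads_triples_pairs:
  assumes V: "packable V (replicate_mset (n5 + n7) 3 + replicate_mset p 2)"
    and \<P>: "pool \<P>" "\<Union>\<P> \<inter> V = {}"
    and total: "4 * n4 + 5 * n5 + 6 * n6 + 7 * n7 \<le> 3 * (n5 + n7) + 2 * p + 4 * card \<P>"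
    and p: "n5 + 1 \<le> p"
  shows "packable (V \<union> \<Union>\<P>) (short_sizes n4 n5 n6 n7)"
proof -
  define Q where "Q = card \<P>"
  \<comment> \<open>\<open>s4\<close>, \<open>s6\<close>, \<open>s7\<close> count the sets that contain one coset, \<open>h\<close> the pairs of sixes made of three cosets.\<close>
  obtain s4 s6 s7 h where s: "s4 \<le> n4" "s7 \<le> n7" "s6 + 2 * h \<le> n6" "s4 + s6 + s7 + 3 * h \<le> Q"
    "2 * (n4 - s4) + n5 + 3 * (n6 - s6 - 2 * h) + s6 + 2 * (n7 - s7) \<le> p"
  proof (cases "Q \<le> n4 + n6 + n7")
    case True
    define s4 s7 s6 where "s4 = min n4 Q" and "s7 = min n7 (Q - s4)" and "s6 = Q - s4 - s7"
    have "s4 \<le> n4" "s7 \<le> n7" "s6 \<le> n6" "s4 + s6 + s7 = Q" using True by (auto simp: s4_def s7_def s6_def)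
    then show thesis using that[of s4 s7 s6 0] total by (auto simp: Q_def)
  next
    case False
    define h where "h = min (n6 div 2) (Q - n4 - n7 - n6)"
    have h: "2 * h \<le> n6" "n4 + n7 + n6 + h \<le> Q" using False by (auto simp: h_def)
    have "n5 + (n6 - 2 * h) \<le> p"
    proof (cases "h = n6 div 2")
      case True
      then have "n6 - 2 * h \<le> 1" by presburger
      then show ?thesis using p by linarith
    next
      case False2: False
      then have "h = Q - n4 - n7 - n6" by (auto simp: h_def min_def split: if_splits)
      then show ?thesis using total h False by (simp add: Q_def)
    qed
    then show thesis using that[of n4 n7 "n6 - 2 * h" h] h by auto
  qed
  define rest where "rest = replicate_mset (n4 - s4) 4 + replicate_mset n5 5 + replicate_mset (n6 - s6 - 2 * h) 6
    + replicate_mset s6 2 + replicate_mset (n7 - s7) 7 + replicate_mset s7 (3::nat)"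
  have fil: "filter_mset odd (replicate_mset n (k::nat)) = (if odd k then replicate_mset n k else {#})" for n k
    by (induction n) auto
  have odd: "size (filter_mset odd rest) = n5 + n7" using s(2) by (simp add: rest_def fil)
  have "packable V rest"
  proof (rule packable_of_triples_and_pairs[of _ _ p])
    show "\<forall>n\<in>#rest. 2 \<le> n" by (auto simp: rest_def split: if_splits)
    show "packable V (replicate_mset (size (filter_mset odd rest)) 3 + replicate_mset p 2)"
      unfolding odd by (rule V)
    have "sum_mset rest = 4 * (n4 - s4) + 5 * n5 + 6 * (n6 - s6 - 2 * h) + 2 * s6 + 7 * (n7 - s7) + 3 * s7"
      by (simp add: rest_def)
    then show "sum_mset rest \<le> 3 * size (filter_mset odd rest) + 2 * p"
      unfolding odd using s(2,5) by simp
  qed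
  moreover obtain \<Q> where \<Q>: "\<Q> \<subseteq> \<P>" "card \<Q> = s4 + s6 + s7 + 3 * h"
    using s(4) unfolding Q_def by (metis obtain_subset_with_card_n)
  then have "packable (\<Union>\<Q>) (replicate_mset (s4 + s6 + s7) 4 + replicate_mset (2 * h) 6)"
    using pool_packable pool_subset[OF \<P>(1)] by blast
  moreover have "V \<inter> \<Union>\<Q> = {}" using \<P>(2) \<Q>(1) by blast
  ultimately have "packable (V \<union> \<Union>\<Q>) (rest + (replicate_mset (s4 + s6 + s7) 4 + replicate_mset (2 * h) 6))"
    by (rule packable_union)
  moreover define base :: "nat multiset" where "base = replicate_mset (n4 - s4) 4 + replicate_mset n5 5
    + replicate_mset (n6 - s6 - 2 * h) 6 + replicate_mset (n7 - s7) 7 + replicate_mset s4 4 + replicate_mset (2 * h) 6"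
  moreover have "rest + (replicate_mset (s4 + s6 + s7) 4 + replicate_mset (2 * h) 6)
      = (base + replicate_mset s7 3 + replicate_mset s7 4) + replicate_mset s6 2 + replicate_mset s6 4"
    by (intro multiset_eqI) (simp add: rest_def base_def)
  ultimately have "packable (V \<union> \<Union>\<Q>) ((base + replicate_mset s7 3 + replicate_mset s7 4)
      + replicate_mset s6 2 + replicate_mset s6 4)"
    by simp
  from merge_all[OF this] have "packable (V \<union> \<Union>\<Q>) ((base + replicate_mset s6 6)
      + replicate_mset s7 3 + replicate_mset s7 4)"
    by (simp add: ac_simps)
  from merge_all[OF this] have "packable (V \<union> \<Union>\<Q>) (base + replicate_mset s6 6 + replicate_mset s7 7)"
    by simp
  moreover have "base + replicate_mset s6 6 + replicate_mset s7 7 = short_sizes n4 n5 n6 n7"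
    using s by (intro multiset_eqI) (simp add: base_def short_sizes_def)
  ultimately have "packable (V \<union> \<Union>\<Q>) (short_sizes n4 n5 n6 n7)" by simp
  then show ?thesis by (rule packable_mono) (use \<Q>(1) in blast)
qed

lemma packable_zero_filler:
  assumes "0 \<notin> U" "packable U (add_mset k M)"
  shows "packable (insert 0 U) (add_mset (Suc k) M)"
proof -
  have "packable {0} {#1#}" using packable_single[of "{0}"] by simp
  then have "packable ({0} \<union> U) ({#1#} + add_mset k M)" using assms by (intro packable_union) auto
  then have "packable (insert 0 U) (add_mset 1 (add_mset k M))" by (simp add: add_mset_commute)
  from packable_merge[OF this] show ?thesis by simp
qed

text \<open>
  One of the odd sizes is lowered by one, and the element 0 is added to the resulting set.
\<close>

lemma absorb_odd_size:
  assumes "0 < n5 + n7"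
  shows "\<exists>k4 k5 k6 k7. k5 + k7 + 1 = n5 + n7 \<and>
    4 * k4 + 5 * k5 + 6 * k6 + 7 * k7 + 1 = 4 * n4 + 5 * n5 + 6 * n6 + 7 * n7 \<and>
    (\<forall>U :: 'g::ab_group_add set. 0 \<notin> U \<longrightarrow> packable U (short_sizes k4 k5 k6 k7) \<longrightarrow>
      packable (insert 0 U) (short_sizes n4 n5 n6 n7))"
proof (cases "0 < n5")
  case True
  then obtain k5 where k5: "n5 = Suc k5" by (cases n5) auto
  have "short_sizes (Suc n4) k5 n6 n7 = add_mset 4 (short_sizes n4 k5 n6 n7)"
    "short_sizes n4 n5 n6 n7 = add_mset (Suc 4) (short_sizes n4 k5 n6 n7)"
    by (simp_all add: short_sizes_def k5)
  then have "\<forall>U :: 'g set. 0 \<notin> U \<longrightarrow> packable U (short_sizes (Suc n4) k5 n6 n7) \<longrightarrow>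
      packable (insert 0 U) (short_sizes n4 n5 n6 n7)" using packable_zero_filler by metis
  then show ?thesis by (intro exI[of _ "Suc n4"] exI[of _ k5] exI[of _ n6] exI[of _ n7]) (simp add: k5)
next
  case False
  then obtain k7 where k7: "n7 = Suc k7" using assms by (cases n7) auto
  have "short_sizes n4 n5 (Suc n6) k7 = add_mset 6 (short_sizes n4 n5 n6 k7)"
    "short_sizes n4 n5 n6 n7 = add_mset (Suc 6) (short_sizes n4 n5 n6 k7)"
    by (simp_all add: short_sizes_def k7)
  then have "\<forall>U :: 'g set. 0 \<notin> U \<longrightarrow> packable U (short_sizes n4 n5 (Suc n6) k7) \<longrightarrow>
      packable (insert 0 U) (short_sizes n4 n5 n6 n7)" using packable_zero_filler by metis
  then show ?thesis by (intro exI[of _ n4] exI[of _ n5] exI[of _ "Suc n6"] exI[of _ k7]) (simp add: k7)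
qed

text \<open>
  The number of triples in use is even if they come from opposite couples alone, and odd if all the
  lines in the involutions are used, because the number of lines is odd. If this is not the parity of
  the number of odd sizes, the element 0 is used for one of them. Using all the lines
  leaves at most four involutions unused, few enough for the density condition on the unused
  elements outside. If there are fewer odd sizes than lines, couples outside the involutions
  suffice and the involutions are cut into cosets of a Klein four-subgroup.
\<close>

lemma packable_without_square_klein_subgroup:
  assumes no: "\<not> (\<exists>a b :: 'g::{finite, ab_group_add}. square_klein_subgroup a b)"
    and n: "4 * n4 + 5 * n5 + 6 * n6 + 7 * n7 + 6 \<le> CARD('g)"
  shows "packable (UNIV :: 'g set) (short_sizes n4 n5 n6 n7)"
proof -
  let ?I = "involutions :: 'g set"
  define w where "w = card ?I"
  have index: "3 \<le> card (range (\<lambda>x::'g. x + x))" by (rule index_at_least_three[OF no]) (use n in linarith)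
  have cN: "card (- ?I) = CARD('g) - w" by (simp add: Compl_eq_Diff_UNIV card_Diff_subset w_def)
  have w1: "1 \<le> w" using card_mono[of ?I "{0}"] by (simp add: w_def)
  have m: "CARD('g) = 3 * w \<or> 4 * w \<le> CARD('g)"
  proof -
    have "CARD('g) = w * card (range (\<lambda>x::'g. x + x))" using card_involutions_index by (simp add: w_def)
    moreover have "w * 4 \<le> w * card (range (\<lambda>x::'g. x + x))" if "4 \<le> card (range (\<lambda>x::'g. x + x))"
      using that by (rule mult_le_mono2)
    ultimately show ?thesis using index by (cases "card (range (\<lambda>x::'g. x + x)) = 3") auto
  qed
  have doubles: "packable (- ?I) (replicate_mset (2 * k) 3
      + replicate_mset ((CARD('g) - w - 6 * k) div 2) 2)"
    if room: "\<And>i. Suc i = k \<Longrightarrow> 2 * CARD('g) + 23 \<le> 5 * (CARD('g) - w - 6 * i) \<or>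
      CARD('g) = 3 * w \<and> w + 3 \<le> CARD('g) - w - 6 * i" for k
  proof -
    have "\<exists>D :: ('g \<times> 'g \<times> 'g) set. opp.family D \<and> card D = k"
      by (rule opposite_triples_exist[OF no index]) (use room in \<open>simp add: cN w_def[symmetric]\<close>)
    then obtain D :: "('g \<times> 'g \<times> 'g) set" where "opp.family D" "card D = k" by blast
    then show ?thesis using opposite_triples_packable[of D] by (simp add: cN)
  qed
  have few: "packable (U :: 'g set) (short_sizes k4 k5 k6 k7)"
    if "packable (- ?I) (replicate_mset (k5 + k7) 3 + replicate_mset p 2)" "- ?I \<subseteq> U"
      "4 * k4 + 5 * k5 + 6 * k6 + 7 * k7 \<le> 3 * (k5 + k7) + 2 * p" for U k4 k5 k6 k7 p
    using packable_mono[OF packable_of_triples_and_pairs[of "short_sizes k4 k5 k6 k7" "- ?I" p] that(2)]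
      that(1,3) short_sizes_props[of k4 k5 k6 k7] by simp
  consider "w \<le> 4" | F :: "'g set set" where "4 < w" "line_packing ?I F" "odd (card F)"
      "3 * card F + 1 = w \<or> 3 * card F + 5 = w" "card F \<le> n5 + n7"
    | F :: "'g set set" where "4 < w" "3 * card F + 1 = w \<or> 3 * card F + 5 = w" "n5 + n7 < card F" "odd (card F)"
  proof (cases "w \<le> 4")
    case False
    then obtain F where F: "line_packing ?I F" "odd (card F)" "3 * card F + 1 = w \<or> 3 * card F + 5 = w"
      using involutions_line_packing[where 'g = 'g] unfolding w_def by auto
    show thesis
    proof (cases "card F \<le> n5 + n7")
      case True
      then show thesis using False F by (intro that(2)) auto
    next
      case less: False
      show thesis by (rule that(3)[of F]) (use False F less in auto)
    qed
  qed (rule that(1))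
  then show ?thesis
  proof cases
    case 1
    have main: "packable (- ?I) (short_sizes k4 k5 k6 k7)"
      if "even (k5 + k7)" "4 * k4 + 5 * k5 + 6 * k6 + 7 * k7 + 6 \<le> CARD('g)" for k4 k5 k6 k7
    proof -
      note even = that(1)
      obtain k where k: "k5 + k7 = 2 * k" using even by blast
      have 5: "10 * k + 6 \<le> CARD('g)" using that(2) k by linarith
      have "packable (- ?I) (replicate_mset (2 * k) 3 + replicate_mset ((CARD('g) - w - 6 * k) div 2) 2)"
      proof (rule doubles)
        show "2 * CARD('g) + 23 \<le> 5 * (CARD('g) - w - 6 * i) \<or>
          CARD('g) = 3 * w \<and> w + 3 \<le> CARD('g) - w - 6 * i" if "Suc i = k" for i
          using 5 1 that by auto
      qed
      moreover have "4 * k4 + 5 * k5 + 6 * k6 + 7 * k7 \<le> 3 * (k5 + k7) + 2 * ((CARD('g) - w - 6 * k) div 2)"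
      proof -
        have "CARD('g) \<le> w + 6 * k + 2 * ((CARD('g) - w - 6 * k) div 2) + 1" by linarith
        then show ?thesis using that(2) 1 unfolding k by simp
      qed
      ultimately show ?thesis using few[of k5 k7] k by simp
    qed
    show ?thesis
    proof (cases "even (n5 + n7)")
      case True
      from packable_mono[OF main[OF True n]] show ?thesis by simp
    next
      case False
      then have "0 < n5 + n7" by (cases "n5 + n7") auto
      from absorb_odd_size[OF this, where 'g = 'g and ?n4.0 = n4 and ?n6.0 = n6] obtain k4 k5 k6 k7 where k': "k5 + k7 + 1 = n5 + n7 \<and>
        4 * k4 + 5 * k5 + 6 * k6 + 7 * k7 + 1 = 4 * n4 + 5 * n5 + 6 * n6 + 7 * n7 \<and>
        (\<forall>U :: 'g set. 0 \<notin> U \<longrightarrow> packable U (short_sizes k4 k5 k6 k7) \<longrightarrow>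
          packable (insert 0 U) (short_sizes n4 n5 n6 n7))"
        by (elim exE) (rule that)
      note k = conjunct1[OF k'] conjunct1[OF conjunct2[OF k']] conjunct2[OF conjunct2[OF k'], rule_format]
      have "packable (- ?I) (short_sizes k4 k5 k6 k7)"
      proof (rule main)
        show "even (k5 + k7)" using False k(1)[symmetric] by simp
        show "4 * k4 + 5 * k5 + 6 * k6 + 7 * k7 + 6 \<le> CARD('g)" using k(2) n by linarith
      qed
      from packable_mono[OF k(3)[OF _ this] subset_UNIV] show ?thesis by simp
    qed
  next
    case (2 F)
    have main: "packable (- {0} :: 'g set) (short_sizes k4 k5 k6 k7)"
      if "odd (k5 + k7)" "card F \<le> k5 + k7" "4 * k4 + 5 * k5 + 6 * k6 + 7 * k7 + 6 \<le> CARD('g)" for k4 k5 k6 k7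
    proof -
      have "even (k5 + k7 - card F)" using that(1,2) 2(3) by simp
      then obtain k where "k5 + k7 - card F = 2 * k" by blast
      then have k: "k5 + k7 = card F + 2 * k" using that(2) by linarith
      have 5: "5 * (card F + 2 * k) + 6 \<le> CARD('g)" using that(3) unfolding k[symmetric] by simp
      have "packable (- ?I) (replicate_mset (2 * k) 3 + replicate_mset ((CARD('g) - w - 6 * k) div 2) 2)"
      proof (rule doubles)
        show "2 * CARD('g) + 23 \<le> 5 * (CARD('g) - w - 6 * i) \<or>
          CARD('g) = 3 * w \<and> w + 3 \<le> CARD('g) - w - 6 * i" if "Suc i = k" for i
          using 5 2(4) that by auto
      qed
      from packable_union[OF lines_of_involutions_packable[OF 2(2)] this]
      have "packable ((?I - {0}) \<union> - ?I) (replicate_mset (card F) 3 + (replicate_mset (2 * k) 3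
          + replicate_mset ((CARD('g) - w - 6 * k) div 2) 2))" by blast
      moreover have "replicate_mset (card F) 3 + (replicate_mset (2 * k) 3
          + replicate_mset ((CARD('g) - w - 6 * k) div 2) (2::nat))
        = replicate_mset (k5 + k7) 3 + replicate_mset ((CARD('g) - w - 6 * k) div 2) 2"
        unfolding k by (intro multiset_eqI) simp
      moreover have "(?I - {0}) \<union> - ?I = - {0}" using zero_involution by blast
      ultimately have "packable (- {0} :: 'g set) (replicate_mset (k5 + k7) 3
          + replicate_mset ((CARD('g) - w - 6 * k) div 2) 2)" by metis
      moreover have "4 * k4 + 5 * k5 + 6 * k6 + 7 * k7 \<le> 3 * (k5 + k7) + 2 * ((CARD('g) - w - 6 * k) div 2)"
      proof -
        have "CARD('g) \<le> w + 6 * k + 2 * ((CARD('g) - w - 6 * k) div 2) + 1" by linarith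
        moreover have "w \<le> 3 * card F + 5" using 2(4) by linarith
        ultimately show ?thesis using that(3) unfolding k by simp
      qed
      ultimately show ?thesis
        using packable_of_triples_and_pairs[of "short_sizes k4 k5 k6 k7"] short_sizes_props by metis
    qed
    show ?thesis
    proof (cases "odd (n5 + n7)")
      case True
      from packable_mono[OF main[OF True 2(5) n]] show ?thesis by simp
    next
      case False
      then have "card F \<noteq> n5 + n7" using 2(3) by auto
      then have F: "card F + 1 \<le> n5 + n7" using 2(5) by simp
      then have "0 < n5 + n7" by linarith
      from absorb_odd_size[OF this, where 'g = 'g and ?n4.0 = n4 and ?n6.0 = n6] obtain k4 k5 k6 k7 where k': "k5 + k7 + 1 = n5 + n7 \<and>
        4 * k4 + 5 * k5 + 6 * k6 + 7 * k7 + 1 = 4 * n4 + 5 * n5 + 6 * n6 + 7 * n7 \<and>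
        (\<forall>U :: 'g set. 0 \<notin> U \<longrightarrow> packable U (short_sizes k4 k5 k6 k7) \<longrightarrow>
          packable (insert 0 U) (short_sizes n4 n5 n6 n7))"
        by (elim exE) (rule that)
      note k = conjunct1[OF k'] conjunct1[OF conjunct2[OF k']] conjunct2[OF conjunct2[OF k'], rule_format]
      have "odd (k5 + k7)" "card F \<le> k5 + k7" using False k(1)[symmetric] F by simp_all
      then have "packable (- {0} :: 'g set) (short_sizes k4 k5 k6 k7)" by (rule main) (use k n in linarith)
      from packable_mono[OF k(3)[OF _ this] subset_UNIV] show ?thesis by simp
    qed
  next
    case (3 F)
    obtain a b :: 'g where gens: "a \<in> ?I" "b \<in> ?I" "a \<noteq> 0" "b \<noteq> 0" "a \<noteq> b"
    proof -
      have pick: "\<exists>x. x \<in> ?I \<and> x \<notin> X" if "card X \<le> 2" for X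
        using exists_outside[of X ?I] that 3(1) by (simp add: w_def)
      obtain a where a: "a \<in> ?I" "a \<noteq> 0" using pick[of "{0}"] by auto
      have "card {0, a} \<le> 2" by (simp add: card_insert_if)
      then obtain b where "b \<in> ?I" "b \<notin> {0, a}" using pick by blast
      then show thesis using that[of a b] a by auto
    qed
    interpret klein_subgroup a b using gens by unfold_locales (auto simp: mem_involutions)
    have K: "K \<subseteq> ?I" using gens add_involutions by (auto simp: K_def)
    have coset_I: "coset x \<subseteq> ?I" if "x \<in> ?I" for x
      using K add_involutions that by (auto simp: coset_def)
    define \<P> where "\<P> = coset ` ?I"
    have pool: "pool \<P>" by (auto simp: \<P>_def pool_def mem_involutions)
    have cover: "\<Union>\<P> = ?I" using coset_I coset_self unfolding \<P>_def by blast
    have "card (\<Union>\<P>) = (\<Sum>X\<in>\<P>. card X)"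
      using pool_disjoint[OF pool] by (intro card_Union_disjoint) (auto simp: pairwise_def disjnt_def)
    also have "\<dots> = (\<Sum>X\<in>\<P>. 4)" by (intro sum.cong) (auto simp: \<P>_def card_coset)
    finally have cP: "w = 4 * card \<P>" using cover by (simp add: w_def)
    have KP: "K \<in> \<P>" unfolding \<P>_def coset_zero[symmetric] using zero_involution by (rule imageI)
    have zero_free: "0 \<notin> - ?I \<union> \<Union>(\<P> - {K})"
    proof -
      have "X \<inter> K = {}" if "X \<in> \<P> - {K}" for X using pool_disjoint[OF pool, of X K] KP that by blast
      then have "0 \<notin> X" if "X \<in> \<P> - {K}" for X using zero_K that by blast
      then show ?thesis by auto
    qed
    have main: "packable (- ?I \<union> \<Union>\<Q>) (short_sizes k4 k5 k6 k7)"
      if "even (k5 + k7)" "k5 + k7 < card F" "\<Q> \<subseteq> \<P>"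
        "4 * k4 + 5 * k5 + 6 * k6 + 7 * k7 + w + 1 \<le> CARD('g) + 4 * card \<Q>" for \<Q> k4 k5 k6 k7
    proof -
      note even = that(1)
      obtain k where k: "k5 + k7 = 2 * k" using even by blast
      have kw: "6 * k + 4 \<le> w" using that(2) 3(2) k by linarith
      define p where "p = (CARD('g) - w - 6 * k) div 2"
      have "packable (- ?I) (replicate_mset (2 * k) 3 + replicate_mset p 2)"
        unfolding p_def
      proof (rule doubles)
        show "2 * CARD('g) + 23 \<le> 5 * (CARD('g) - w - 6 * i) \<or>
          CARD('g) = 3 * w \<and> w + 3 \<le> CARD('g) - w - 6 * i" if "Suc i = k" for i
          using m kw that by auto
      qed
      then have "packable (- ?I) (replicate_mset (k5 + k7) 3 + replicate_mset p 2)" using k by simp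
      moreover have "pool \<Q>" using pool_subset[OF pool that(3)] .
      moreover have "\<Union>\<Q> \<inter> - ?I = {}" using cover that(3) by blast
      moreover have "CARD('g) \<le> w + 6 * k + 2 * p + 1" unfolding p_def by linarith
      then have "4 * k4 + 5 * k5 + 6 * k6 + 7 * k7 \<le> 3 * (k5 + k7) + 2 * p + 4 * card \<Q>"
        using that(4) unfolding k by simp
      moreover have "k5 + 1 \<le> p"
      proof -
        have "3 * w \<le> CARD('g)" using m by auto
        then have "w \<le> 2 * p + 1" using kw unfolding p_def by linarith
        then show ?thesis using kw k by linarith
      qed
      ultimately show ?thesis by (rule pack_quads_triples_pairs)
    qed
    show ?thesis
    proof (cases "even (n5 + n7)")
      case True
      have "packable (- ?I \<union> \<Union>\<P>) (short_sizes n4 n5 n6 n7)"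
        by (rule main[OF True 3(3)]) (use n cP in auto)
      then show ?thesis by (rule packable_mono) simp
    next
      case False
      then have "0 < n5 + n7" by (cases "n5 + n7") auto
      from absorb_odd_size[OF this, where 'g = 'g and ?n4.0 = n4 and ?n6.0 = n6] obtain k4 k5 k6 k7 where k': "k5 + k7 + 1 = n5 + n7 \<and>
        4 * k4 + 5 * k5 + 6 * k6 + 7 * k7 + 1 = 4 * n4 + 5 * n5 + 6 * n6 + 7 * n7 \<and>
        (\<forall>U :: 'g set. 0 \<notin> U \<longrightarrow> packable U (short_sizes k4 k5 k6 k7) \<longrightarrow>
          packable (insert 0 U) (short_sizes n4 n5 n6 n7))"
        by (elim exE) (rule that)
      note k = conjunct1[OF k'] conjunct1[OF conjunct2[OF k']] conjunct2[OF conjunct2[OF k'], rule_format]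
      have cQ: "card (\<P> - {K}) = card \<P> - 1" "1 \<le> card \<P>" using KP cP w1 by auto
      have "even (k5 + k7)" "k5 + k7 < card F" using False k(1)[symmetric] 3(3) by simp_all
      then have "packable (- ?I \<union> \<Union>(\<P> - {K})) (short_sizes k4 k5 k6 k7)"
        by (rule main) (use n k cP cQ in auto)
      then have "packable (insert 0 (- ?I \<union> \<Union>(\<P> - {K}))) (short_sizes n4 n5 n6 n7)"
        by (rule k(3)[OF zero_free])
      then show ?thesis by (rule packable_mono) simp
    qed
  qed
qed

theorem packable_sizes_at_least_four:
  assumes "\<forall>n\<in>#L. 4 \<le> n" "sum_mset L + 6 \<le> CARD('g::{finite, ab_group_add})"
  shows "packable (UNIV :: 'g set) L"
proof -
  obtain n4 n5 n6 n7 where n: "4 * n4 + 5 * n5 + 6 * n6 + 7 * n7 = sum_mset L"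
    "\<And>(U :: 'g set) M. packable U (M + short_sizes n4 n5 n6 n7) \<Longrightarrow> packable U (M + L)"
    using reduce_to_short_sizes[OF assms(1), where 'g = 'g] by blast
  have "packable (UNIV :: 'g set) (short_sizes n4 n5 n6 n7)"
  proof (cases "\<exists>a b :: 'g. square_klein_subgroup a b")
    case True
    then obtain a b :: 'g where "square_klein_subgroup a b" by blast
    then interpret square_klein_subgroup a b .
    show ?thesis unfolding short_sizes_def by (rule square_klein_packable) (use n assms in simp)
  next
    case False
    then show ?thesis by (rule packable_without_square_klein_subgroup) (use n assms in simp)
  qed
  then show ?thesis using n(2)[of UNIV "{#}"] by simp
qed

theorem corollary3p6:
  fixes G :: "'v pair_pre_digraph" and n :: nat
  assumes "pair_fin_digraph G"
    and "card (pverts G) = n"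
    and "\<And>C. C \<in> weak_components G \<Longrightarrow> card C \<ge> 4"
    and "CARD('g::{finite, ab_group_add}) \<ge> n + 6"
  shows "\<exists>\<psi> :: 'v \<times> 'v \<Rightarrow> 'g. irregular_labeling G \<psi>"
proof -
  interpret pair_fin_digraph G by fact
  let ?C = "weak_components G"
  interpret H: pair_fin_digraph "mk_symmetric (with_proj G)" ..
  have fin: "finite ?C" using H.finite_sccs_verts by (simp add: weak_components_def)
  have sub: "C \<subseteq> pverts G" if "C \<in> ?C" for C
    using H.sccs_verts_subsets[of C] that by (simp add: weak_components_def)
  have finC: "finite C" if "C \<in> ?C" for C using sub[OF that] finite_subset by fastforce
  have disj: "C \<inter> D = {}" if "C \<in> ?C" "D \<in> ?C" "C \<noteq> D" for C D
    using H.sccs_verts_disjoint that by (auto simp: weak_components_def)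
  have cover: "\<exists>C\<in>?C. x \<in> C" if "x \<in> pverts G" for x
    using H.scc_of_in_sccs_verts[of x] H.in_scc_of_self[of x] that
    by (auto simp: weak_components_def)
  have "(\<Sum>C\<in>?C. card C) = card (\<Union>?C)"
    using fin finC disj by (intro card_Union_disjoint[symmetric]) (auto simp: pairwise_def disjnt_def)
  also have "\<Union>?C = pverts G" using sub cover by blast
  finally have total: "(\<Sum>C\<in>?C. card C) = n" using assms(2) by simp
  have "packable (UNIV :: 'g set) (image_mset card (mset_set ?C))"
    by (rule packable_sizes_at_least_four)
      (use fin assms(3,4) total in \<open>auto simp: sum_unfold_sum_mset[symmetric]\<close>)
  from packable_assignment[OF fin this] obtain S :: "'v set \<Rightarrow> 'g set" where
    S': "\<forall>C\<in>?C. S C \<subseteq> UNIV \<and> finite (S C) \<and> card (S C) = card C \<and> \<Sum>(S C) = 0"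
      "\<forall>C\<in>?C. \<forall>D\<in>?C. C \<noteq> D \<longrightarrow> S C \<inter> S D = {}"
    by blast
  then have S: "\<And>C. C \<in> ?C \<Longrightarrow> finite (S C) \<and> card (S C) = card C \<and> \<Sum>(S C) = 0"
      "\<And>C D. C \<in> ?C \<Longrightarrow> D \<in> ?C \<Longrightarrow> C \<noteq> D \<Longrightarrow> S C \<inter> S D = {}"
    by blast+
  have "\<exists>f. bij_betw f C (S C)" if "C \<in> ?C" for C
    using finite_same_card_bij[OF finC[OF that]] S(1)[OF that] by metis
  then obtain f where f: "\<And>C. C \<in> ?C \<Longrightarrow> bij_betw (f C) C (S C)" by metis
  obtain c where c: "\<And>x. x \<in> pverts G \<Longrightarrow> c x \<in> ?C \<and> x \<in> c x" using cover by metis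
  have c_eq: "c x = C" if "C \<in> ?C" "x \<in> C" for x C
    using c[of x] disj[of "c x" C] that sub by blast
  define w where "w x = f (c x) x" for x
  have "sum w C = 0" if C: "C \<in> ?C" for C
  proof -
    have "sum w C = sum (f C) C" using c_eq[OF C] by (intro sum.cong) (auto simp: w_def)
    also have "\<dots> = \<Sum>(S C)" using sum.reindex_bij_betw[OF f[OF C], of "\<lambda>x. x"] by simp
    finally show ?thesis using S(1)[OF C] by simp
  qed
  then obtain \<psi> where \<psi>: "\<forall>x\<in>pverts G. vertex_sum G \<psi> x = w x"
    using prescribed_vertex_sums[OF assms(1)] by blast
  have "inj_on w (pverts G)"
  proof (rule inj_onI)
    fix x y assume xy: "x \<in> pverts G" "y \<in> pverts G" "w x = w y"
    have "w x \<in> S (c x)" "w y \<in> S (c y)"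
      using f c xy(1,2) by (auto simp: w_def dest: bij_betwE)
    then have "c x = c y" using S(2)[of "c x" "c y"] c xy by auto
    then show "x = y" using f[of "c x"] c[OF xy(1)] c[OF xy(2)] xy(3)
      by (auto simp: w_def bij_betw_def dest: inj_onD)
  qed
  then have "inj_on (vertex_sum G \<psi>) (pverts G)" using \<psi> by (simp cong: inj_on_cong)
  then show ?thesis unfolding irregular_labeling_def by blast
qed

end
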